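(* The space of $\mathrm{Spin}(7)$-invariant affine (or metric) connections on the 7-sphere $S^{7}=\mathrm{Spin}(7)/G_2$ is 1-dimensional; it consists of the family $\{\nabla^{\alpha}:\alpha\in\mathbb{R}\}$ of invariant connections with Nomizu map $\Lambda^{\alpha}(X)Y=\frac{1-\alpha}{2}[X,Y]_{\mathfrak{m}}$, $X,Y\in\mathfrak{m}$; that is, $\dim_{\mathbb{R}}\mathfrak{aff}_{\mathrm{Spin}(7)}(F(S^{7}))=1$. Similarly, the space of $G_2$-invariant affine (or metric) connections on the sphere $S^{6}=G_2/SU(3)$ consists of the same family $\nabla^{\alpha}$, with $\Lambda^{\alpha}(X)Y=\frac{1-\alpha}{2}[X,Y]_{\mathfrak{m}}$, but in this case the parameter $\alpha$ is a complex number, $\alpha\in\mathbb{C}$. Hence $\dim_{\mathbb{R}}\mathfrak{aff}_{G_{2}}(F(S^{6}))=2$.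
   Context: For a homogeneous space $M=G/K$ with $\mathrm{Ad}(K)$-invariant (reductive) decomposition $\mathfrak{g}=\mathfrak{k}\oplus\mathfrak{m}$, $\mathfrak{m}\cong T_oM$, let $\mathfrak{aff}_G(F(G/K))$ denote the space of $G$-invariant affine (linear) connections on $M$ (connections on the frame bundle $F(G/K)$). By Wang's theorem it is identified with $\mathrm{Hom}^{\mathbb{R}}_K(\mathfrak{m}\otimes\mathfrak{m},\mathfrak{m})$: a connection $\nabla$ corresponds to the $\mathrm{Ad}(K)$-equivariant bilinear map $\eta(X,Y)=\Lambda(X)Y$, where $\Lambda:\mathfrak{m}\to\mathfrak{gl}(\mathfrak{m})$ is its Nomizu map (so $\nabla_XY=\nabla^c_XY+\Lambda(X)Y$, with $\nabla^c$ the canonical connection, whose Nomizu map is zero); its torsion is $T(X,Y)=\Lambda(X)Y-\Lambda(Y)X-[X,Y]_{\mathfrak{m}}$. The dimension of $\mathfrak{aff}_G(F(G/K))$ is that of $\mathrm{Hom}^{\mathbb{R}}_K(\mathfrak{m}\otimes\mathfrak{m},\mathfrak{m})$. The connection is metric with respect to a $G$-invariant metric iff $\Lambda(X)\in\mathfrak{so}(\mathfrak{m})$ for all $X\in\mathfrak{m}$. On each of the two spaces the $G$-invariant Riemannian metric is unique up to scale and is induced by a negative multiple of the Killing form restricted to $\mathfrak{m}$; the reductive decompositions are $\mathfrak{spin}(7)=\mathfrak{g}_2\oplus\mathfrak{m}$ and $\mathfrak{g}_2=\mathfrak{su}(3)\oplus\mathfrak{m}$. For $S^6$, $\mathfrak{m}$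 is the real $SU(3)$-module underlying the standard complex representation $\mathbb{C}^3$ of $SU(3)$, and a complex scalar acts on $\mathfrak{m}$ through the corresponding $SU(3)$-invariant complex structure. *)

theory Defs
  imports "HOL-Analysis.Analysis" "HOL-Library.Function_Algebras"
begin

section \<open>Pointwise real vector space structure on functions\<close>

text \<open>A connection is a function of two vector fields, so sets of connections live in a function
  type; the instance makes \<^const>\<open>real_vector.dim\<close> available there.\<close>

instantiation "fun" :: (type, real_vector) real_vector
begin

definition scaleR_fun :: "real \<Rightarrow> ('a \<Rightarrow> 'b) \<Rightarrow> 'a \<Rightarrow> 'b" where
  "scaleR_fun r f = (\<lambda>x. r *\<^sub>R f x)"

instance
  by standard (simp_all add: scaleR_fun_def fun_eq_iff scaleR_add_right scaleR_add_left)

end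

definition affine_dimension :: "'a::real_vector set \<Rightarrow> nat" where
  "affine_dimension S = dim {x - y | x y. x \<in> S \<and> y \<in> S}"


section \<open>Calculus on embedded submanifolds of a Euclidean space\<close>

text \<open>Class \<open>C^k\<close> on an open set, by iterated directional derivatives.\<close>

fun Ck_on :: "nat \<Rightarrow> 'v::euclidean_space set \<Rightarrow> ('v \<Rightarrow> 'w::euclidean_space) \<Rightarrow> bool" where
  "Ck_on 0 U f = continuous_on U f"
| "Ck_on (Suc k) U f =
     (f differentiable_on U \<and> (\<forall>v. Ck_on k U (\<lambda>x. frechet_derivative f (at x) v)))"

definition smooth_on :: "'v::euclidean_space set \<Rightarrow> ('v \<Rightarrow> 'w::euclidean_space) \<Rightarrow> bool" where
  "smooth_on M f \<longleftrightarrow>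
     (\<exists>U F. open U \<and> M \<subseteq> U \<and> (\<forall>k. Ck_on k U F) \<and> (\<forall>x\<in>M. F x = f x))"

definition curve_at :: "'v::real_normed_vector set \<Rightarrow> 'v \<Rightarrow> 'v \<Rightarrow> (real \<Rightarrow> 'v) \<Rightarrow> bool" where
  "curve_at M p v c \<longleftrightarrow>
     (\<forall>t. c t \<in> M) \<and> c 0 = p \<and> (c has_vector_derivative v) (at 0)"

definition tangent_space :: "'v::real_normed_vector set \<Rightarrow> 'v \<Rightarrow> 'v set" where
  "tangent_space M p = {v. \<exists>c. curve_at M p v c}"

text \<open>Derivative at \<open>p\<close> along the tangent vector \<open>v\<close> of a function \<open>f\<close> of which only the
  restriction to \<open>M\<close> matters.\<close>

definition dir_deriv ::
    "'v::real_normed_vector set \<Rightarrow> ('v \<Rightarrow> 'w::real_normed_vector) \<Rightarrow> 'v \<Rightarrow> 'v \<Rightarrow> 'w" where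
  "dir_deriv M f p v =
     (THE d. \<forall>c. curve_at M p v c \<longrightarrow> ((\<lambda>t. f (c t)) has_vector_derivative d) (at 0))"

text \<open>Vector fields are normalised to vanish off \<open>M\<close>, so that equality of vector fields on \<open>M\<close>
  is equality of functions.\<close>

definition vector_fields :: "'v::euclidean_space set \<Rightarrow> ('v \<Rightarrow> 'v) set" where
  "vector_fields M =
     {X. smooth_on M X \<and> (\<forall>p\<in>M. X p \<in> tangent_space M p) \<and> (\<forall>p. p \<notin> M \<longrightarrow> X p = 0)}"

definition lie_bracket :: "'v::euclidean_space set \<Rightarrow> ('v \<Rightarrow> 'v) \<Rightarrow> ('v \<Rightarrow> 'v) \<Rightarrow> 'v \<Rightarrow> 'v" where
  "lie_bracket M X Y p =
     (if p \<in> M then dir_deriv M Y p (X p) - dir_deriv M X p (Y p) else 0)"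

type_synonym 'v connection = "('v \<Rightarrow> 'v) \<Rightarrow> ('v \<Rightarrow> 'v) \<Rightarrow> ('v \<Rightarrow> 'v)"

text \<open>Affine connections as covariant derivatives; the last clause fixes the value on arguments
  that are not vector fields on \<open>M\<close>.\<close>

definition affine_connection :: "'v::euclidean_space set \<Rightarrow> 'v connection \<Rightarrow> bool" where
  "affine_connection M D \<longleftrightarrow>
     (\<forall>X\<in>vector_fields M. \<forall>Y\<in>vector_fields M. D X Y \<in> vector_fields M) \<and>
     (\<forall>X\<in>vector_fields M. \<forall>X'\<in>vector_fields M. \<forall>Y\<in>vector_fields M.
        D (\<lambda>p. X p + X' p) Y = (\<lambda>p. D X Y p + D X' Y p)) \<and>
     (\<forall>f::'v \<Rightarrow> real. \<forall>X\<in>vector_fields M. \<forall>Y\<in>vector_fields M. smooth_on M f \<longrightarrow>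
        D (\<lambda>p. f p *\<^sub>R X p) Y = (\<lambda>p. f p *\<^sub>R D X Y p)) \<and>
     (\<forall>X\<in>vector_fields M. \<forall>Y\<in>vector_fields M. \<forall>Y'\<in>vector_fields M.
        D X (\<lambda>p. Y p + Y' p) = (\<lambda>p. D X Y p + D X Y' p)) \<and>
     (\<forall>f::'v \<Rightarrow> real. \<forall>X\<in>vector_fields M. \<forall>Y\<in>vector_fields M. smooth_on M f \<longrightarrow>
        D X (\<lambda>p. f p *\<^sub>R Y p) =
          (\<lambda>p. dir_deriv M f p (X p) *\<^sub>R Y p + f p *\<^sub>R D X Y p)) \<and>
     (\<forall>X Y. X \<notin> vector_fields M \<or> Y \<notin> vector_fields M \<longrightarrow> D X Y = (\<lambda>_. 0))"

definition riemannian_metric ::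
    "'v::euclidean_space set \<Rightarrow> ('v \<Rightarrow> 'v \<Rightarrow> 'v \<Rightarrow> real) \<Rightarrow> bool" where
  "riemannian_metric M g \<longleftrightarrow>
     (\<forall>p\<in>M. \<forall>u\<in>tangent_space M p. \<forall>v\<in>tangent_space M p. \<forall>w\<in>tangent_space M p. \<forall>a b.
        g p (a *\<^sub>R u + b *\<^sub>R v) w = a * g p u w + b * g p v w) \<and>
     (\<forall>p\<in>M. \<forall>u\<in>tangent_space M p. \<forall>v\<in>tangent_space M p. g p u v = g p v u) \<and>
     (\<forall>p\<in>M. \<forall>u\<in>tangent_space M p. u \<noteq> 0 \<longrightarrow> g p u u > 0) \<and>
     (\<forall>X\<in>vector_fields M. \<forall>Y\<in>vector_fields M. smooth_on M (\<lambda>p. g p (X p) (Y p)))"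

definition metric_connection ::
    "'v::euclidean_space set \<Rightarrow> ('v \<Rightarrow> 'v \<Rightarrow> 'v \<Rightarrow> real) \<Rightarrow> 'v connection \<Rightarrow> bool" where
  "metric_connection M g D \<longleftrightarrow>
     (\<forall>X\<in>vector_fields M. \<forall>Y\<in>vector_fields M. \<forall>Z\<in>vector_fields M. \<forall>p\<in>M.
        dir_deriv M (\<lambda>q. g q (Y q) (Z q)) p (X p) =
          g p (D X Y p) (Z p) + g p (Y p) (D X Z p))"


section \<open>Linear groups acting on submanifolds\<close>

text \<open>A linear Lie group is a set of invertible endomorphisms of the ambient space. Its Lie algebra
  is the tangent space at the identity, with the commutator bracket.\<close>

type_synonym 'v endo = "'v \<Rightarrow>\<^sub>L 'v"

definition lie_algebra :: "'v::euclidean_space endo set \<Rightarrow> 'v endo set" where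
  "lie_algebra G = tangent_space G id_blinfun"

definition commutator :: "'v::euclidean_space endo \<Rightarrow> 'v endo \<Rightarrow> 'v endo" where
  "commutator X Y = (X o\<^sub>L Y) - (Y o\<^sub>L X)"

definition Ad :: "'v::euclidean_space endo \<Rightarrow> 'v endo \<Rightarrow> 'v endo" where
  "Ad g X = g o\<^sub>L X o\<^sub>L Blinfun (inv (blinfun_apply g))"

definition homogeneous_space ::
    "'v::euclidean_space endo set \<Rightarrow> 'v endo set \<Rightarrow> 'v set \<Rightarrow> 'v \<Rightarrow> bool" where
  "homogeneous_space G K M p \<longleftrightarrow>
     p \<in> M \<and> M = {blinfun_apply g p | g. g \<in> G} \<and> K = {g \<in> G. blinfun_apply g p = p}"

definition reductive_decomposition ::
    "'v::euclidean_space endo set \<Rightarrow> 'v endo set \<Rightarrow> 'v endo set \<Rightarrow> bool" where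
  "reductive_decomposition G K m \<longleftrightarrow>
     subspace m \<and>
     lie_algebra G = {A + B | A B. A \<in> lie_algebra K \<and> B \<in> m} \<and>
     lie_algebra K \<inter> m = {0} \<and>
     (\<forall>k\<in>K. \<forall>X\<in>m. Ad k X \<in> m)"

text \<open>The component \<open>X\<^sub>m\<close> of \<open>X\<close> in the splitting of the Lie algebra.\<close>

definition m_part :: "'v::euclidean_space endo set \<Rightarrow> 'v endo set \<Rightarrow> 'v endo \<Rightarrow> 'v endo" where
  "m_part K m X = (THE Z. Z \<in> m \<and> X - Z \<in> lie_algebra K)"

definition push_forward :: "'v::euclidean_space endo \<Rightarrow> ('v \<Rightarrow> 'v) \<Rightarrow> 'v \<Rightarrow> 'v" where
  "push_forward g X p = blinfun_apply g (X (inv (blinfun_apply g) p))"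

definition invariant_connections ::
    "'v::euclidean_space endo set \<Rightarrow> 'v set \<Rightarrow> 'v connection set" where
  "invariant_connections G M =
     {D. affine_connection M D \<and>
         (\<forall>g\<in>G. \<forall>X\<in>vector_fields M. \<forall>Y\<in>vector_fields M.
            D (push_forward g X) (push_forward g Y) = push_forward g (D X Y))}"

definition invariant_metric ::
    "'v::euclidean_space endo set \<Rightarrow> 'v set \<Rightarrow> ('v \<Rightarrow> 'v \<Rightarrow> 'v \<Rightarrow> real) \<Rightarrow> bool" where
  "invariant_metric G M g \<longleftrightarrow>
     riemannian_metric M g \<and>
     (\<forall>h\<in>G. \<forall>p\<in>M. \<forall>u\<in>tangent_space M p. \<forall>v\<in>tangent_space M p.
        g (blinfun_apply h p) (blinfun_apply h u) (blinfun_apply h v) = g p u v)"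

text \<open>The vector field on \<open>M\<close> whose flow is \<open>p \<mapsto> exp(tX) p\<close>.\<close>

definition fundamental_field :: "'v::euclidean_space set \<Rightarrow> 'v endo \<Rightarrow> 'v \<Rightarrow> 'v" where
  "fundamental_field M X p = (if p \<in> M then blinfun_apply X p else 0)"

text \<open>The Nomizu map of an invariant connection with respect to the base point \<open>b\<close>, in the sense
  of Kobayashi and Nomizu: under the identification of \<open>m\<close> with the tangent space at \<open>b\<close> given by
  \<open>Z \<mapsto> Z b\<close>, \<open>\<Lambda>(X)\<close> is the endomorphism \<open>\<nabla>\<^sub>X\<^sub>* - L\<^sub>X\<^sub>*\<close> at \<open>b\<close>, where \<open>X\<^sub>*\<close> is the fundamental field
  of \<open>X\<close>. Since \<open>[X\<^sub>*, W]\<close> at \<open>b\<close> is the derivative at \<open>t = 0\<close> of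
  \<open>exp(-tX) W(exp(tX) b)\<close>, which for \<open>X \<in> m\<close> is the canonical covariant derivative, this is
  the difference from the canonical connection. As a total function it is \<open>0\<close> outside \<open>m\<close>.\<close>

definition nomizu_map ::
    "'v::euclidean_space set \<Rightarrow> 'v \<Rightarrow> 'v endo set \<Rightarrow> 'v connection \<Rightarrow> 'v endo \<Rightarrow> 'v endo \<Rightarrow> 'v endo"
  where
  "nomizu_map M b m D X Y =
     (if X \<in> m \<and> Y \<in> m
      then (THE Z. Z \<in> m \<and>
              (\<forall>W\<in>vector_fields M. W b = blinfun_apply Y b \<longrightarrow>
                 blinfun_apply Z b =
                   D (fundamental_field M X) W b - lie_bracket M (fundamental_field M X) W b))
      else 0)"

text \<open>\<open>\<Lambda>\<^sup>\<alpha>(X)Y = (1 - \<alpha>)/2 [X,Y]\<^sub>m\<close>, where \<open>act\<close> is the action on \<open>m\<close> of the field of scalars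
  in which \<open>\<alpha>\<close> lies.\<close>

definition Lambda_alpha ::
    "('s::field \<Rightarrow> 'v endo \<Rightarrow> 'v endo) \<Rightarrow> 'v::euclidean_space endo set \<Rightarrow> 'v endo set \<Rightarrow> 's
      \<Rightarrow> 'v endo \<Rightarrow> 'v endo \<Rightarrow> 'v endo" where
  "Lambda_alpha act K m \<alpha> X Y =
     (if X \<in> m \<and> Y \<in> m then act ((1 - \<alpha>) / 2) (m_part K m (commutator X Y)) else 0)"


section \<open>Octonions and the groups Spin(7), G2 and SU(3)\<close>

text \<open>The octonions as \<open>\<complex> \<oplus> \<complex>\<^sup>3\<close>, with the Euclidean norm and product
  \<open>(a, u) (b, v) = (a b - \<Sum>\<^sub>k u\<^sub>k cnj v\<^sub>k, a v + cnj b u + cnj (u \<times> v))\<close>.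
  The norm is multiplicative and \<open>(1, 0)\<close> is the identity, so by Hurwitz's theorem this is the
  octonion algebra. The subalgebra \<open>\<complex>\<close> is spanned by \<open>1\<close> and the imaginary unit \<open>(\<i>, 0)\<close>, and
  left multiplication by the latter is the complex structure of \<open>\<complex>\<^sup>3\<close>.\<close>

type_synonym octonion = "complex \<times> (complex ^ 3)"

definition conj_cross :: "complex ^ 3 \<Rightarrow> complex ^ 3 \<Rightarrow> complex ^ 3" where
  "conj_cross u v = vector
     [cnj (u $ 2 * v $ 3 - u $ 3 * v $ 2),
      cnj (u $ 3 * v $ 1 - u $ 1 * v $ 3),
      cnj (u $ 1 * v $ 2 - u $ 2 * v $ 1)]"

definition omult :: "octonion \<Rightarrow> octonion \<Rightarrow> octonion" where
  "omult x y =
     (fst x * fst y - (\<Sum>k\<in>UNIV. snd x $ k * cnj (snd y $ k)),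
      fst x *s snd y + cnj (fst y) *s snd x + conj_cross (snd x) (snd y))"

definition oct_one :: octonion where "oct_one = (1, 0)"

definition oct_i :: octonion where "oct_i = (\<i>, 0)"

definition imaginary :: "octonion set" where
  "imaginary = {x. Re (fst x) = 0}"

text \<open>Left multiplications by imaginary octonions satisfy \<open>L\<^sub>u L\<^sub>u = -|u|\<^sup>2\<close>, so they make the
  octonions the real spin module of the Clifford algebra of the 7-space \<open>V\<close> of imaginary octonions.
  On it the even Clifford algebra acts faithfully as the algebra of all endomorphisms, its
  canonical involution \<open>*\<close> being the transpose. The usual definition
  \<open>Spin(V) = {g even. g g* = 1 \<and> g V g* \<subseteq> V}\<close> thus becomes the set of orthogonal maps that
  conjugate left multiplications by elements of \<open>V\<close> into such.\<close>

definition Spin7 :: "octonion endo set" where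
  "Spin7 =
     {g. orthogonal_transformation (blinfun_apply g) \<and>
         (\<forall>u\<in>imaginary. \<exists>v\<in>imaginary. \<forall>x.
            blinfun_apply g (omult u x) = omult v (blinfun_apply g x))}"

definition G2 :: "octonion endo set" where
  "G2 = {g. bij (blinfun_apply g) \<and>
            (\<forall>x y. blinfun_apply g (omult x y) = omult (blinfun_apply g x) (blinfun_apply g y))}"

definition SU3_matrices :: "(complex ^ 3 ^ 3) set" where
  "SU3_matrices = {A. transpose (map_matrix cnj A) ** A = mat 1 \<and> det A = 1}"

definition SU3_embed :: "complex ^ 3 ^ 3 \<Rightarrow> octonion endo" where
  "SU3_embed A = Blinfun (\<lambda>x. (fst x, A *v snd x))"

definition SU3 :: "octonion endo set" where
  "SU3 = SU3_embed ` SU3_matrices"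

definition S7 :: "octonion set" where
  "S7 = {x. norm x = 1}"

definition S6 :: "octonion set" where
  "S6 = {x \<in> imaginary. norm x = 1}"

text \<open>An identification of \<open>m\<close> with the real SU(3)-module underlying the standard complex
  representation, and the resulting action of complex scalars on \<open>m\<close>. By Schur's lemma the action
  does not depend on the choice of \<open>\<phi>\<close>.\<close>

definition standard_SU3_module_iso ::
    "(complex ^ 3 \<Rightarrow> octonion endo) \<Rightarrow> octonion endo set \<Rightarrow> bool" where
  "standard_SU3_module_iso \<phi> m \<longleftrightarrow>
     linear \<phi> \<and> bij_betw \<phi> UNIV m \<and>
     (\<forall>A\<in>SU3_matrices. \<forall>u. \<phi> (A *v u) = Ad (SU3_embed A) (\<phi> u))"

definition complex_scale ::
    "(complex ^ 3 \<Rightarrow> octonion endo) \<Rightarrow> complex \<Rightarrow> octonion endo \<Rightarrow> octonion endo" where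
  "complex_scale \<phi> c Z = \<phi> (c *s inv \<phi> Z)"

end

theory Submission
  imports Defs
begin

text \<open>
  Each of the two spheres is the unit sphere \<open>M\<close> of a subspace of the octonions, \<open>b\<close> is its base point
  and \<open>K\<close> the isotropy group. On \<open>M\<close> there is an obvious invariant connection, the Levi-Civita
  connection of the round metric, that is the tangential part of the ambient derivative. Any other
  invariant connection differs from it by an invariant tensor, and an invariant tensor is the same thing
  as a \<open>K\<close>-equivariant bilinear map of the tangent space at \<open>b\<close>. So the problem is to find these maps.
  On \<open>\<complex>\<^sup>3\<close> the SU(3)-equivariant ones are the complex multiples of the conjugate cross product
  (\<open>SU3_bilinear_maps\<close>); on the imaginary octonions the G2-equivariant ones are the real multiples of the
  imaginary part of the product (\<open>G2_bilinear_maps\<close>). Both families extend to explicit tensors on the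
  whole sphere (\<open>S7_tensor\<close>, \<open>S6_tensor\<close>). This gives the classification and the dimensions 1 and 2
  (\<open>invariant_connections_eq\<close>, \<open>affine_dimension_invariant_connections\<close>). All these tensors are
  skew-symmetric in the last two slots, and \<open>K\<close> is transitive on directions, so that every invariant
  metric is round; therefore all invariant connections are metric.

  For the Nomizu maps let \<open>m\<close> be any reductive complement. Evaluation at \<open>b\<close> identifies it with the
  tangent space, and \<open>(X, v) \<mapsto> X v + \<langle>X b, v\<rangle> b\<close> is again an equivariant bilinear map, say the tensor
  with parameter \<open>s0\<close> (\<open>lift_action\<close>). Hence the connection with parameter \<open>s\<close> has the Nomizu map with
  parameter \<open>s + s0\<close>, and \<open>[X, Y]\<^sub>m\<close> has parameter \<open>2 s0\<close>, so that \<open>\<Lambda>\<^sup>\<alpha>\<close> has parameter \<open>(1 - \<alpha>) s0\<close>.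
  Both parametrise the same set as soon as \<open>s0 \<noteq> 0\<close>, which is checked on one product of octonions in
  each case (\<open>nomizu_map_bij\<close>).

  The group theory rests on the Clifford relation for left multiplications by imaginary octonions. Unit
  imaginary octonions act as elements of Spin(7), products of two of them move \<open>1\<close> to any unit octonion,
  and products of four yield the involutions of G2 that interchange two given imaginary unit vectors
  (\<open>G2_swap\<close>). The Lie algebra of the isotropy group has to be known exactly, since only then evaluation
  at \<open>b\<close> is injective on \<open>m\<close>; this follows by exponentiating derivations (\<open>endo_exp_automorphism\<close>).\<close>

section \<open>Smooth functions and directional derivatives\<close>

lemma Ck_on_cong:
  assumes "open U" "\<And>x. x \<in> U \<Longrightarrow> f x = g x" "Ck_on k U f"
  shows "Ck_on k U g"
  using assms(2,3)
proof (induction k arbitrary: f g)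
  case 0
  then show ?case by (simp cong: continuous_on_cong)
next
  case (Suc k)
  have d: "f differentiable (at x)" if "x \<in> U" for x
    using Suc.prems(2) that assms(1) by (simp add: differentiable_on_eq_differentiable_at)
  have "g differentiable_on U"
    unfolding differentiable_on_eq_differentiable_at[OF assms(1)]
  proof
    fix x assume x: "x \<in> U"
    show "g differentiable (at x)"
      using d[OF x] has_derivative_transform_within_open[of f _ x UNIV, OF _ assms(1) x Suc.prems(1)]
      unfolding differentiable_def by metis
  qed
  moreover have "Ck_on k U (\<lambda>x. frechet_derivative g (at x) v)" for v
  proof (rule Suc.IH)
    show "Ck_on k U (\<lambda>x. frechet_derivative f (at x) v)" using Suc.prems(2) by simp
    show "frechet_derivative f (at x) v = frechet_derivative g (at x) v" if "x \<in> U" for x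
      using frechet_derivative_transform_within_open[OF d[OF that] assms(1) that Suc.prems(1)] by simp
  qed
  ultimately show ?case by simp
qed

lemma Ck_on_SucD: "Ck_on (Suc k) U f \<Longrightarrow> Ck_on k U f"
proof (induction k arbitrary: f)
  case 0
  then show ?case by (simp add: differentiable_imp_continuous_on)
next
  case (Suc k)
  have "Ck_on (Suc k) U (\<lambda>x. frechet_derivative f (at x) v)" for v
    using Suc.prems by (metis Ck_on.simps(2))
  then have "Ck_on k U (\<lambda>x. frechet_derivative f (at x) v)" for v
    by (rule Suc.IH)
  then show ?case using Suc.prems by simp
qed

lemma Ck_on_subset: "Ck_on k U f \<Longrightarrow> W \<subseteq> U \<Longrightarrow> Ck_on k W f"
  by (induction k arbitrary: f) (auto intro: continuous_on_subset differentiable_on_subset)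

text \<open>The derivative may be computed by any rule instead of through \<^const>\<open>frechet_derivative\<close>; the
  closure properties below are inductions that combine this with the sum, product and chain rules.\<close>

lemma Ck_on_SucI:
  assumes "open U" "\<And>x. x \<in> U \<Longrightarrow> (f has_derivative f' x) (at x)" "\<And>v. Ck_on k U (\<lambda>x. f' x v)"
  shows "Ck_on (Suc k) U f"
proof -
  have "f differentiable_on U"
    using assms by (meson differentiableI differentiable_at_imp_differentiable_on)
  moreover have "Ck_on k U (\<lambda>x. frechet_derivative f (at x) v)" for v
    by (rule Ck_on_cong[OF assms(1) _ assms(3)[of v]]) (simp add: frechet_derivative_at[OF assms(2), symmetric])
  ultimately show ?thesis by simp
qed

lemma Ck_on_SucE:
  assumes "open U" "Ck_on (Suc k) U f" "x \<in> U"
  shows "(f has_derivative frechet_derivative f (at x)) (at x)"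
  using assms by (simp add: differentiable_on_eq_differentiable_at frechet_derivative_works)

lemma Ck_on_const: "open U \<Longrightarrow> Ck_on k U (\<lambda>_. c)"
  by (induction k arbitrary: c) (auto simp: frechet_derivative_const)

lemma Ck_on_linear_compose:
  assumes "open U" "bounded_linear h" "Ck_on k U f"
  shows "Ck_on k U (\<lambda>x. h (f x))"
  using assms(3)
proof (induction k arbitrary: f)
  case 0
  then show ?case using assms(2) by (simp add: bounded_linear.continuous_on)
next
  case (Suc k)
  show ?case
    by (rule Ck_on_SucI[OF assms(1) bounded_linear.has_derivative[OF assms(2) Ck_on_SucE[OF assms(1) Suc.prems]]])
      (use Suc in auto)
qed

lemma Ck_on_id: "open U \<Longrightarrow> Ck_on k U (\<lambda>x. x)"
  by (cases k) (auto simp: frechet_derivative_ident Ck_on_const)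

lemma Ck_on_add:
  assumes "open U" "Ck_on k U f" "Ck_on k U g"
  shows "Ck_on k U (\<lambda>x. f x + g x)"
  using assms(2,3)
proof (induction k arbitrary: f g)
  case 0
  then show ?case by (simp add: continuous_on_add)
next
  case (Suc k)
  show ?case
    by (rule Ck_on_SucI[OF assms(1) has_derivative_add[OF Ck_on_SucE[OF assms(1) Suc.prems(1)]
            Ck_on_SucE[OF assms(1) Suc.prems(2)]]])
      (use Suc in auto)
qed

lemma Ck_on_bilinear:
  assumes "open U" "bounded_bilinear h" "Ck_on k U f" "Ck_on k U g"
  shows "Ck_on k U (\<lambda>x. h (f x) (g x))"
  using assms(3,4)
proof (induction k arbitrary: f g)
  case 0
  then show ?case using bounded_bilinear.continuous_on[OF assms(2)] by simp
next
  case (Suc k)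
  have k: "Ck_on k U f" "Ck_on k U g" using Suc.prems by (blast dest: Ck_on_SucD)+
  show ?case
    by (rule Ck_on_SucI[OF assms(1) bounded_bilinear.FDERIV[OF assms(2) Ck_on_SucE[OF assms(1) Suc.prems(1)]
            Ck_on_SucE[OF assms(1) Suc.prems(2)]]])
      (use Suc k in \<open>auto intro!: Ck_on_add[OF assms(1)]\<close>)
qed

lemma Ck_on_compose_linear:
  assumes "open U" "bounded_linear h" "open W" "h ` W \<subseteq> U" "Ck_on k U f"
  shows "Ck_on k W (\<lambda>x. f (h x))"
  using assms(5)
proof (induction k arbitrary: f)
  case 0
  then show ?case using assms(4) bounded_linear.continuous_on[OF assms(2) continuous_on_id]
    by (auto intro: continuous_on_compose2)
next
  case (Suc k)
  have D: "((\<lambda>x. f (h x)) has_derivative (\<lambda>v. frechet_derivative f (at (h x)) (h v))) (at x)"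
    if "x \<in> W" for x
  proof -
    have "h x \<in> U" using that assms(4) by blast
    from has_derivative_compose[OF bounded_linear_imp_has_derivative[OF assms(2)]
        Ck_on_SucE[OF assms(1) Suc.prems this]]
    show ?thesis by simp
  qed
  show ?case
    by (rule Ck_on_SucI[OF assms(3) D]) (use Suc in auto)
qed

lemma smooth_onI:
  "open U \<Longrightarrow> M \<subseteq> U \<Longrightarrow> (\<And>k. Ck_on k U F) \<Longrightarrow> (\<And>x. x \<in> M \<Longrightarrow> F x = f x) \<Longrightarrow> smooth_on M f"
  unfolding smooth_on_def by blast

lemma smooth_on_cong: "smooth_on M f \<Longrightarrow> (\<And>x. x \<in> M \<Longrightarrow> f x = g x) \<Longrightarrow> smooth_on M g"
  unfolding smooth_on_def by metis

lemma smooth_on_const: "smooth_on M (\<lambda>_. c)"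
  by (rule smooth_onI[of UNIV]) (auto intro: Ck_on_const)

lemma smooth_on_id: "smooth_on M (\<lambda>x. x)"
  by (rule smooth_onI[of UNIV]) (auto intro: Ck_on_id)

lemma smooth_on_linear:
  assumes "bounded_linear h" "smooth_on M f"
  shows "smooth_on M (\<lambda>x. h (f x))"
proof -
  obtain U F where U: "open U" "M \<subseteq> U" "\<And>k. Ck_on k U F" "\<And>x. x \<in> M \<Longrightarrow> F x = f x"
    using assms(2) unfolding smooth_on_def by blast
  show ?thesis
    by (rule smooth_onI[OF U(1,2) Ck_on_linear_compose[OF U(1) assms(1) U(3)]]) (simp add: U(4))
qed

lemma smooth_on_bilinear:
  assumes h: "bounded_bilinear h" and f: "smooth_on M f" and g: "smooth_on M g"
  shows "smooth_on M (\<lambda>x. h (f x) (g x))"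
proof -
  obtain U F where U: "open U" "M \<subseteq> U" "\<And>k. Ck_on k U F" "\<And>x. x \<in> M \<Longrightarrow> F x = f x"
    using f unfolding smooth_on_def by blast
  obtain W G where W: "open W" "M \<subseteq> W" "\<And>k. Ck_on k W G" "\<And>x. x \<in> M \<Longrightarrow> G x = g x"
    using g unfolding smooth_on_def by blast
  show ?thesis
  proof (rule smooth_onI)
    show o: "open (U \<inter> W)" using U W by blast
    show "Ck_on k (U \<inter> W) (\<lambda>x. h (F x) (G x))" for k
      by (rule Ck_on_bilinear[OF o h]) (rule Ck_on_subset[OF U(3)] Ck_on_subset[OF W(3)]; simp)+
  qed (use U W in auto)
qed

lemma smooth_on_add:
  assumes f: "smooth_on M f" and g: "smooth_on M g"
  shows "smooth_on M (\<lambda>x. f x + g x)"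
proof -
  obtain U F where U: "open U" "M \<subseteq> U" "\<And>k. Ck_on k U F" "\<And>x. x \<in> M \<Longrightarrow> F x = f x"
    using f unfolding smooth_on_def by blast
  obtain W G where W: "open W" "M \<subseteq> W" "\<And>k. Ck_on k W G" "\<And>x. x \<in> M \<Longrightarrow> G x = g x"
    using g unfolding smooth_on_def by blast
  show ?thesis
  proof (rule smooth_onI)
    show o: "open (U \<inter> W)" using U W by blast
    show "Ck_on k (U \<inter> W) (\<lambda>x. F x + G x)" for k
      by (rule Ck_on_add[OF o]) (rule Ck_on_subset[OF U(3)] Ck_on_subset[OF W(3)]; simp)+
  qed (use U W in auto)
qed

lemmas smooth_on_scaleR = smooth_on_bilinear[OF bounded_bilinear_scaleR]
  and smooth_on_inner = smooth_on_bilinear[OF bounded_bilinear_inner]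

lemma smooth_on_sum:
  "finite A \<Longrightarrow> (\<And>i. i \<in> A \<Longrightarrow> smooth_on M (f i)) \<Longrightarrow> smooth_on M (\<lambda>x. \<Sum>i\<in>A. f i x)"
  by (induction A rule: finite_induct) (auto intro: smooth_on_const smooth_on_add)

lemma smooth_on_compose_linear:
  assumes "bounded_linear h" "\<And>x. x \<in> N \<Longrightarrow> h x \<in> M" "smooth_on M f"
  shows "smooth_on N (\<lambda>x. f (h x))"
proof -
  obtain U F where U: "open U" "M \<subseteq> U" "\<And>k. Ck_on k U F" "\<And>x. x \<in> M \<Longrightarrow> F x = f x"
    using assms(3) unfolding smooth_on_def by blast
  have o: "open (h -` U)"
    by (rule open_vimage[OF U(1) linear_continuous_on[OF assms(1)]])
  show ?thesis
  proof (rule smooth_onI[OF o])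
    show "Ck_on k (h -` U) (\<lambda>x. F (h x))" for k
      by (rule Ck_on_compose_linear[OF U(1) assms(1) o _ U(3)]) auto
    show "N \<subseteq> h -` U" using assms(2) U(2) by auto
    show "F (h x) = f (h x)" if "x \<in> N" for x using that assms(2) U(4) by simp
  qed
qed

lemma smooth_on_extension:
  assumes "smooth_on M f"
  obtains U F where "open U" "M \<subseteq> U" "\<forall>k. Ck_on k U F" "\<forall>x\<in>M. F x = f x"
    "\<forall>x\<in>M. (F has_derivative frechet_derivative F (at x)) (at x)"
proof -
  obtain U F where U: "open U" "M \<subseteq> U" "\<And>k. Ck_on k U F" "\<And>x. x \<in> M \<Longrightarrow> F x = f x"
    using assms unfolding smooth_on_def by blast
  show ?thesis
    by (rule that[of U F]) (use Ck_on_SucE[OF U(1) U(3)] U in blast)+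
qed

lemma smooth_on_differentiable:
  assumes "smooth_on M f" "p \<in> M"
  obtains F F' where "(F has_derivative F') (at p)" "\<forall>x\<in>M. F x = f x"
  using smooth_on_extension[OF assms(1)] assms(2) by metis

lemma curve_derivative:
  assumes c: "curve_at M p v c" and F: "(F has_derivative F') (at p)" and eq: "\<forall>x\<in>M. F x = f x"
  shows "((\<lambda>t. f (c t)) has_vector_derivative F' v) (at 0)"
proof -
  have c: "\<And>t. c t \<in> M" "c 0 = p" "(c has_vector_derivative v) (at 0)"
    using c by (auto simp: curve_at_def)
  have "((\<lambda>t. F (c t)) has_vector_derivative F' v) (at 0)"
    using has_derivative_compose[OF c(3)[unfolded has_vector_derivative_def], of F F'] F c(2)
    by (simp add: has_vector_derivative_def linear_cmul[OF has_derivative_linear[OF F]])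
  then show ?thesis using eq c(1) by simp
qed

text \<open>The curves defining a directional derivative stay in \<open>M\<close>, so all extensions of \<open>f\<close> look alike
  to them, and the chain rule at \<open>0\<close> applies to each.\<close>

lemma dir_deriv_eqI:
  assumes v: "v \<in> tangent_space M p" and F: "(F has_derivative F') (at p)" and eq: "\<forall>x\<in>M. F x = f x"
  shows "dir_deriv M f p v = F' v"
  unfolding dir_deriv_def
proof (rule the_equality)
  show "\<forall>c. curve_at M p v c \<longrightarrow> ((\<lambda>t. f (c t)) has_vector_derivative F' v) (at 0)"
    using curve_derivative[OF _ F eq] by blast
next
  fix d assume d: "\<forall>c. curve_at M p v c \<longrightarrow> ((\<lambda>t. f (c t)) has_vector_derivative d) (at 0)"
  obtain c where "curve_at M p v c" using v by (auto simp: tangent_space_def)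
  then show "d = F' v" using d curve_derivative[OF _ F eq] vector_derivative_unique_at by blast
qed

lemma dir_deriv_curve:
  assumes f: "smooth_on M f" and p: "p \<in> M" and c: "curve_at M p v c"
  shows "((\<lambda>t. f (c t)) has_vector_derivative dir_deriv M f p v) (at 0)"
proof -
  obtain F F' where F: "(F has_derivative F') (at p)" "\<forall>x\<in>M. F x = f x"
    using smooth_on_differentiable[OF f p] .
  have "v \<in> tangent_space M p" using c by (auto simp: tangent_space_def)
  from dir_deriv_eqI[OF this F] curve_derivative[OF c F] show ?thesis by simp
qed

lemma dir_deriv_curve_eqI:
  assumes "smooth_on M f" "p \<in> M" "curve_at M p v c" "((\<lambda>t. f (c t)) has_vector_derivative d) (at 0)"
  shows "dir_deriv M f p v = d"
  using dir_deriv_curve[OF assms(1-3)] assms(4) vector_derivative_unique_at by blast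

lemma dir_deriv_bilinear:
  fixes h :: "'a::euclidean_space \<Rightarrow> 'b::euclidean_space \<Rightarrow> 'c::euclidean_space"
  assumes h: "bounded_bilinear h" and f: "smooth_on M f" and g: "smooth_on M g"
    and p: "p \<in> M" and v: "v \<in> tangent_space M p"
  shows "dir_deriv M (\<lambda>q. h (f q) (g q)) p v = h (f p) (dir_deriv M g p v) + h (dir_deriv M f p v) (g p)"
proof -
  obtain c where c: "curve_at M p v c" using v by (auto simp: tangent_space_def)
  then have "c 0 = p" by (simp add: curve_at_def)
  then show ?thesis
    using dir_deriv_curve_eqI[OF smooth_on_bilinear[OF h f g] p c
      bounded_bilinear.has_vector_derivative[OF h dir_deriv_curve[OF f p c] dir_deriv_curve[OF g p c]]]
    by simp
qed

lemma dir_deriv_add: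
  assumes f: "smooth_on M f" and g: "smooth_on M g"
    and p: "p \<in> M" and v: "v \<in> tangent_space M p"
  shows "dir_deriv M (\<lambda>q. f q + g q) p v = dir_deriv M f p v + dir_deriv M g p v"
proof -
  obtain c where c: "curve_at M p v c" using v by (auto simp: tangent_space_def)
  show ?thesis
    by (rule dir_deriv_curve_eqI[OF smooth_on_add[OF f g] p c
      has_vector_derivative_add[OF dir_deriv_curve[OF f p c] dir_deriv_curve[OF g p c]]])
qed

lemma dir_deriv_linear:
  fixes h :: "'b::euclidean_space \<Rightarrow> 'c::euclidean_space"
  assumes h: "bounded_linear h" and f: "smooth_on M f"
    and p: "p \<in> M" and v: "v \<in> tangent_space M p"
  shows "dir_deriv M (\<lambda>q. h (f q)) p v = h (dir_deriv M f p v)"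
proof -
  obtain c where c: "curve_at M p v c" using v by (auto simp: tangent_space_def)
  show ?thesis
    by (rule dir_deriv_curve_eqI[OF smooth_on_linear[OF h f] p c
      bounded_linear.has_vector_derivative[OF h dir_deriv_curve[OF f p c]]])
qed

text \<open>The source of linearity in the direction, which is not visible from the definition by curves.\<close>

lemma dir_deriv_extension:
  assumes f: "smooth_on M f" and p: "p \<in> M"
  obtains F' where "bounded_linear F'" "\<forall>v\<in>tangent_space M p. dir_deriv M f p v = F' v"
proof -
  obtain F F' where F: "(F has_derivative F') (at p)" "\<forall>x\<in>M. F x = f x"
    using smooth_on_differentiable[OF f p] .
  show ?thesis
    by (rule that[of F']) (use F dir_deriv_eqI in \<open>auto simp: has_derivative_bounded_linear\<close>)
qed

text \<open>\<^const>\<open>Ck_on\<close> speaks about derivatives in constant directions. Expanding \<open>X\<close> in the ambient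
  basis reduces to these.\<close>

lemma smooth_on_dir_deriv:
  assumes X: "smooth_on M X" "\<And>p. p \<in> M \<Longrightarrow> X p \<in> tangent_space M p" and f: "smooth_on M f"
  shows "smooth_on M (\<lambda>p. dir_deriv M f p (X p))"
proof -
  obtain U F where U: "open U" "M \<subseteq> U" "\<forall>k. Ck_on k U F" "\<forall>x\<in>M. F x = f x"
    "\<forall>x\<in>M. (F has_derivative frechet_derivative F (at x)) (at x)"
    using smooth_on_extension[OF f] by metis
  have s: "smooth_on M (\<lambda>p. (X p \<bullet> e) *\<^sub>R frechet_derivative F (at p) e)" for e
    by (rule smooth_on_scaleR)
      (use smooth_onI[OF U(1,2), of "\<lambda>p. frechet_derivative F (at p) e"] U(3)[rule_format, of "Suc _"]
        in \<open>auto intro!: smooth_on_inner X smooth_on_const\<close>)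
  show ?thesis
  proof (rule smooth_on_cong[OF smooth_on_sum[OF finite_Basis s]])
    fix p assume p: "p \<in> M"
    interpret D: bounded_linear "frechet_derivative F (at p)"
      using U(5) p has_derivative_bounded_linear by blast
    have "dir_deriv M f p (X p) = frechet_derivative F (at p) (\<Sum>e\<in>Basis. (X p \<bullet> e) *\<^sub>R e)"
      using dir_deriv_eqI[OF X(2)[OF p] U(5)[rule_format, OF p] U(4)] by (simp add: euclidean_representation)
    then show "(\<Sum>e\<in>Basis. (X p \<bullet> e) *\<^sub>R frechet_derivative F (at p) e) = dir_deriv M f p (X p)"
      by (simp add: D.sum D.scaleR)
  qed
qed

section \<open>Connections on the unit sphere of a subspace\<close>

text \<open>Push-forward along any map, so that it can also be taken along the inverse of a group element.\<close>

definition transport :: "('v \<Rightarrow> 'v) \<Rightarrow> ('v \<Rightarrow> 'v) \<Rightarrow> 'v \<Rightarrow> 'v" where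
  "transport f X p = f (X (inv f p))"

lemma push_forward_transport: "push_forward g X = transport (blinfun_apply g) X"
  by (simp add: fun_eq_iff push_forward_def transport_def)

text \<open>The unit sphere of a linear subspace, the image of \<open>\<pi>\<close>. For the 7-sphere \<open>\<pi>\<close> is the identity,
  for the 6-sphere it removes the real part of an octonion.\<close>

locale unit_sphere =
  fixes \<pi> :: "'v::euclidean_space \<Rightarrow> 'v" and M :: "'v set"
  assumes proj_linear: "bounded_linear \<pi>" and proj_idem: "\<pi> (\<pi> x) = \<pi> x"
    and M_eq: "M = {x. \<pi> x = x \<and> norm x = 1}"
begin

interpretation P: bounded_linear \<pi> by (rule proj_linear)

definition tgt :: "'v \<Rightarrow> 'v set" where
  "tgt p = {v. \<pi> v = v \<and> v \<bullet> p = 0}"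

lemma subspace_tgt: "subspace (tgt p)"
  by (auto simp: tgt_def subspace_def P.add P.scaleR P.zero inner_add_left)

lemmas tgt_zero = subspace_0[OF subspace_tgt]
  and tgt_add = subspace_add[OF subspace_tgt]
  and tgt_scaleR = subspace_scale[OF subspace_tgt]
  and tgt_diff = subspace_diff[OF subspace_tgt]

lemma M_iff: "p \<in> M \<longleftrightarrow> \<pi> p = p \<and> p \<bullet> p = 1"
  by (simp add: M_eq norm_eq_1)

text \<open>Differentiating \<open>\<pi> c = c\<close> and \<open>c \<bullet> c = 1\<close> gives one inclusion, great circles give the other.\<close>

lemma tangent_space_eq:
  assumes "p \<in> M"
  shows "tangent_space M p = tgt p"
proof (intro equalityI subsetI)
  fix v assume "v \<in> tangent_space M p"
  then obtain c where c: "\<And>t. c t \<in> M" "c 0 = p" "(c has_vector_derivative v) (at 0)"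
    by (auto simp: tangent_space_def curve_at_def)
  have "((\<lambda>t. \<pi> (c t)) has_vector_derivative \<pi> v) (at 0)"
    by (rule P.has_vector_derivative[OF c(3)])
  then have "\<pi> v = v"
    using c(1,3) vector_derivative_unique_at by (simp add: M_iff) blast
  moreover have "((\<lambda>t. c t \<bullet> c t) has_vector_derivative (c 0 \<bullet> v + v \<bullet> c 0)) (at 0)"
    by (rule bounded_bilinear.has_vector_derivative[OF bounded_bilinear_inner c(3,3)])
  then have "c 0 \<bullet> v + v \<bullet> c 0 = 0"
    using c(1) vector_derivative_unique_at[of "\<lambda>t. 1::real"] has_vector_derivative_const
    by (simp add: M_iff)
  then have "v \<bullet> p = 0" using c(2) by (simp add: inner_commute)
  ultimately show "v \<in> tgt p" by (simp add: tgt_def)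
next
  fix v assume v: "v \<in> tgt p"
  show "v \<in> tangent_space M p"
  proof (cases "v = 0")
    case True
    then have "curve_at M p v (\<lambda>t. p)" using assms by (simp add: curve_at_def)
    then show ?thesis by (auto simp: tangent_space_def)
  next
    case False
    define s where "s = norm v"
    define w where "w = (1 / s) *\<^sub>R v"
    have s: "s \<noteq> 0" "s *\<^sub>R w = v" using False by (simp_all add: s_def w_def)
    have w: "\<pi> w = w" "w \<bullet> p = 0" "w \<bullet> w = 1"
      using v False by (simp_all add: w_def s_def tgt_def P.scaleR dot_square_norm power2_eq_square)
    define c where "c = (\<lambda>t. cos (s * t) *\<^sub>R p + sin (s * t) *\<^sub>R w)"
    have "c t \<in> M" for t
    proof -
      have "c t \<bullet> c t = cos (s * t) ^ 2 + sin (s * t) ^ 2"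
        using w assms by (simp add: c_def M_iff inner_add_left inner_add_right inner_commute power2_eq_square)
      then show ?thesis using w assms by (simp add: M_iff c_def P.add P.scaleR)
    qed
    moreover have "(c has_vector_derivative v) (at 0)"
      unfolding c_def by (auto intro!: derivative_eq_intros simp: s)
    ultimately have "curve_at M p v c" by (simp add: curve_at_def c_def)
    then show ?thesis by (auto simp: tangent_space_def)
  qed
qed

lemma vector_fieldI:
  "smooth_on M X \<Longrightarrow> (\<And>p. p \<in> M \<Longrightarrow> X p \<in> tgt p) \<Longrightarrow> (\<And>p. p \<notin> M \<Longrightarrow> X p = 0) \<Longrightarrow> X \<in> vector_fields M"
  by (simp add: vector_fields_def tangent_space_eq)

lemma vector_fieldD:
  assumes "X \<in> vector_fields M"
  shows "smooth_on M X" "p \<in> M \<Longrightarrow> X p \<in> tgt p" "p \<notin> M \<Longrightarrow> X p = 0"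
    "p \<in> M \<Longrightarrow> X p \<in> tangent_space M p"
  using assms by (auto simp: vector_fields_def tangent_space_eq)

lemma vector_field_add:
  "X \<in> vector_fields M \<Longrightarrow> Y \<in> vector_fields M \<Longrightarrow> (\<lambda>p. X p + Y p) \<in> vector_fields M"
  by (rule vector_fieldI) (auto simp: vector_fieldD(3) intro: smooth_on_add tgt_add dest: vector_fieldD)

lemma vector_field_scale:
  "smooth_on M f \<Longrightarrow> X \<in> vector_fields M \<Longrightarrow> (\<lambda>p. f p *\<^sub>R X p) \<in> vector_fields M"
  by (rule vector_fieldI)
    (auto intro: smooth_on_scaleR tgt_scaleR dest: vector_fieldD)

lemma vector_field_zero: "(\<lambda>p. 0) \<in> vector_fields M"
  by (rule vector_fieldI) (auto intro: smooth_on_const tgt_zero)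

text \<open>Global vector fields that span every tangent space. They serve as a substitute for local frames.\<close>

definition proj_field :: "'v \<Rightarrow> 'v \<Rightarrow> 'v" where
  "proj_field e p = (if p \<in> M then e - (e \<bullet> p) *\<^sub>R p else 0)"

lemma proj_field_vector_field:
  assumes "\<pi> e = e"
  shows "proj_field e \<in> vector_fields M"
proof (rule vector_fieldI)
  have "smooth_on M (\<lambda>p. e + (- (e \<bullet> p)) *\<^sub>R p)"
    by (intro smooth_on_add smooth_on_const smooth_on_scaleR smooth_on_id
        smooth_on_linear[OF bounded_linear_minus[OF bounded_linear_ident]]
        smooth_on_inner)
  then show "smooth_on M (proj_field e)"
    by (rule smooth_on_cong) (simp add: proj_field_def)
  show "proj_field e p \<in> tgt p" if "p \<in> M" for p
    using that assms by (simp add: proj_field_def tgt_def M_iff P.diff P.scaleR inner_diff_left)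
qed (simp add: proj_field_def)

lemma proj_field_tgt: "p \<in> M \<Longrightarrow> e \<in> tgt p \<Longrightarrow> proj_field e p = e"
  by (simp add: proj_field_def tgt_def)

lemma tgt_proj: "e \<in> tgt p \<Longrightarrow> \<pi> e = e"
  by (simp add: tgt_def)

lemma vector_field_expansion:
  assumes X: "X \<in> vector_fields M"
  shows "X = (\<lambda>p. \<Sum>e\<in>Basis. (X p \<bullet> e) *\<^sub>R proj_field (\<pi> e) p)"
proof
  fix p
  show "X p = (\<Sum>e\<in>Basis. (X p \<bullet> e) *\<^sub>R proj_field (\<pi> e) p)"
  proof (cases "p \<in> M")
    case True
    have t: "\<pi> (X p) = X p" "X p \<bullet> p = 0" using vector_fieldD(2)[OF X True] by (auto simp: tgt_def)
    have s: "(\<Sum>e\<in>Basis. (X p \<bullet> e) *\<^sub>R \<pi> e) = X p"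
      using t(1) by (simp add: P.scaleR[symmetric] P.sum[symmetric] euclidean_representation)
    have "(\<Sum>e\<in>Basis. (X p \<bullet> e) *\<^sub>R proj_field (\<pi> e) p)
        = (\<Sum>e\<in>Basis. (X p \<bullet> e) *\<^sub>R \<pi> e) - ((\<Sum>e\<in>Basis. (X p \<bullet> e) *\<^sub>R \<pi> e) \<bullet> p) *\<^sub>R p"
      using True by (simp add: proj_field_def scaleR_diff_right sum_subtractf inner_sum_left scaleR_sum_left)
    then show ?thesis using t by (simp add: s)
  qed (simp add: vector_fieldD(3)[OF X] proj_field_def)
qed

text \<open>The usual tensoriality criterion; the tangential projections of the constant fields take
  the place of local frames extended by cut-off functions.\<close>

lemma tensorial:
  fixes L :: "('v \<Rightarrow> 'v) \<Rightarrow> 'w::real_vector"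
  assumes add: "\<And>X Y. X \<in> vector_fields M \<Longrightarrow> Y \<in> vector_fields M \<Longrightarrow> L (\<lambda>p. X p + Y p) = L X + L Y"
    and scale: "\<And>f X. smooth_on M f \<Longrightarrow> X \<in> vector_fields M \<Longrightarrow> L (\<lambda>p. f p *\<^sub>R X p) = f b *\<^sub>R L X"
    and X: "X \<in> vector_fields M" "Y \<in> vector_fields M" "X b = Y b"
  shows "L X = L Y"
proof -
  have L0: "L (\<lambda>p. 0) = 0"
    using scale[OF smooth_on_const vector_field_zero, of 0] by simp
  have F: "(\<lambda>p. (X p \<bullet> e) *\<^sub>R proj_field (\<pi> e) p) \<in> vector_fields M" if "X \<in> vector_fields M" for X e
    by (intro vector_field_scale smooth_on_inner vector_fieldD(1)[OF that]
        smooth_on_const proj_field_vector_field proj_idem)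
  have S: "(\<lambda>p. \<Sum>e\<in>A. (X p \<bullet> e) *\<^sub>R proj_field (\<pi> e) p) \<in> vector_fields M \<and>
      L (\<lambda>p. \<Sum>e\<in>A. (X p \<bullet> e) *\<^sub>R proj_field (\<pi> e) p) = (\<Sum>e\<in>A. (X b \<bullet> e) *\<^sub>R L (proj_field (\<pi> e)))"
    if X: "X \<in> vector_fields M" and A: "finite A" for X A
    using A
  proof (induction A rule: finite_induct)
    case empty
    then show ?case by (simp add: L0 vector_field_zero)
  next
    case (insert e A)
    have "L (\<lambda>p. (X p \<bullet> e) *\<^sub>R proj_field (\<pi> e) p) = (X b \<bullet> e) *\<^sub>R L (proj_field (\<pi> e))"
      by (intro scale smooth_on_inner vector_fieldD(1)[OF X]
        smooth_on_const proj_field_vector_field proj_idem)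
    then show ?case
      using insert by (simp add: add F X vector_field_add)
  qed
  have "L X = (\<Sum>e\<in>Basis. (X b \<bullet> e) *\<^sub>R L (proj_field (\<pi> e)))" if X: "X \<in> vector_fields M" for X
    using S[OF X finite_Basis] by (subst vector_field_expansion[OF X]) blast
  then show ?thesis using X by simp
qed

text \<open>The first two summands are the Levi-Civita connection of the round metric, the tangential part of
  the ambient derivative: as \<open>Y\<close> is orthogonal to the position vector, the derivative has the normal
  component \<open>- (X \<bullet> Y) p\<close>.\<close>

definition connection :: "('v \<Rightarrow> 'v \<Rightarrow> 'v \<Rightarrow> 'v) \<Rightarrow> 'v connection" where
  "connection T X Y =
     (if X \<in> vector_fields M \<and> Y \<in> vector_fields M
      then (\<lambda>p. if p \<in> M then dir_deriv M Y p (X p) + (X p \<bullet> Y p) *\<^sub>R p + T p (X p) (Y p) else 0)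
      else (\<lambda>_. 0))"

lemma connection_at:
  "X \<in> vector_fields M \<Longrightarrow> Y \<in> vector_fields M \<Longrightarrow> p \<in> M \<Longrightarrow>
    connection T X Y p = dir_deriv M Y p (X p) + (X p \<bullet> Y p) *\<^sub>R p + T p (X p) (Y p)"
  by (simp add: connection_def)

lemma dir_deriv_tangent:
  assumes X: "X \<in> vector_fields M" and Y: "Y \<in> vector_fields M" and p: "p \<in> M"
  shows "dir_deriv M Y p (X p) + (X p \<bullet> Y p) *\<^sub>R p \<in> tgt p"
proof -
  note [simp] = vector_fieldD[OF X] vector_fieldD[OF Y] p
  have v: "X p \<in> tangent_space M p" by simp
  obtain c where c: "curve_at M p (X p) c" using v by (auto simp: tangent_space_def)
  then have cM: "\<And>t. c t \<in> M" "c 0 = p" "(c has_vector_derivative X p) (at 0)" by (auto simp: curve_at_def)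
  have Yc: "((\<lambda>t. Y (c t)) has_vector_derivative dir_deriv M Y p (X p)) (at 0)"
    by (rule dir_deriv_curve[OF _ _ c]) simp_all
  have "((\<lambda>t. \<pi> (Y (c t))) has_vector_derivative \<pi> (dir_deriv M Y p (X p))) (at 0)"
    by (rule P.has_vector_derivative[OF Yc])
  moreover have "(\<lambda>t. \<pi> (Y (c t))) = (\<lambda>t. Y (c t))"
    using vector_fieldD(2)[OF Y cM(1)] by (simp add: tgt_def)
  ultimately have 1: "\<pi> (dir_deriv M Y p (X p)) = dir_deriv M Y p (X p)"
    using Yc vector_derivative_unique_at by simp blast
  have "((\<lambda>t. Y (c t) \<bullet> c t) has_vector_derivative (Y (c 0) \<bullet> X p + dir_deriv M Y p (X p) \<bullet> c 0)) (at 0)"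
    by (rule bounded_bilinear.has_vector_derivative[OF bounded_bilinear_inner Yc cM(3)])
  moreover have "(\<lambda>t. Y (c t) \<bullet> c t) = (\<lambda>t. 0)"
    using vector_fieldD(2)[OF Y cM(1)] by (simp add: tgt_def)
  ultimately have "Y (c 0) \<bullet> X p + dir_deriv M Y p (X p) \<bullet> c 0 = 0"
    using vector_derivative_unique_at[OF _ has_vector_derivative_const] by metis
  with 1 show ?thesis
    using p cM(2) by (simp add: tgt_def P.add P.scaleR M_iff inner_add_right inner_commute)
qed

lemma affine_connection_connection:
  assumes bil: "\<And>p. bilinear (T p)"
    and tan: "\<And>p x y. p \<in> M \<Longrightarrow> x \<in> tgt p \<Longrightarrow> y \<in> tgt p \<Longrightarrow> T p x y \<in> tgt p"
    and sm: "\<And>X Y. X \<in> vector_fields M \<Longrightarrow> Y \<in> vector_fields M \<Longrightarrow> smooth_on M (\<lambda>p. T p (X p) (Y p))"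
  shows "affine_connection M (connection T)"
proof -
  note bl = bilinear_ladd[OF bil] bilinear_radd[OF bil] bilinear_lmul[OF bil] bilinear_rmul[OF bil]
  note vf = vector_field_add vector_field_scale
  have D_add: "dir_deriv M Y p (x + x') = dir_deriv M Y p x + dir_deriv M Y p x'"
    and D_scale: "dir_deriv M Y p (r *\<^sub>R x) = r *\<^sub>R dir_deriv M Y p x"
    if Y: "Y \<in> vector_fields M" and p: "p \<in> M" and x: "x \<in> tgt p" "x' \<in> tgt p" for Y p x x' r
  proof -
    obtain F' where F: "bounded_linear F'" "\<forall>v\<in>tangent_space M p. dir_deriv M Y p v = F' v"
      using dir_deriv_extension[OF vector_fieldD(1)[OF Y] p] .
    then interpret F: bounded_linear F' by simp
    show "dir_deriv M Y p (x + x') = dir_deriv M Y p x + dir_deriv M Y p x'"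
      "dir_deriv M Y p (r *\<^sub>R x) = r *\<^sub>R dir_deriv M Y p x"
      using F(2) x by (simp_all add: tangent_space_eq[OF p] tgt_add tgt_scaleR F.add F.scaleR)
  qed
  have C1: "connection T X Y \<in> vector_fields M" if X: "X \<in> vector_fields M" and Y: "Y \<in> vector_fields M" for X Y
  proof (rule vector_fieldI)
    have "smooth_on M (\<lambda>p. dir_deriv M Y p (X p) + (X p \<bullet> Y p) *\<^sub>R p + T p (X p) (Y p))"
      by (intro smooth_on_add smooth_on_dir_deriv sm smooth_on_scaleR
          smooth_on_inner smooth_on_id vector_fieldD(1,4)[OF X]
          vector_fieldD(1)[OF Y] X Y)
    then show "smooth_on M (connection T X Y)"
      by (rule smooth_on_cong) (simp add: connection_at X Y)
    show "connection T X Y p \<in> tgt p" if "p \<in> M" for p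
      using tgt_add[OF dir_deriv_tangent[OF X Y that] tan[OF that vector_fieldD(2)[OF X that] vector_fieldD(2)[OF Y that]]]
      by (simp add: connection_at X Y that)
  qed (simp add: connection_def)
  have C2: "connection T (\<lambda>p. X p + X' p) Y = (\<lambda>p. connection T X Y p + connection T X' Y p)"
    if X: "X \<in> vector_fields M" and X': "X' \<in> vector_fields M" and Y: "Y \<in> vector_fields M" for X X' Y
    using X X' Y by (auto simp: fun_eq_iff connection_def vf bl D_add[OF Y] vector_fieldD(2) inner_add_left scaleR_add_left)
  have C3: "connection T (\<lambda>p. f p *\<^sub>R X p) Y = (\<lambda>p. f p *\<^sub>R connection T X Y p)"
    if X: "X \<in> vector_fields M" and Y: "Y \<in> vector_fields M" and f: "smooth_on M f" for X Y f
    using X Y f by (auto simp: fun_eq_iff connection_def vf bl D_scale[OF Y _ _ tgt_zero] vector_fieldD(2) scaleR_add_right)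
  have C4: "connection T X (\<lambda>p. Y p + Y' p) = (\<lambda>p. connection T X Y p + connection T X Y' p)"
    if X: "X \<in> vector_fields M" and Y: "Y \<in> vector_fields M" and Y': "Y' \<in> vector_fields M" for X Y Y'
    using X Y Y' by (auto simp: fun_eq_iff connection_def vf bl dir_deriv_add vector_fieldD inner_add_right scaleR_add_left)
  have C5: "connection T X (\<lambda>p. f p *\<^sub>R Y p) =
      (\<lambda>p. dir_deriv M f p (X p) *\<^sub>R Y p + f p *\<^sub>R connection T X Y p)"
    if X: "X \<in> vector_fields M" and Y: "Y \<in> vector_fields M" and f: "smooth_on M f" for X Y f
    using X Y f by (auto simp: fun_eq_iff connection_def vf bl vector_fieldD
        dir_deriv_bilinear[OF bounded_bilinear_scaleR f] scaleR_add_right)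
  have C6: "connection T X Y = (\<lambda>_. 0)" if "X \<notin> vector_fields M \<or> Y \<notin> vector_fields M" for X Y
    using that by (auto simp: connection_def)
  show ?thesis
    unfolding affine_connection_def
    by (intro conjI ballI allI impI; (rule C1 C2 C3 C4 C5 C6; assumption))
qed

definition symmetry :: "('v \<Rightarrow> 'v) \<Rightarrow> bool" where
  "symmetry f \<longleftrightarrow> orthogonal_transformation f \<and> (\<forall>x. f (\<pi> x) = \<pi> (f x))"

lemma symmetry_inv:
  assumes "symmetry f"
  shows "symmetry (inv f)" "f (inv f x) = x" "inv f (f x) = x" "inv (inv f) = f" "bounded_linear f"
    "f x \<bullet> f y = x \<bullet> y" "\<pi> (f x) = f (\<pi> x)"
proof -
  have o: "orthogonal_transformation f" and c: "\<And>x. f (\<pi> x) = \<pi> (f x)" using assms by (auto simp: symmetry_def)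
  have b: "bij f" by (rule orthogonal_transformation_bij[OF o])
  show 1: "f (inv f x) = x" "inv f (f x) = x" for x
    using b by (simp_all add: bij_is_surj surj_f_inv_f bij_is_inj)
  show "inv (inv f) = f" by (rule inv_inv_eq[OF b])
  show "bounded_linear f" using o by (simp add: orthogonal_transformation_linear linear_conv_bounded_linear[symmetric])
  show "f x \<bullet> f y = x \<bullet> y" using o by (simp add: orthogonal_transformation_def)
  show "\<pi> (f x) = f (\<pi> x)" by (simp add: c)
  have "inv f (\<pi> x) = \<pi> (inv f x)" for x
    using c[of "inv f x"] 1 by metis
  then show "symmetry (inv f)" using o by (simp add: symmetry_def orthogonal_transformation_inv)
qed

lemma symmetry_M:
  assumes "symmetry f"
  shows "f p \<in> M \<longleftrightarrow> p \<in> M"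
  using symmetry_inv[OF assms] by (simp add: M_iff) metis

lemma symmetry_tgt:
  assumes "symmetry f"
  shows "f v \<in> tgt (f p) \<longleftrightarrow> v \<in> tgt p"
  using symmetry_inv[OF assms] by (simp add: tgt_def) metis

lemma transport_vector_field:
  assumes f: "symmetry f" and X: "X \<in> vector_fields M"
  shows "transport f X \<in> vector_fields M"
proof (rule vector_fieldI)
  note s = symmetry_inv[OF f]
  have i: "inv f p \<in> M \<longleftrightarrow> p \<in> M" for p by (rule symmetry_M[OF s(1)])
  show "smooth_on M (transport f X)"
    unfolding transport_def
    by (rule smooth_on_linear[OF s(5) smooth_on_compose_linear[OF symmetry_inv(5)[OF s(1)] _ vector_fieldD(1)[OF X]]])
      (simp add: i)
  show "transport f X p \<in> tgt p" if "p \<in> M" for p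
    using symmetry_tgt[OF f, of "X (inv f p)" "inv f p"] vector_fieldD(2)[OF X, of "inv f p"] that
    by (simp add: transport_def i s)
  show "transport f X p = 0" if "p \<notin> M" for p
    using vector_fieldD(3)[OF X, of "inv f p"] that linear_0[OF bounded_linear.linear[OF s(5)]]
    by (simp add: transport_def i)
qed

lemma transport_inv:
  assumes f: "symmetry f"
  shows "transport f (transport (inv f) X) = X" "transport f X (f p) = f (X p)"
  using symmetry_inv[OF f] by (simp_all add: transport_def fun_eq_iff)

lemma dir_deriv_transport:
  assumes f: "symmetry f" and Y: "Y \<in> vector_fields M" and p: "p \<in> M" and v: "v \<in> tgt p"
  shows "dir_deriv M (transport f Y) (f p) (f v) = f (dir_deriv M Y p v)"
proof -
  obtain c where c: "curve_at M p v c" using v p by (auto simp: tangent_space_def tangent_space_eq[symmetric])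
  have fc: "curve_at M (f p) (f v) (\<lambda>t. f (c t))"
    using c bounded_linear.has_vector_derivative[OF symmetry_inv(5)[OF f]]
    by (simp add: curve_at_def symmetry_M[OF f])
  show ?thesis
  proof (rule dir_deriv_curve_eqI[OF _ _ fc])
    show "smooth_on M (transport f Y)" by (rule vector_fieldD(1)[OF transport_vector_field[OF f Y]])
    show "((\<lambda>t. transport f Y (f (c t))) has_vector_derivative f (dir_deriv M Y p v)) (at 0)"
      unfolding transport_inv[OF f]
      by (rule bounded_linear.has_vector_derivative[OF symmetry_inv(5)[OF f] dir_deriv_curve[OF vector_fieldD(1)[OF Y] p c]])
  qed (simp add: p symmetry_M[OF f])
qed

lemma connection_transport:
  assumes f: "symmetry f" and X: "X \<in> vector_fields M" and Y: "Y \<in> vector_fields M"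
    and T: "\<And>p x y. p \<in> M \<Longrightarrow> x \<in> tgt p \<Longrightarrow> y \<in> tgt p \<Longrightarrow> T (f p) (f x) (f y) = f (T p x y)"
  shows "connection T (transport f X) (transport f Y) = transport f (connection T X Y)"
proof
  fix q
  note s = symmetry_inv[OF f]
  define p where "p = inv f q"
  have q: "q = f p" by (simp add: p_def s)
  interpret f: bounded_linear f by (rule s(5))
  show "connection T (transport f X) (transport f Y) q = transport f (connection T X Y) q"
  proof (cases "p \<in> M")
    case True
    then show ?thesis
      using dir_deriv_transport[OF f Y True vector_fieldD(2)[OF X True]]
      by (simp add: q connection_at transport_vector_field[OF f] X Y symmetry_M[OF f] transport_inv[OF f]
          f.add f.scaleR s(6) T vector_fieldD(2))
  qed (simp add: q connection_def symmetry_M[OF f] transport_inv[OF f] X Y f.zero transport_vector_field[OF f])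
qed

end

section \<open>Invariant connections on a homogeneous sphere\<close>

lemma has_vector_derivative_const_iff:
  "((\<lambda>t. c) has_vector_derivative d) (at x) \<longleftrightarrow> d = 0"
  using vector_derivative_unique_at[OF _ has_vector_derivative_const] has_vector_derivative_const
  by blast

lemma lie_algebra_curve:
  assumes "X \<in> lie_algebra G"
  obtains c where "\<forall>t. c t \<in> G" "c 0 = id_blinfun"
    "\<forall>x. ((\<lambda>t. blinfun_apply (c t) x) has_vector_derivative blinfun_apply X x) (at 0)"
proof -
  obtain c where c: "\<And>t. c t \<in> G" "c 0 = id_blinfun" "(c has_vector_derivative X) (at 0)"
    using assms by (auto simp: lie_algebra_def tangent_space_def curve_at_def)
  show ?thesis
    by (rule that[of c]) (use c bounded_linear.has_vector_derivative[OF
        bounded_bilinear.bounded_linear_left[OF bounded_bilinear_blinfun_apply]] in auto)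
qed

lemma affine_connectionD:
  assumes "affine_connection M D"
  shows "X \<in> vector_fields M \<Longrightarrow> Y \<in> vector_fields M \<Longrightarrow> D X Y \<in> vector_fields M"
    "X \<notin> vector_fields M \<or> Y \<notin> vector_fields M \<Longrightarrow> D X Y = (\<lambda>_. 0)"
  using assms unfolding affine_connection_def by simp_all

text \<open>Relativised to \<open>V\<close>, the tangent space at the base point, where alone the maps in question are
  determined.\<close>

definition equivariant_bilinear :: "'v::euclidean_space set \<Rightarrow> 'v endo set \<Rightarrow> ('v \<Rightarrow> 'v \<Rightarrow> 'v) \<Rightarrow> bool" where
  "equivariant_bilinear V K \<beta> \<longleftrightarrow>
     (\<forall>x\<in>V. \<forall>y\<in>V. \<beta> x y \<in> V \<and>
       (\<forall>z\<in>V. \<beta> (x + z) y = \<beta> x y + \<beta> z y \<and> \<beta> x (y + z) = \<beta> x y + \<beta> x z) \<and>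
       (\<forall>r. \<beta> (r *\<^sub>R x) y = r *\<^sub>R \<beta> x y \<and> \<beta> x (r *\<^sub>R y) = r *\<^sub>R \<beta> x y) \<and>
       (\<forall>k\<in>K. \<beta> (blinfun_apply k x) (blinfun_apply k y) = blinfun_apply k (\<beta> x y)))"

lemma equivariant_bilinearI:
  assumes "\<And>x y. x \<in> V \<Longrightarrow> y \<in> V \<Longrightarrow> \<beta> x y \<in> V"
    and "\<And>x z y. x \<in> V \<Longrightarrow> z \<in> V \<Longrightarrow> y \<in> V \<Longrightarrow> \<beta> (x + z) y = \<beta> x y + \<beta> z y"
    and "\<And>x y z. x \<in> V \<Longrightarrow> y \<in> V \<Longrightarrow> z \<in> V \<Longrightarrow> \<beta> x (y + z) = \<beta> x y + \<beta> x z"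
    and "\<And>r x y. x \<in> V \<Longrightarrow> y \<in> V \<Longrightarrow> \<beta> (r *\<^sub>R x) y = r *\<^sub>R \<beta> x y"
    and "\<And>r x y. x \<in> V \<Longrightarrow> y \<in> V \<Longrightarrow> \<beta> x (r *\<^sub>R y) = r *\<^sub>R \<beta> x y"
    and "\<And>k x y. k \<in> K \<Longrightarrow> x \<in> V \<Longrightarrow> y \<in> V \<Longrightarrow>
      \<beta> (blinfun_apply k x) (blinfun_apply k y) = blinfun_apply k (\<beta> x y)"
  shows "equivariant_bilinear V K \<beta>"
  using assms by (simp add: equivariant_bilinear_def)

lemma equivariant_bilinearD:
  assumes "equivariant_bilinear V K \<beta>" "x \<in> V" "y \<in> V"
  shows "\<beta> x y \<in> V"
    and "z \<in> V \<Longrightarrow> \<beta> (x + z) y = \<beta> x y + \<beta> z y"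
    and "z \<in> V \<Longrightarrow> \<beta> x (y + z) = \<beta> x y + \<beta> x z"
    and "\<beta> (r *\<^sub>R x) y = r *\<^sub>R \<beta> x y"
    and "\<beta> x (r *\<^sub>R y) = r *\<^sub>R \<beta> x y"
    and "k \<in> K \<Longrightarrow> \<beta> (blinfun_apply k x) (blinfun_apply k y) = blinfun_apply k (\<beta> x y)"
  using assms by (simp_all add: equivariant_bilinear_def)

text \<open>The common setting of the two spheres. \<open>T\<close> is a family of invariant tensors, linear in a parameter
  \<open>s\<close> from a real algebra of scalars, whose values at the base point are exactly the bilinear maps of
  the tangent space that are equivariant under the isotropy group. Pointwise properties are required
  at the base point only; \<open>T_equivariant\<close> moves them along the orbit.\<close>

locale homogeneous_sphere = unit_sphere \<pi> M
  for \<pi> :: "'v::euclidean_space \<Rightarrow> 'v" and M +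
  fixes G K :: "'v endo set" and b :: 'v
    and T :: "'s::{euclidean_space, real_normed_field} \<Rightarrow> 'v \<Rightarrow> 'v \<Rightarrow> 'v \<Rightarrow> 'v"
  assumes homogeneous: "homogeneous_space G K M b"
    and G_symmetry: "g \<in> G \<Longrightarrow> symmetry (blinfun_apply g)"
    and isotropic: "x \<in> tgt b \<Longrightarrow> y \<in> tgt b \<Longrightarrow> norm x = norm y \<Longrightarrow> \<exists>k\<in>K. blinfun_apply k x = y"
    and T_bilinear: "bilinear (T s p)"
    and T_linear: "linear (\<lambda>s. T s p x y)"
    and T_tgt: "x \<in> tgt b \<Longrightarrow> y \<in> tgt b \<Longrightarrow> T s b x y \<in> tgt b"
    and T_equivariant: "g \<in> G \<Longrightarrow> p \<in> M \<Longrightarrow> x \<in> tgt p \<Longrightarrow> y \<in> tgt p \<Longrightarrow>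
        T s (blinfun_apply g p) (blinfun_apply g x) (blinfun_apply g y) = blinfun_apply g (T s p x y)"
    and T_smooth: "X \<in> vector_fields M \<Longrightarrow> Y \<in> vector_fields M \<Longrightarrow> smooth_on M (\<lambda>p. T s p (X p) (Y p))"
    and T_skew: "x \<in> tgt b \<Longrightarrow> y \<in> tgt b \<Longrightarrow> z \<in> tgt b \<Longrightarrow> T s b x y \<bullet> z = - (y \<bullet> T s b x z)"
    and T_alternating: "x \<in> tgt b \<Longrightarrow> y \<in> tgt b \<Longrightarrow> T s b x y = - T s b y x"
    and T_faithful: "(\<And>x y. x \<in> tgt b \<Longrightarrow> y \<in> tgt b \<Longrightarrow> T s b x y = 0) \<Longrightarrow> s = 0"
    and T_complete: "equivariant_bilinear (tgt b) K \<beta> \<Longrightarrow>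
        \<exists>s. \<forall>x\<in>tgt b. \<forall>y\<in>tgt b. \<beta> x y = T s b x y"
begin

lemma b_in_M: "b \<in> M" and K_iff: "k \<in> K \<longleftrightarrow> k \<in> G \<and> blinfun_apply k b = b"
  and orbit: "p \<in> M \<Longrightarrow> \<exists>g\<in>G. p = blinfun_apply g b"
  and G_M: "g \<in> G \<Longrightarrow> p \<in> M \<Longrightarrow> blinfun_apply g p \<in> M"
  using homogeneous symmetry_M[OF G_symmetry] unfolding homogeneous_space_def by auto

lemma G_tgt: "g \<in> G \<Longrightarrow> blinfun_apply g v \<in> tgt (blinfun_apply g p) \<longleftrightarrow> v \<in> tgt p"
  by (rule symmetry_tgt[OF G_symmetry])

lemma T_zero: "T 0 p x y = 0"
  using linear_0[OF T_linear] .

lemma T_tangent: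
  assumes "p \<in> M" "x \<in> tgt p" "y \<in> tgt p"
  shows "T s p x y \<in> tgt p"
proof -
  obtain g where g: "g \<in> G" "p = blinfun_apply g b" using orbit[OF assms(1)] by blast
  note i = symmetry_inv[OF G_symmetry[OF g(1)]]
  have "inv (blinfun_apply g) x \<in> tgt b" "inv (blinfun_apply g) y \<in> tgt b"
    using assms(2,3) G_tgt[OF g(1), of "inv (blinfun_apply g) x" b]
      G_tgt[OF g(1), of "inv (blinfun_apply g) y" b] by (simp_all add: i g(2))
  then show ?thesis
    using T_equivariant[OF g(1) b_in_M, of "inv (blinfun_apply g) x" "inv (blinfun_apply g) y" s]
      G_tgt[OF g(1)] T_tgt by (simp add: i g(2))
qed

lemma connection_invariant: "connection (T s) \<in> invariant_connections G M"
  unfolding invariant_connections_def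
proof (intro CollectI conjI ballI)
  show "affine_connection M (connection (T s))"
    by (rule affine_connection_connection[OF T_bilinear T_tangent T_smooth])
  show "connection (T s) (push_forward g X) (push_forward g Y) = push_forward g (connection (T s) X Y)"
    if "g \<in> G" "X \<in> vector_fields M" "Y \<in> vector_fields M" for g X Y
    unfolding push_forward_transport
    by (rule connection_transport[OF G_symmetry[OF that(1)] that(2,3)]) (rule T_equivariant[OF that(1)])
qed

text \<open>Each point is \<open>g b\<close> for some \<open>g\<close>, and each field is the push-forward along \<open>g\<close> of another
  one, so invariance propagates the values at \<open>b\<close>.\<close>

lemma invariant_connection_eqI:
  assumes D: "D \<in> invariant_connections G M" and D': "D' \<in> invariant_connections G M"
    and eq: "\<And>X Y. X \<in> vector_fields M \<Longrightarrow> Y \<in> vector_fields M \<Longrightarrow> D X Y b = D' X Y b"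
  shows "D = D'"
proof (intro ext)
  fix X Y p
  have A: "affine_connection M D" "affine_connection M D'"
    using D D' by (simp_all add: invariant_connections_def)
  show "D X Y p = D' X Y p"
  proof (cases "X \<in> vector_fields M \<and> Y \<in> vector_fields M")
    case False
    then have "X \<notin> vector_fields M \<or> Y \<notin> vector_fields M" by simp
    then show ?thesis using A[THEN affine_connectionD(2)] by simp
  next
    case True
    then have vf: "D X Y \<in> vector_fields M" "D' X Y \<in> vector_fields M"
      using A[THEN affine_connectionD(1)] by simp_all
    show ?thesis
    proof (cases "p \<in> M")
      case False
      then show ?thesis using vector_fieldD(3)[OF vf(1)] vector_fieldD(3)[OF vf(2)] by simp
    next
      case p: True
      obtain g where g: "g \<in> G" "p = blinfun_apply g b" using orbit[OF p] by blast
      note s = G_symmetry[OF g(1)]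
      define X' where "X' = transport (inv (blinfun_apply g)) X"
      define Y' where "Y' = transport (inv (blinfun_apply g)) Y"
      have v: "X' \<in> vector_fields M" "Y' \<in> vector_fields M"
        using True by (auto simp: X'_def Y'_def intro: transport_vector_field symmetry_inv(1)[OF s])
      have t: "X = push_forward g X'" "Y = push_forward g Y'"
        by (simp_all add: X'_def Y'_def push_forward_transport transport_inv[OF s])
      have "E X Y = push_forward g (E X' Y')" if "E \<in> invariant_connections G M" for E
        using that g(1) v unfolding t invariant_connections_def by blast
      then show ?thesis
        using D D' eq[OF v] by (simp add: g(2) push_forward_transport transport_inv[OF s])
    qed
  qed
qed

text \<open>The difference from the round Levi-Civita connection is tensorial in both arguments, hence a
  bilinear map \<open>\<beta>\<close> of the tangent space at \<open>b\<close>. It is evaluated on the projected constant fields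
  because the isotropy group permutes these, which makes \<open>\<beta>\<close> equivariant.\<close>

lemma invariant_connection_cases:
  assumes D: "D \<in> invariant_connections G M"
  shows "\<exists>s. D = connection (T s)"
proof -
  define E where "E = connection (T 0)"
  have E: "E \<in> invariant_connections G M" unfolding E_def by (rule connection_invariant)
  define \<Delta> where "\<Delta> = (\<lambda>X Y. D X Y b - E X Y b)"
  have A: "affine_connection M D" "affine_connection M E"
    using D E by (simp_all add: invariant_connections_def)
  have add1: "\<Delta> (\<lambda>p. X p + X' p) Y = \<Delta> X Y + \<Delta> X' Y"
    and add2: "\<Delta> Y (\<lambda>p. X p + X' p) = \<Delta> Y X + \<Delta> Y X'"
    and tan: "\<Delta> X Y \<in> tgt b"
    if "X \<in> vector_fields M" "X' \<in> vector_fields M" "Y \<in> vector_fields M" for X X' Y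
  proof -
    show "\<Delta> (\<lambda>p. X p + X' p) Y = \<Delta> X Y + \<Delta> X' Y" "\<Delta> Y (\<lambda>p. X p + X' p) = \<Delta> Y X + \<Delta> Y X'"
      using A that unfolding \<Delta>_def affine_connection_def by simp_all
    show "\<Delta> X Y \<in> tgt b"
      using A that vector_fieldD(2)[OF _ b_in_M] unfolding \<Delta>_def affine_connection_def
      by (simp add: tgt_diff)
  qed
  have sc1: "\<Delta> (\<lambda>p. f p *\<^sub>R X p) Y = f b *\<^sub>R \<Delta> X Y"
    and sc2: "\<Delta> Y (\<lambda>p. f p *\<^sub>R X p) = f b *\<^sub>R \<Delta> Y X"
    if "smooth_on M f" "X \<in> vector_fields M" "Y \<in> vector_fields M" for f X Y
    using A that unfolding \<Delta>_def affine_connection_def by (simp_all add: scaleR_diff_right)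
  have dep: "\<Delta> X Y = \<Delta> X' Y'"
    if v: "X \<in> vector_fields M" "X' \<in> vector_fields M" "Y \<in> vector_fields M" "Y' \<in> vector_fields M"
      and e: "X b = X' b" "Y b = Y' b" for X X' Y Y'
  proof -
    have "\<Delta> X Y = \<Delta> X' Y"
      by (rule tensorial[where L="\<lambda>X. \<Delta> X Y" and b=b, OF _ _ v(1,2) e(1)])
        (rule add1 sc1; (assumption | rule v))+
    also have "\<dots> = \<Delta> X' Y'"
      by (rule tensorial[where L="\<Delta> X'" and b=b, OF _ _ v(3,4) e(2)])
        (rule add2 sc2; (assumption | rule v))+
    finally show ?thesis .
  qed
  define \<beta> where "\<beta> = (\<lambda>x y. \<Delta> (proj_field x) (proj_field y))"
  note pf = proj_field_vector_field[OF tgt_proj]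
  have pf_add: "proj_field (x + y) = (\<lambda>p. proj_field x p + proj_field y p)"
    and pf_scale: "proj_field (r *\<^sub>R x) = (\<lambda>p. r *\<^sub>R proj_field x p)" for x y r
    by (auto simp: proj_field_def fun_eq_iff inner_add_left scaleR_add_left scaleR_diff_right)
  have pf_push: "proj_field (blinfun_apply k x) = push_forward k (proj_field x)" if k: "k \<in> K" for k x
  proof
    fix q
    have kG: "k \<in> G" using k by (simp add: K_iff)
    note s = symmetry_inv[OF G_symmetry[OF kG]]
    interpret k: bounded_linear "blinfun_apply k" by (rule s(5))
    show "proj_field (blinfun_apply k x) q = push_forward k (proj_field x) q"
      using symmetry_M[OF s(1), of q] s(6)[of x "inv (blinfun_apply k) q"]
      by (simp add: proj_field_def push_forward_def k.diff k.scaleR k.zero s(2))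
  qed
  have "\<exists>s. \<forall>x\<in>tgt b. \<forall>y\<in>tgt b. \<beta> x y = T s b x y"
  proof (rule T_complete, rule equivariant_bilinearI)
    fix k x y assume k: "k \<in> K" and x: "x \<in> tgt b" "y \<in> tgt b"
    have kG: "k \<in> G" "blinfun_apply k b = b" using k by (simp_all add: K_iff)
    have "F (push_forward k (proj_field x)) (push_forward k (proj_field y)) b
        = blinfun_apply k (F (proj_field x) (proj_field y) b)" if "F \<in> invariant_connections G M" for F
    proof -
      have "F (push_forward k (proj_field x)) (push_forward k (proj_field y)) = push_forward k (F (proj_field x) (proj_field y))"
        using that kG(1) pf x unfolding invariant_connections_def by simp
      moreover have "inv (blinfun_apply k) b = b"
        using symmetry_inv(3)[OF G_symmetry[OF kG(1)], of b] kG(2) by simp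
      ultimately show ?thesis by (simp add: push_forward_def)
    qed
    then show "\<beta> (blinfun_apply k x) (blinfun_apply k y) = blinfun_apply k (\<beta> x y)"
      by (simp add: \<beta>_def \<Delta>_def pf_push[OF k] D E blinfun.diff_right)
  qed (auto simp: \<beta>_def pf_add pf_scale intro!: tan add1 add2 pf sc1[OF smooth_on_const] sc2[OF smooth_on_const])
  then obtain s where s: "\<And>x y. x \<in> tgt b \<Longrightarrow> y \<in> tgt b \<Longrightarrow> \<beta> x y = T s b x y" by blast
  have "D = connection (T s)"
  proof (rule invariant_connection_eqI[OF D connection_invariant])
    fix X Y assume v: "X \<in> vector_fields M" "Y \<in> vector_fields M"
    note t = vector_fieldD(2)[OF v(1) b_in_M] vector_fieldD(2)[OF v(2) b_in_M]
    have "\<Delta> X Y = \<beta> (X b) (Y b)"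
      unfolding \<beta>_def by (rule dep) (use v t in \<open>simp_all add: pf proj_field_tgt b_in_M\<close>)
    then show "D X Y b = connection (T s) X Y b"
      using s[OF t] by (simp add: \<Delta>_def E_def connection_at v b_in_M T_zero algebra_simps)
  qed
  then show ?thesis by blast
qed

lemma invariant_connections_eq: "invariant_connections G M = range (\<lambda>s. connection (T s))"
  using connection_invariant invariant_connection_cases by blast

text \<open>The elements of the vector space over which the invariant connections form an affine space.\<close>

definition difference :: "'s \<Rightarrow> 'v connection" where
  "difference s = (\<lambda>X Y p.
     if X \<in> vector_fields M \<and> Y \<in> vector_fields M \<and> p \<in> M then T s p (X p) (Y p) else 0)"

lemma difference_linear: "linear difference"
  by (rule linearI)
    (auto simp: difference_def fun_eq_iff scaleR_fun_def linear_add[OF T_linear] linear_cmul[OF T_linear])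

lemma connection_diff: "connection (T s) - connection (T s') = difference (s - s')"
  by (auto simp: difference_def fun_eq_iff connection_def linear_diff[OF T_linear])

lemma difference_inj: "inj difference"
  unfolding linear_injective_0[OF difference_linear]
proof (intro allI impI, rule T_faithful)
  fix s x y assume d: "difference s = 0" and x: "x \<in> tgt b" "y \<in> tgt b"
  have "difference s (proj_field x) (proj_field y) b = 0" by (simp add: d)
  then show "T s b x y = 0"
    using x b_in_M by (simp add: difference_def proj_field_vector_field tgt_proj proj_field_tgt)
qed

lemma affine_dimension_invariant_connections:
  "affine_dimension (invariant_connections G M) = DIM('s)"
proof -
  have "{x - y |x y. x \<in> invariant_connections G M \<and> y \<in> invariant_connections G M} = range difference"
  proof (intro equalityI subsetI)
    fix d assume "d \<in> range difference"
    then obtain s where "d = connection (T s) - connection (T 0)"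
      using connection_diff[of _ 0] by (metis diff_zero imageE)
    then show "d \<in> {x - y |x y. x \<in> invariant_connections G M \<and> y \<in> invariant_connections G M}"
      using connection_invariant by blast
  qed (auto simp: invariant_connections_eq connection_diff)
  also have "\<dots> = span (difference ` Basis)"
    by (simp add: linear_span_image[OF difference_linear])
  finally show ?thesis
    unfolding affine_dimension_def
    using linear_independent_injective_image[OF difference_linear independent_Basis] difference_inj
      card_image[OF inj_on_subset[OF difference_inj subset_UNIV, of Basis]]
    by (simp add: dim_eq_card_independent)
qed

text \<open>The isotropy group is transitive on directions, so the metric is constant on unit vectors at \<open>b\<close>;
  polarisation determines it there, and invariance elsewhere.\<close>

lemma invariant_metric_round:
  assumes g: "invariant_metric G M g"
  obtains r where "\<forall>p\<in>M. \<forall>x\<in>tgt p. \<forall>y\<in>tgt p. g p x y = r * (x \<bullet> y)"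
proof -
  have lin: "g p (a *\<^sub>R u + c *\<^sub>R v) w = a * g p u w + c * g p v w"
    and sym: "g p u v = g p v u"
    if "p \<in> M" "u \<in> tgt p" "v \<in> tgt p" "w \<in> tgt p" for p u v w a c
    using g that unfolding invariant_metric_def riemannian_metric_def by (simp_all add: tangent_space_eq)
  have inv: "g (blinfun_apply h p) (blinfun_apply h u) (blinfun_apply h v) = g p u v"
    if "h \<in> G" "p \<in> M" "u \<in> tgt p" "v \<in> tgt p" for h p u v
    using g that unfolding invariant_metric_def by (simp add: tangent_space_eq)
  have scale: "g b (a *\<^sub>R u) (a *\<^sub>R u) = a\<^sup>2 * g b u u" if "u \<in> tgt b" for a u
    using lin[OF b_in_M that that tgt_scaleR[OF that], of a 0] lin[OF b_in_M that that that, of a 0]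
      sym[OF b_in_M that tgt_scaleR[OF that] that] by (simp add: power2_eq_square)
  have "\<exists>r. \<forall>u\<in>tgt b. g b u u = r * (u \<bullet> u)"
  proof (cases "\<exists>e\<in>tgt b. norm e = 1")
    case False
    have "u = 0" if "u \<in> tgt b" for u
    proof (rule ccontr)
      assume "u \<noteq> 0"
      then have "norm ((1 / norm u) *\<^sub>R u) = 1" by simp
      then show False using False tgt_scaleR[OF that, of "1 / norm u"] by blast
    qed
    then show ?thesis using scale[OF tgt_zero, of 0] by (intro exI[of _ 0]) force
  next
    case True
    then obtain e where e: "e \<in> tgt b" "norm e = 1" by blast
    have "g b u u = g b e e * (u \<bullet> u)" if u: "u \<in> tgt b" for u
    proof -
      obtain k where k: "k \<in> K" "blinfun_apply k (norm u *\<^sub>R e) = u"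
        using isotropic[OF tgt_scaleR[OF e(1), of "norm u"] u] e(2) by auto
      have "g b u u = g b (norm u *\<^sub>R e) (norm u *\<^sub>R e)"
        using inv[of k b "norm u *\<^sub>R e" "norm u *\<^sub>R e"] k b_in_M tgt_scaleR[OF e(1)] by (simp add: K_iff)
      then show ?thesis by (simp add: scale[OF e(1)] dot_square_norm)
    qed
    then show ?thesis by blast
  qed
  then obtain r where r: "\<And>u. u \<in> tgt b \<Longrightarrow> g b u u = r * (u \<bullet> u)" by blast
  have rb: "g b x y = r * (x \<bullet> y)" if x: "x \<in> tgt b" and y: "y \<in> tgt b" for x y
  proof -
    note xy = tgt_add[OF x y]
    have "g b (x + y) (x + y) = g b x x + 2 * g b x y + g b y y"
      using lin[OF b_in_M x y xy, of 1 1] lin[OF b_in_M x y x, of 1 1] lin[OF b_in_M x y y, of 1 1]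
        sym[OF b_in_M x xy xy] sym[OF b_in_M y xy xy] sym[OF b_in_M x y y] by simp
    then show ?thesis
      by (simp add: r[OF x] r[OF y] r[OF xy] inner_add_left inner_add_right inner_commute algebra_simps)
  qed
  have "g p x y = r * (x \<bullet> y)" if p: "p \<in> M" and x: "x \<in> tgt p" "y \<in> tgt p" for p x y
  proof -
    obtain h where h: "h \<in> G" "p = blinfun_apply h b" using orbit[OF p] by blast
    note i = symmetry_inv[OF G_symmetry[OF h(1)]]
    have t: "inv (blinfun_apply h) x \<in> tgt b" "inv (blinfun_apply h) y \<in> tgt b"
      using x G_tgt[OF h(1), of "inv (blinfun_apply h) x" b] G_tgt[OF h(1), of "inv (blinfun_apply h) y" b]
      by (simp_all add: i h(2))
    show ?thesis
      using inv[OF h(1) b_in_M t] rb[OF t] i(6)[of "inv (blinfun_apply h) x" "inv (blinfun_apply h) y"]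
      by (simp add: i h(2))
  qed
  then show ?thesis by (intro that) blast
qed

lemma T_skew_everywhere:
  assumes p: "p \<in> M" and x: "x \<in> tgt p" "y \<in> tgt p" "z \<in> tgt p"
  shows "T s p x y \<bullet> z = - (y \<bullet> T s p x z)"
proof -
  obtain h where h: "h \<in> G" "p = blinfun_apply h b" using orbit[OF p] by blast
  note i = symmetry_inv[OF G_symmetry[OF h(1)]]
  have pull: "\<exists>u'\<in>tgt b. u = blinfun_apply h u'" if "u \<in> tgt p" for u
    using that G_tgt[OF h(1), of "inv (blinfun_apply h) u" b]
    by (intro bexI[of _ "inv (blinfun_apply h) u"]) (simp_all add: i h(2))
  obtain x' y' z' where "x' \<in> tgt b" "y' \<in> tgt b" "z' \<in> tgt b"
    "x = blinfun_apply h x'" "y = blinfun_apply h y'" "z = blinfun_apply h z'"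
    using pull x by metis
  then show ?thesis by (simp add: h(2) T_equivariant[OF h(1) b_in_M] i(6) T_skew)
qed

text \<open>The round Levi-Civita connection is metric for every multiple of the Euclidean inner product, and
  adding \<open>T\<close> keeps this property because \<open>T p x\<close> is skew-symmetric.\<close>

lemma invariant_connections_metric:
  assumes g: "invariant_metric G M g"
  shows "{D \<in> invariant_connections G M. metric_connection M g D} = invariant_connections G M"
proof -
  obtain r where r: "\<forall>p\<in>M. \<forall>x\<in>tgt p. \<forall>y\<in>tgt p. g p x y = r * (x \<bullet> y)"
    using invariant_metric_round[OF g] .
  have "metric_connection M g (connection (T s))" for s
    unfolding metric_connection_def
  proof (intro ballI)
    fix X Y Z p
    assume v: "X \<in> vector_fields M" "Y \<in> vector_fields M" "Z \<in> vector_fields M" and p: "p \<in> M"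
    note t = vector_fieldD(2)[OF v(1) p] vector_fieldD(2)[OF v(2) p] vector_fieldD(2)[OF v(3) p]
    have c: "connection (T s) X W p \<in> tgt p" if "W \<in> vector_fields M" for W
      using tgt_add[OF dir_deriv_tangent[OF v(1) that p] T_tangent[OF p t(1) vector_fieldD(2)[OF that p]]]
      by (simp add: connection_at v that p)
    have "dir_deriv M (\<lambda>q. g q (Y q) (Z q)) p (X p) = dir_deriv M (\<lambda>q. r *\<^sub>R (Y q \<bullet> Z q)) p (X p)"
    proof -
      have eq: "dir_deriv M f p w = dir_deriv M f' p w" if "\<And>q. q \<in> M \<Longrightarrow> f q = f' q"
        for f f' :: "'v \<Rightarrow> real" and w
        unfolding dir_deriv_def curve_at_def using that by (intro arg_cong[where f=The] ext) auto
      show ?thesis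
        by (rule eq) (use r vector_fieldD(2)[OF v(2)] vector_fieldD(2)[OF v(3)] in simp)
    qed
    also have "\<dots> = r *\<^sub>R (Y p \<bullet> dir_deriv M Z p (X p) + dir_deriv M Y p (X p) \<bullet> Z p)"
      using dir_deriv_linear[OF bounded_linear_scaleR_right[of r]
          smooth_on_bilinear[OF bounded_bilinear_inner vector_fieldD(1)[OF v(2)] vector_fieldD(1)[OF v(3)]] p
          vector_fieldD(4)[OF v(1) p]]
        dir_deriv_bilinear[OF bounded_bilinear_inner vector_fieldD(1)[OF v(2)] vector_fieldD(1)[OF v(3)] p
          vector_fieldD(4)[OF v(1) p]] by simp
    also have "\<dots> = g p (connection (T s) X Y p) (Z p) + g p (Y p) (connection (T s) X Z p)"
      using r p t c v T_skew_everywhere[OF p t, of s]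
      by (simp add: connection_at inner_add_left inner_add_right algebra_simps)
        (simp add: tgt_def inner_commute)
    finally show "dir_deriv M (\<lambda>q. g q (Y q) (Z q)) p (X p)
        = g p (connection (T s) X Y p) (Z p) + g p (Y p) (connection (T s) X Z p)" .
  qed
  then show ?thesis by (auto simp: invariant_connections_eq)
qed

lemma lie_algebra_G:
  assumes "X \<in> lie_algebra G"
  shows "blinfun_apply X x \<bullet> y = - (x \<bullet> blinfun_apply X y)" "p \<in> M \<Longrightarrow> blinfun_apply X p \<in> tgt p"
    "\<pi> (blinfun_apply X x) = blinfun_apply X (\<pi> x)"
proof -
  obtain c where c: "\<forall>t. c t \<in> G" "c 0 = id_blinfun"
    "\<forall>x. ((\<lambda>t. blinfun_apply (c t) x) has_vector_derivative blinfun_apply X x) (at 0)"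
    using lie_algebra_curve[OF assms] .
  note s = symmetry_inv[OF G_symmetry[OF c(1)[rule_format]]]
  have "((\<lambda>t. blinfun_apply (c t) x \<bullet> blinfun_apply (c t) y) has_vector_derivative
      (blinfun_apply (c 0) x \<bullet> blinfun_apply X y + blinfun_apply X x \<bullet> blinfun_apply (c 0) y)) (at 0)"
    by (rule bounded_bilinear.has_vector_derivative[OF bounded_bilinear_inner c(3)[rule_format] c(3)[rule_format]])
  then have "blinfun_apply (c 0) x \<bullet> blinfun_apply X y + blinfun_apply X x \<bullet> blinfun_apply (c 0) y = 0"
    by (simp add: s(6) has_vector_derivative_const_iff)
  then show "blinfun_apply X x \<bullet> y = - (x \<bullet> blinfun_apply X y)" by (simp add: c(2))
  show "blinfun_apply X p \<in> tgt p" if "p \<in> M"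
    unfolding tangent_space_eq[OF that, symmetric] tangent_space_def curve_at_def
    using c G_M that by (auto intro!: exI[of _ "\<lambda>t. blinfun_apply (c t) p"])
  have "((\<lambda>t. \<pi> (blinfun_apply (c t) x)) has_vector_derivative \<pi> (blinfun_apply X x)) (at 0)"
    by (rule bounded_linear.has_vector_derivative[OF proj_linear c(3)[rule_format]])
  then show "\<pi> (blinfun_apply X x) = blinfun_apply X (\<pi> x)"
    using vector_derivative_unique_at c(3) by (simp add: s(7)) blast
qed

lemma lie_algebra_K:
  assumes "X \<in> lie_algebra K"
  shows "blinfun_apply X b = 0"
proof -
  obtain c where c: "\<forall>t. c t \<in> K" "c 0 = id_blinfun"
    "\<forall>x. ((\<lambda>t. blinfun_apply (c t) x) has_vector_derivative blinfun_apply X x) (at 0)"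
    using lie_algebra_curve[OF assms] .
  then have "((\<lambda>t. b) has_vector_derivative blinfun_apply X b) (at 0)"
    by (metis (no_types, lifting) K_iff ext)
  then show ?thesis by (simp add: has_vector_derivative_const_iff)
qed

lemma fundamental_field_vector_field:
  assumes "X \<in> lie_algebra G"
  shows "fundamental_field M X \<in> vector_fields M"
proof (rule vector_fieldI)
  show "smooth_on M (fundamental_field M X)"
    by (rule smooth_on_cong[OF smooth_on_linear[OF blinfun.bounded_linear_right smooth_on_id]])
      (simp add: fundamental_field_def)
qed (simp_all add: fundamental_field_def lie_algebra_G(2)[OF assms])

end

section \<open>Nomizu maps\<close>

lemma blinfun_apply_commutator:
  "blinfun_apply (commutator X Y) v = blinfun_apply X (blinfun_apply Y v) - blinfun_apply Y (blinfun_apply X v)"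
  by (simp add: commutator_def blinfun.diff_left)

text \<open>\<open>L\<close> is an algebraic condition satisfied by the Lie algebra of \<open>G\<close> and stable under brackets; by
  \<open>L_isotropy\<close> the elements of \<open>L\<close> that kill \<open>b\<close> integrate to curves in \<open>K\<close>. The last condition
  distinguishes the situation from \<open>SO(n+1)/SO(n)\<close>, where a complement \<open>m\<close> acts by
  \<open>X v = - \<langle>X b, v\<rangle> b\<close> on tangent vectors and \<open>[m, m]\<close> has no component in \<open>m\<close>.\<close>

locale homogeneous_sphere_lie = homogeneous_sphere \<pi> M G K b T
  for \<pi> :: "'v::euclidean_space \<Rightarrow> 'v" and M G K b
    and T :: "'s::{euclidean_space, real_normed_field} \<Rightarrow> 'v \<Rightarrow> 'v \<Rightarrow> 'v \<Rightarrow> 'v" +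
  fixes L :: "'v endo set"
  assumes lie_G_sub: "lie_algebra G \<subseteq> L"
    and L_diff: "X \<in> L \<Longrightarrow> Y \<in> L \<Longrightarrow> X - Y \<in> L"
    and L_commutator: "X \<in> L \<Longrightarrow> Y \<in> L \<Longrightarrow> commutator X Y \<in> L"
    and L_isotropy: "X \<in> L \<Longrightarrow> blinfun_apply X b = 0 \<Longrightarrow> X \<in> lie_algebra K"
    and lie_G_onto: "x \<in> tgt b \<Longrightarrow> \<exists>X\<in>lie_algebra G. blinfun_apply X b = x"
    and not_symmetric: "\<exists>x\<in>tgt b. \<forall>X\<in>L. blinfun_apply X b = x \<longrightarrow>
      (\<exists>v\<in>tgt b. blinfun_apply X v \<noteq> - (x \<bullet> v) *\<^sub>R b)"
begin

context
  fixes m assumes m: "reductive_decomposition G K m"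
begin

lemma m_subspace: "subspace m" and m_lie: "X \<in> m \<Longrightarrow> X \<in> lie_algebra G"
  and m_Ad: "k \<in> K \<Longrightarrow> X \<in> m \<Longrightarrow> Ad k X \<in> m"
proof -
  show "subspace m" "k \<in> K \<Longrightarrow> X \<in> m \<Longrightarrow> Ad k X \<in> m"
    using m unfolding reductive_decomposition_def by simp_all
  have "lie_algebra G = {A + B | A B. A \<in> lie_algebra K \<and> B \<in> m}" "lie_algebra K \<inter> m = {0}"
    using m unfolding reductive_decomposition_def by simp_all
  then show "X \<in> m \<Longrightarrow> X \<in> lie_algebra G"
    by (metis (mono_tags, lifting) CollectI Int_iff add_0 insertI1)
qed

lemma m_tgt: "X \<in> m \<Longrightarrow> blinfun_apply X b \<in> tgt b"
  using lie_algebra_G(2)[OF m_lie b_in_M] .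

lemma m_inj:
  assumes "X \<in> m" "Y \<in> m" "blinfun_apply X b = blinfun_apply Y b"
  shows "X = Y"
proof -
  have "X - Y \<in> m" using assms m_subspace by (simp add: subspace_diff)
  moreover have "X - Y \<in> lie_algebra K"
    by (rule L_isotropy) (use assms lie_G_sub m_lie in \<open>auto intro: L_diff simp: blinfun.diff_left\<close>)
  ultimately have "X - Y = 0" using m unfolding reductive_decomposition_def by blast
  then show ?thesis by simp
qed

lemma m_onto:
  assumes "x \<in> tgt b"
  shows "\<exists>X\<in>m. blinfun_apply X b = x"
proof -
  obtain X where X: "X \<in> lie_algebra G" "blinfun_apply X b = x" using lie_G_onto[OF assms] by blast
  then obtain A B where "X = A + B" "A \<in> lie_algebra K" "B \<in> m"
    using m unfolding reductive_decomposition_def by blast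
  then show ?thesis using X lie_algebra_K by (auto simp: blinfun.add_left)
qed

text \<open>The inverse of the isomorphism \<open>X \<mapsto> X b\<close> from \<open>m\<close> to the tangent space at \<open>b\<close>.\<close>

definition lift :: "'v \<Rightarrow> 'v endo" where
  "lift x = (THE X. X \<in> m \<and> blinfun_apply X b = x)"

lemma lift_eqI: "X \<in> m \<Longrightarrow> blinfun_apply X b = x \<Longrightarrow> lift x = X"
  unfolding lift_def by (rule the_equality) (simp, metis m_inj)

lemma lift:
  assumes "x \<in> tgt b"
  shows "lift x \<in> m" "blinfun_apply (lift x) b = x"
proof -
  obtain X where X: "X \<in> m" "blinfun_apply X b = x" using m_onto[OF assms] by blast
  with lift_eqI[OF X] show "lift x \<in> m" "blinfun_apply (lift x) b = x" by simp_all
qed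

lemma lift_of_m: "X \<in> m \<Longrightarrow> lift (blinfun_apply X b) = X"
  by (rule lift_eqI) simp_all

lemma lift_add: "x \<in> tgt b \<Longrightarrow> y \<in> tgt b \<Longrightarrow> lift (x + y) = lift x + lift y"
  by (rule lift_eqI) (simp_all add: lift subspace_add[OF m_subspace] blinfun.add_left)

lemma lift_scaleR: "x \<in> tgt b \<Longrightarrow> lift (r *\<^sub>R x) = r *\<^sub>R lift x"
  by (rule lift_eqI) (simp_all add: lift subspace_scale[OF m_subspace] blinfun.scaleR_left)

lemma blinfun_apply_Ad:
  assumes "k \<in> K"
  shows "blinfun_apply (Ad k X) (blinfun_apply k v) = blinfun_apply k (blinfun_apply X v)"
proof -
  have s: "symmetry (blinfun_apply k)" using assms G_symmetry by (simp add: K_iff)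
  show ?thesis
    using symmetry_inv(5)[OF symmetry_inv(1)[OF s]]
    by (simp add: Ad_def bounded_linear_Blinfun_apply symmetry_inv(3)[OF s])
qed

lemma lift_Ad:
  assumes "k \<in> K" "x \<in> tgt b"
  shows "lift (blinfun_apply k x) = Ad k (lift x)"
proof (rule lift_eqI)
  have "blinfun_apply k b = b" using assms(1) by (simp add: K_iff)
  then show "blinfun_apply (Ad k (lift x)) b = blinfun_apply k x"
    using blinfun_apply_Ad[OF assms(1), of "lift x" b] by (simp add: lift[OF assms(2)])
qed (simp add: m_Ad assms lift)

text \<open>The tangential part of \<open>X v\<close> is an equivariant bilinear map of \<open>X b\<close> and \<open>v\<close>, because \<open>m\<close> is
  stable under the adjoint action of \<open>K\<close>. Hence every reductive complement acts on the tangent space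
  by one of the tensors \<open>T s0 b\<close>; this is all that the brackets and the Nomizu maps depend on.\<close>

lemma lift_action:
  obtains s0 where "s0 \<noteq> 0" "\<forall>X\<in>m. \<forall>v\<in>tgt b. blinfun_apply X v + (blinfun_apply X b \<bullet> v) *\<^sub>R b = T s0 b (blinfun_apply X b) v"
proof -
  define \<beta> where "\<beta> = (\<lambda>x v. blinfun_apply (lift x) v + (x \<bullet> v) *\<^sub>R b)"
  have "\<exists>s. \<forall>x\<in>tgt b. \<forall>y\<in>tgt b. \<beta> x y = T s b x y"
  proof (rule T_complete, rule equivariant_bilinearI)
    fix x y assume x: "x \<in> tgt b" and y: "y \<in> tgt b"
    note X = m_lie[OF lift(1)[OF x]]
    show "\<beta> x y \<in> tgt b"
      using lie_algebra_G(1)[OF X, of y b] lie_algebra_G(3)[OF X, of y] b_in_M y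
        bounded_linear.linear[OF proj_linear]
      by (simp add: \<beta>_def tgt_def inner_add_left inner_add_right lift(2)[OF x] M_iff linear_add linear_cmul inner_commute)
  next
    fix k x y assume k: "k \<in> K" and x: "x \<in> tgt b" and y: "y \<in> tgt b"
    have kG: "k \<in> G" "blinfun_apply k b = b" using k by (simp_all add: K_iff)
    show "\<beta> (blinfun_apply k x) (blinfun_apply k y) = blinfun_apply k (\<beta> x y)"
      using symmetry_inv(6)[OF G_symmetry[OF kG(1)], of x y] kG(2)
      by (simp add: \<beta>_def lift_Ad[OF k x] blinfun_apply_Ad[OF k] blinfun.add_right blinfun.scaleR_right)
  qed (simp_all add: \<beta>_def lift_add lift_scaleR blinfun.add_left blinfun.add_right blinfun.scaleR_left
      blinfun.scaleR_right inner_add_left inner_add_right algebra_simps)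
  then obtain s0 where s0: "\<And>x y. x \<in> tgt b \<Longrightarrow> y \<in> tgt b \<Longrightarrow> \<beta> x y = T s0 b x y" by blast
  have "s0 \<noteq> 0"
  proof
    assume "s0 = 0"
    then have z: "blinfun_apply (lift x) v = - (x \<bullet> v) *\<^sub>R b" if "x \<in> tgt b" "v \<in> tgt b" for x v
      using s0[OF that] by (simp add: \<beta>_def T_zero eq_neg_iff_add_eq_0)
    obtain x where x: "x \<in> tgt b" "\<forall>X\<in>L. blinfun_apply X b = x \<longrightarrow>
      (\<exists>v\<in>tgt b. blinfun_apply X v \<noteq> - (x \<bullet> v) *\<^sub>R b)" using not_symmetric by blast
    have "lift x \<in> L" using lie_G_sub m_lie[OF lift(1)[OF x(1)]] by blast
    then show False using x z[OF x(1)] lift(2)[OF x(1)] by blast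
  qed
  moreover have "\<forall>X\<in>m. \<forall>v\<in>tgt b. blinfun_apply X v + (blinfun_apply X b \<bullet> v) *\<^sub>R b = T s0 b (blinfun_apply X b) v"
    using s0[OF m_tgt] by (simp add: \<beta>_def lift_of_m)
  ultimately show ?thesis by (rule that)
qed

text \<open>The tensor \<open>T s b\<close>, read on \<open>m\<close>.\<close>

definition bilinear_on_m :: "'s \<Rightarrow> 'v endo \<Rightarrow> 'v endo \<Rightarrow> 'v endo" where
  "bilinear_on_m s X Y =
    (if X \<in> m \<and> Y \<in> m then lift (T s b (blinfun_apply X b) (blinfun_apply Y b)) else 0)"

lemma bilinear_on_m_inj:
  assumes "bilinear_on_m s = bilinear_on_m s'"
  shows "s = s'"
proof -
  have "T (s - s') b x y = 0" if x: "x \<in> tgt b" and y: "y \<in> tgt b" for x y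
  proof -
    have "lift (T s b x y) = lift (T s' b x y)"
      using fun_cong[OF fun_cong[OF assms], of "lift x" "lift y"] lift x y by (simp add: bilinear_on_m_def)
    then have "T s b x y = T s' b x y" using lift(2)[OF T_tgt[OF x y]] by metis
    then show ?thesis using linear_diff[OF T_linear[where p=b and x=x and y=y], of s s'] by simp
  qed
  then have "s - s' = 0" by (rule T_faithful)
  then show ?thesis by simp
qed

text \<open>The derivatives of \<open>W\<close> cancel between the covariant derivative and the Lie bracket. What is left is
  \<open>X (Y b) + \<langle>X b, Y b\<rangle> b\<close>, which is \<open>T s0\<close>, and the added tensor \<open>T s\<close>.\<close>

lemma nomizu_map_connection:
  assumes s0: "\<forall>X\<in>m. \<forall>v\<in>tgt b. blinfun_apply X v + (blinfun_apply X b \<bullet> v) *\<^sub>R b = T s0 b (blinfun_apply X b) v"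
  shows "nomizu_map M b m (connection (T s)) = bilinear_on_m (s + s0)"
proof (intro ext)
  fix X Y
  show "nomizu_map M b m (connection (T s)) X Y = bilinear_on_m (s + s0) X Y"
  proof (cases "X \<in> m \<and> Y \<in> m")
    case True
    then have X: "X \<in> m" and Y: "Y \<in> m" by simp_all
    let ?x = "blinfun_apply X b" and ?y = "blinfun_apply Y b"
    let ?X = "fundamental_field M X"
    note t = m_tgt[OF X] m_tgt[OF Y]
    note XF = fundamental_field_vector_field[OF m_lie[OF X]]
    have val: "connection (T s) ?X W b - lie_bracket M ?X W b = T (s + s0) b ?x ?y"
      if W: "W \<in> vector_fields M" "W b = ?y" for W
    proof -
      have "?y \<in> tangent_space M b" using t(2) by (simp add: tangent_space_eq b_in_M)
      then have "dir_deriv M ?X b ?y = blinfun_apply X ?y"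
        by (rule dir_deriv_eqI[where F="blinfun_apply X"])
          (simp_all add: bounded_linear_imp_has_derivative blinfun.bounded_linear_right fundamental_field_def)
      then show ?thesis
        using s0[rule_format, OF X t(2)]
        by (simp add: connection_at XF W b_in_M lie_bracket_def fundamental_field_def
            linear_add[OF T_linear] algebra_simps)
    qed
    have "(THE Z. Z \<in> m \<and> (\<forall>W\<in>vector_fields M. W b = ?y \<longrightarrow>
        blinfun_apply Z b = connection (T s) ?X W b - lie_bracket M ?X W b)) = lift (T (s + s0) b ?x ?y)"
    proof (rule the_equality)
      show "lift (T (s + s0) b ?x ?y) \<in> m \<and> (\<forall>W\<in>vector_fields M. W b = ?y \<longrightarrow>
        blinfun_apply (lift (T (s + s0) b ?x ?y)) b = connection (T s) ?X W b - lie_bracket M ?X W b)"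
        using val lift[OF T_tgt[OF t]] by simp
    next
      fix Z assume Z: "Z \<in> m \<and> (\<forall>W\<in>vector_fields M. W b = ?y \<longrightarrow>
        blinfun_apply Z b = connection (T s) ?X W b - lie_bracket M ?X W b)"
      then have "blinfun_apply Z b = T (s + s0) b ?x ?y"
        using val[of "proj_field ?y"] proj_field_vector_field[OF tgt_proj[OF t(2)]]
          proj_field_tgt[OF b_in_M t(2)] by metis
      then show "Z = lift (T (s + s0) b ?x ?y)" using Z lift_eqI by metis
    qed
    then show ?thesis using True by (simp add: nomizu_map_def bilinear_on_m_def)
  qed (auto simp: nomizu_map_def bilinear_on_m_def)
qed

text \<open>At \<open>b\<close> the commutator is \<open>X (Y b) - Y (X b)\<close>, the antisymmetrisation of \<open>T s0\<close>. The difference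
  from the lift of this vector lies in \<open>L\<close> and kills \<open>b\<close>.\<close>

lemma m_part_commutator:
  assumes s0: "\<forall>X\<in>m. \<forall>v\<in>tgt b. blinfun_apply X v + (blinfun_apply X b \<bullet> v) *\<^sub>R b = T s0 b (blinfun_apply X b) v"
    and X: "X \<in> m" and Y: "Y \<in> m"
  shows "m_part K m (commutator X Y) = lift (T (2 * s0) b (blinfun_apply X b) (blinfun_apply Y b))"
proof -
  let ?x = "blinfun_apply X b" and ?y = "blinfun_apply Y b" and ?C = "commutator X Y"
  note t = m_tgt[OF X] m_tgt[OF Y]
  have T2: "T (2 * s0) b ?x ?y = 2 *\<^sub>R T s0 b ?x ?y"
    unfolding mult_2 scaleR_2 by (rule linear_add[OF T_linear])
  have "T s0 b ?x ?y - T s0 b ?y ?x = blinfun_apply X ?y - blinfun_apply Y ?x"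
    unfolding s0[rule_format, OF X t(2), symmetric] s0[rule_format, OF Y t(1), symmetric]
    by (simp add: inner_commute)
  then have Cb: "blinfun_apply ?C b = T (2 * s0) b ?x ?y"
    using T_alternating[OF t(2) t(1), of s0] by (simp add: blinfun_apply_commutator T2 scaleR_2)
  have CL: "?C \<in> L" using L_commutator lie_G_sub m_lie X Y by blast
  note l = lift[OF T_tgt[OF t, of "2 * s0"]]
  show ?thesis
    unfolding m_part_def
  proof (rule the_equality)
    have "?C - lift (T (2 * s0) b ?x ?y) \<in> lie_algebra K"
      by (rule L_isotropy) (use CL l lie_G_sub m_lie in \<open>auto intro: L_diff simp: blinfun.diff_left Cb\<close>)
    then show "lift (T (2 * s0) b ?x ?y) \<in> m \<and> ?C - lift (T (2 * s0) b ?x ?y) \<in> lie_algebra K"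
      using l by simp
  next
    fix Z assume Z: "Z \<in> m \<and> ?C - Z \<in> lie_algebra K"
    then have "blinfun_apply Z b = T (2 * s0) b ?x ?y"
      using lie_algebra_K[of "?C - Z"] Cb by (simp add: blinfun.diff_left)
    then show "Z = lift (T (2 * s0) b ?x ?y)" using Z lift_eqI by metis
  qed
qed

text \<open>On \<open>m\<close> the Nomizu maps are the tensors with parameter \<open>s + s0\<close> and the maps \<open>\<Lambda>\<^sup>\<alpha>\<close> those with
  parameter \<open>(1 - \<alpha>) s0\<close>. Both run through all scalars, the latter since \<open>s0 \<noteq> 0\<close>. The hypothesis
  expresses that \<open>act\<close> corresponds to the multiplication of parameters.\<close>

lemma nomizu_map_bij:
  assumes act: "\<And>a s Z x y. Z \<in> m \<Longrightarrow> x \<in> tgt b \<Longrightarrow> y \<in> tgt b \<Longrightarrow> blinfun_apply Z b = T s b x y \<Longrightarrow>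
    act a Z \<in> m \<and> blinfun_apply (act a Z) b = T (a * s) b x y"
  shows "bij_betw (nomizu_map M b m) (invariant_connections G M) (range (Lambda_alpha act K m))"
proof -
  obtain s0 where s0: "s0 \<noteq> 0"
    "\<forall>X\<in>m. \<forall>v\<in>tgt b. blinfun_apply X v + (blinfun_apply X b \<bullet> v) *\<^sub>R b = T s0 b (blinfun_apply X b) v"
    using lift_action .
  have \<Lambda>: "Lambda_alpha act K m \<alpha> = bilinear_on_m ((1 - \<alpha>) * s0)" for \<alpha>
  proof (intro ext)
    fix X Y
    show "Lambda_alpha act K m \<alpha> X Y = bilinear_on_m ((1 - \<alpha>) * s0) X Y"
    proof (cases "X \<in> m \<and> Y \<in> m")
      case True
      note t = m_tgt[OF True[THEN conjunct1]] m_tgt[OF True[THEN conjunct2]]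
      have "(1 - \<alpha>) / 2 * (2 * s0) = (1 - \<alpha>) * s0" by simp
      then show ?thesis
        using act[OF lift(1)[OF T_tgt[OF t]] t lift(2)[OF T_tgt[OF t]], of "(1 - \<alpha>) / 2" "2 * s0"] True
        by (simp add: Lambda_alpha_def bilinear_on_m_def m_part_commutator[OF s0(2)] lift_eqI[symmetric])
    qed (auto simp: Lambda_alpha_def bilinear_on_m_def)
  qed
  have N: "nomizu_map M b m (connection (T s)) = bilinear_on_m (s + s0)" for s
    by (rule nomizu_map_connection[OF s0(2)])
  show ?thesis
    unfolding bij_betw_def invariant_connections_eq
  proof
    show "inj_on (nomizu_map M b m) (range (\<lambda>s. connection (T s)))"
      by (rule inj_onI) (auto simp: N dest!: bilinear_on_m_inj)
    have "range (\<lambda>s. bilinear_on_m (s + s0)) = range (\<lambda>\<alpha>. bilinear_on_m ((1 - \<alpha>) * s0))"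
    proof (intro equalityI image_subsetI)
      show "bilinear_on_m (s + s0) \<in> range (\<lambda>\<alpha>. bilinear_on_m ((1 - \<alpha>) * s0))" for s
        by (rule image_eqI[of _ _ "- s / s0"]) (use s0(1) in \<open>simp_all add: distrib_right add.commute\<close>)
      show "bilinear_on_m ((1 - \<alpha>) * s0) \<in> range (\<lambda>s. bilinear_on_m (s + s0))" for \<alpha>
        by (rule image_eqI[of _ _ "- \<alpha> * s0"]) (simp_all add: algebra_simps)
    qed
    then show "nomizu_map M b m ` range (\<lambda>s. connection (T s)) = range (Lambda_alpha act K m)"
      by (simp add: image_image N \<Lambda>[abs_def])
  qed
qed

end

end

section \<open>Exponentials of endomorphisms\<close>

text \<open>Endomorphisms with composition as product form a Banach algebra; as a type of its own it carries the
  exponential series.\<close>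

typedef (overloaded) ('v::euclidean_space) endo_algebra = "UNIV :: 'v endo set"
  morphisms to_endo of_endo by simp

lemma to_endo_of_endo [simp]: "to_endo (of_endo X) = X"
  by (simp add: of_endo_inverse)

lemma endo_algebra_eq_iff: "A = B \<longleftrightarrow> to_endo A = to_endo B"
  by (simp add: to_endo_inject)

instantiation endo_algebra :: (euclidean_space) real_normed_algebra_1
begin

definition "0 = of_endo 0"
definition "1 = of_endo id_blinfun"
definition "A + B = of_endo (to_endo A + to_endo B)"
definition "A - B = of_endo (to_endo A - to_endo B)"
definition "- A = of_endo (- to_endo A)"
definition "A * B = of_endo (to_endo A o\<^sub>L to_endo B)"
definition "r *\<^sub>R A = of_endo (r *\<^sub>R to_endo A)"
definition "norm A = norm (to_endo A)"
definition "dist A B = norm (A - B :: 'a endo_algebra)"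
definition "sgn (A :: 'a endo_algebra) = inverse (norm A) *\<^sub>R A"
definition "(uniformity :: ('a endo_algebra \<times> 'a endo_algebra) filter) =
  (INF e\<in>{0 <..}. principal {(x, y). dist x y < e})"
definition "open (U :: 'a endo_algebra set) \<longleftrightarrow> (\<forall>x\<in>U. eventually (\<lambda>(x', y). x' = x \<longrightarrow> y \<in> U) uniformity)"

lemmas to_endo_simps = zero_endo_algebra_def one_endo_algebra_def plus_endo_algebra_def
  minus_endo_algebra_def uminus_endo_algebra_def times_endo_algebra_def scaleR_endo_algebra_def
  norm_endo_algebra_def

instance
proof
  fix A B C :: "'a endo_algebra" and r s :: real
  show "A + B + C = A + (B + C)" "A + B = B + A" "0 + A = A" "- A + A = 0" "A - B = A + - B"
    "r *\<^sub>R (A + B) = r *\<^sub>R A + r *\<^sub>R B" "(r + s) *\<^sub>R A = r *\<^sub>R A + s *\<^sub>R A"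
    "r *\<^sub>R s *\<^sub>R A = (r * s) *\<^sub>R A" "1 *\<^sub>R A = A"
    by (simp_all add: endo_algebra_eq_iff to_endo_simps algebra_simps)
  show "A * B * C = A * (B * C)" "1 * A = A" "A * 1 = A" "(A + B) * C = A * C + B * C"
    "A * (B + C) = A * B + A * C" "r *\<^sub>R A * B = r *\<^sub>R (A * B)" "A * r *\<^sub>R B = r *\<^sub>R (A * B)"
    by (auto simp: endo_algebra_eq_iff to_endo_simps blinfun.bilinear_simps intro!: blinfun_eqI)
  have "id_blinfun \<noteq> (0 :: 'a endo)"
    by (metis norm_blinfun_id norm_zero zero_neq_one)
  then show "0 \<noteq> (1 :: 'a endo_algebra)"
    by (simp add: endo_algebra_eq_iff to_endo_simps)
  show "norm (1 :: 'a endo_algebra) = 1" by (simp add: to_endo_simps)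
  show "norm (A * B) \<le> norm A * norm B" by (simp add: to_endo_simps norm_blinfun_compose)
  show "norm (A + B) \<le> norm A + norm B" by (simp add: to_endo_simps norm_triangle_ineq)
  show "norm A = 0 \<longleftrightarrow> A = 0" by (simp add: endo_algebra_eq_iff to_endo_simps)
  show "norm (r *\<^sub>R A) = \<bar>r\<bar> * norm A" by (simp add: to_endo_simps)
  show "dist A B = norm (A - B)" "sgn A = inverse (norm A) *\<^sub>R A"
    by (simp_all add: dist_endo_algebra_def sgn_endo_algebra_def)
  show "(uniformity :: ('a endo_algebra \<times> 'a endo_algebra) filter) =
      (INF e\<in>{0 <..}. principal {(x, y). dist x y < e})"
    by (rule uniformity_endo_algebra_def)
  show "open U \<longleftrightarrow> (\<forall>x\<in>U. eventually (\<lambda>(x', y). x' = x \<longrightarrow> y \<in> U) uniformity)" for U :: "'a endo_algebra set"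
    by (rule open_endo_algebra_def)
qed

end

instance endo_algebra :: (euclidean_space) banach
proof
  fix X :: "nat \<Rightarrow> 'a endo_algebra" assume C: "Cauchy X"
  have d: "dist A B = dist (to_endo A) (to_endo B)" for A B :: "'a endo_algebra"
    by (simp add: dist_endo_algebra_def to_endo_simps dist_norm)
  have "Cauchy (\<lambda>n. to_endo (X n))" using C by (simp add: Cauchy_def d)
  then obtain Y where "(\<lambda>n. to_endo (X n)) \<longlonglongrightarrow> Y" using convergent_eq_Cauchy by blast
  then have "X \<longlonglongrightarrow> of_endo Y" by (simp add: lim_sequentially d)
  then show "convergent X" by (auto simp: convergent_def)
qed

definition endo_exp :: "real \<Rightarrow> 'v::euclidean_space endo \<Rightarrow> 'v endo" where
  "endo_exp t X = to_endo (exp (t *\<^sub>R of_endo X))"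

lemma endo_exp_0: "endo_exp 0 X = id_blinfun"
  by (simp add: endo_exp_def to_endo_simps(2))

lemma bounded_linear_to_endo: "bounded_linear to_endo"
  by (rule bounded_linear_intro[of _ 1]) (simp_all add: to_endo_simps)

lemma endo_exp_inverse: "endo_exp (- t) X o\<^sub>L endo_exp t X = id_blinfun"
proof -
  have "exp ((- t) *\<^sub>R of_endo X) * exp (t *\<^sub>R of_endo X) = 1"
    by (simp flip: exp_add_commuting)
  then show ?thesis
    by (metis endo_exp_def to_endo_of_endo to_endo_simps(2) to_endo_simps(6))
qed

lemma endo_exp_derivative:
  "((\<lambda>t. endo_exp t X) has_vector_derivative X o\<^sub>L endo_exp t X) (at t)"
  "X o\<^sub>L endo_exp t X = endo_exp t X o\<^sub>L X"
proof -
  have "((\<lambda>t. exp (t *\<^sub>R of_endo X)) has_vector_derivative of_endo X * exp (t *\<^sub>R of_endo X)) (at t)"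
    by (rule exp_scaleR_has_vector_derivative_left)
  from bounded_linear.has_vector_derivative[OF bounded_linear_to_endo this]
  show "((\<lambda>t. endo_exp t X) has_vector_derivative X o\<^sub>L endo_exp t X) (at t)"
    by (simp add: endo_exp_def to_endo_simps(6))
  have "of_endo X * exp (t *\<^sub>R of_endo X) = exp (t *\<^sub>R of_endo X) * of_endo X"
    by (metis exp_times_scaleR_commute)
  then show "X o\<^sub>L endo_exp t X = endo_exp t X o\<^sub>L X"
    by (simp add: endo_exp_def endo_algebra_eq_iff to_endo_simps(6))
qed

text \<open>By the Leibniz rule \<open>exp(-tX) (exp(tX) x \<cdot> exp(tX) y)\<close> has derivative zero in \<open>t\<close>, so it keeps
  its value \<open>x \<cdot> y\<close> at \<open>t = 0\<close>.\<close>

lemma endo_exp_automorphism: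
  fixes X :: "'v::euclidean_space endo"
  assumes h: "bounded_bilinear h"
    and X: "\<And>x y. blinfun_apply X (h x y) = h (blinfun_apply X x) y + h x (blinfun_apply X y)"
  shows "blinfun_apply (endo_exp t X) (h x y) = h (blinfun_apply (endo_exp t X) x) (blinfun_apply (endo_exp t X) y)"
proof -
  let ?E = "\<lambda>t. blinfun_apply (endo_exp t X)"
  have D: "((\<lambda>t. ?E t x) has_vector_derivative blinfun_apply X (?E t x)) (at t)" for t x
    using bounded_linear.has_vector_derivative[OF bounded_bilinear.bounded_linear_left[OF bounded_bilinear_blinfun_apply]
        endo_exp_derivative(1)[of X t], of x] by simp
  have D': "((\<lambda>t. endo_exp (- t) X) has_vector_derivative - (endo_exp (- t) X o\<^sub>L X)) (at t)" for t
    using vector_diff_chain_at[of uminus "-1" t, OF _ endo_exp_derivative(1)]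
    by (simp add: o_def has_vector_derivative_minus[OF has_vector_derivative_id, unfolded id_def] endo_exp_derivative(2)[symmetric])
  let ?f = "\<lambda>t. ?E (- t) (h (?E t x) (?E t y))"
  have "(?f has_vector_derivative 0) (at t)" for t
    using bounded_bilinear.has_vector_derivative[OF bounded_bilinear_blinfun_apply D'[of t]
        bounded_bilinear.has_vector_derivative[OF h D[of x t] D[of y t]]]
    by (simp add: X blinfun.bilinear_simps)
  then have "?f t = ?f 0"
    using has_vector_derivative_zero_constant[of UNIV ?f] by (metis UNIV_I convex_UNIV)
  then have "?f t = h x y" by (simp add: endo_exp_0)
  moreover have "?E t (?E (- t) z) = z" for z
    using fun_cong[OF arg_cong[OF endo_exp_inverse[of "- t" X], of blinfun_apply], of z] by simp
  ultimately show ?thesis by metis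
qed

section \<open>Octonions and Spin(7)\<close>

(* quantified octonions are to stay single variables *)
declare split_paired_All [simp del] split_paired_Ex [simp del]

lemma oct_eq_iff:
  "x = y \<longleftrightarrow> fst x = fst y \<and> snd x $ 1 = snd y $ 1 \<and> snd x $ 2 = snd y $ 2 \<and> snd x $ 3 = snd y $ 3"
  for x y :: octonion
  by (simp add: prod_eq_iff vec_eq_iff forall_3)

lemma conj_cross_nth [simp]:
  "conj_cross u v $ 1 = cnj (u $ 2 * v $ 3 - u $ 3 * v $ 2)"
  "conj_cross u v $ 2 = cnj (u $ 3 * v $ 1 - u $ 1 * v $ 3)"
  "conj_cross u v $ 3 = cnj (u $ 1 * v $ 2 - u $ 2 * v $ 1)"
  by (simp_all add: conj_cross_def)

definition ocnj :: "octonion \<Rightarrow> octonion" where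
  "ocnj x = (cnj (fst x), - snd x)"

lemma inner_oct:
  "x \<bullet> y = Re (fst x * cnj (fst y) + snd x $ 1 * cnj (snd y $ 1) + snd x $ 2 * cnj (snd y $ 2)
     + snd x $ 3 * cnj (snd y $ 3))" for x y :: octonion
  by (simp add: inner_prod_def inner_vec_def inner_complex_def sum_3)

lemma of_real_inner_oct:
  "complex_of_real (x \<bullet> x) = fst x * cnj (fst x) + snd x $ 1 * cnj (snd x $ 1) + snd x $ 2 * cnj (snd x $ 2)
     + snd x $ 3 * cnj (snd x $ 3)" for x :: octonion
  by (simp add: inner_oct complex_eq_iff algebra_simps)

lemma fst_omult: "fst (omult x y) = fst x * fst y - (snd x $ 1 * cnj (snd y $ 1) + snd x $ 2 * cnj (snd y $ 2)
     + snd x $ 3 * cnj (snd y $ 3))"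
  by (simp add: omult_def sum_3)

lemma snd_omult: "snd (omult x y) = fst x *s snd y + cnj (fst y) *s snd x + conj_cross (snd x) (snd y)"
  by (simp add: omult_def)

lemmas omult_simps = fst_omult snd_omult

lemma fst_snd_scaleR_nth: "fst (r *\<^sub>R x) = of_real r * fst x" "snd (r *\<^sub>R x) $ k = of_real r * snd x $ k"
  for x :: octonion
  by (simp_all add: scaleR_conv_of_real[where 'a=complex])

lemma bilinear_omult: "bilinear omult"
  unfolding bilinear_def
  by (intro conjI allI linearI; simp add: oct_eq_iff omult_simps fst_snd_scaleR_nth algebra_simps del: fst_scaleR snd_scaleR)

lemma bounded_bilinear_omult: "bounded_bilinear omult"
  using bilinear_omult by (simp add: bilinear_conv_bounded_bilinear)

interpretation O: bounded_bilinear omult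
  by (rule bounded_bilinear_omult)

lemma omult_one [simp]: "omult oct_one x = x" "omult x oct_one = x"
  by (simp_all add: oct_eq_iff omult_simps oct_one_def)

lemma bounded_linear_ocnj: "bounded_linear ocnj"
  unfolding linear_conv_bounded_linear[symmetric]
  by (rule linearI) (simp_all add: ocnj_def oct_eq_iff)

lemma ocnj_omult_left: "omult (ocnj x) (omult x y) = (x \<bullet> x) *\<^sub>R y"
  by (simp add: oct_eq_iff omult_simps fst_snd_scaleR_nth of_real_inner_oct ocnj_def algebra_simps del: fst_scaleR snd_scaleR)

lemma ocnj_omult_right: "omult (omult y x) (ocnj x) = (x \<bullet> x) *\<^sub>R y"
  by (simp add: oct_eq_iff omult_simps fst_snd_scaleR_nth of_real_inner_oct ocnj_def algebra_simps del: fst_scaleR snd_scaleR)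

lemma ocnj_ocnj [simp]: "ocnj (ocnj x) = x"
  by (simp add: ocnj_def)

lemma inner_omult_left: "omult x y \<bullet> z = y \<bullet> omult (ocnj x) z"
  by (simp add: inner_oct omult_simps ocnj_def algebra_simps)

lemma inner_omult_right: "omult x y \<bullet> z = x \<bullet> omult z (ocnj y)"
  by (simp add: inner_oct omult_simps ocnj_def algebra_simps)

lemma imaginary_iff: "x \<in> imaginary \<longleftrightarrow> x \<bullet> oct_one = 0"
  by (simp add: imaginary_def inner_oct oct_one_def)

lemma oct_one_inner: "oct_one \<bullet> oct_one = 1"
  by (simp add: inner_oct oct_one_def)

lemma ocnj_alt: "ocnj x = (2 * (x \<bullet> oct_one)) *\<^sub>R oct_one - x"
  by (simp add: ocnj_def oct_eq_iff oct_one_def inner_oct complex_eq_iff)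

lemma ocnj_imaginary: "x \<in> imaginary \<Longrightarrow> ocnj x = - x"
  by (simp add: ocnj_alt imaginary_iff)

lemma subspace_imaginary: "subspace imaginary"
  by (auto simp: subspace_def imaginary_iff inner_add_left)

lemma oct_decompose: obtains r u where "x = r *\<^sub>R oct_one + u" "u \<in> imaginary"
  by (rule that[of "x \<bullet> oct_one" "x - (x \<bullet> oct_one) *\<^sub>R oct_one"])
    (simp_all add: imaginary_iff inner_diff_left oct_one_inner)

text \<open>Polarised form of the alternative law; for imaginary \<open>u\<close> and \<open>w\<close> it is the Clifford relation.\<close>

lemma ocnj_polarised: "omult (ocnj x) (omult z y) + omult (ocnj z) (omult x y) = (2 * (x \<bullet> z)) *\<^sub>R y"
  using ocnj_omult_left[of "x + z" y] ocnj_omult_left[of x y] ocnj_omult_left[of z y]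
    linear_add[OF bounded_linear.linear[OF bounded_linear_ocnj], of x z]
  by (simp add: O.add_left O.add_right inner_add_left inner_add_right inner_commute algebra_simps)

lemma clifford:
  assumes "u \<in> imaginary" "w \<in> imaginary"
  shows "omult u (omult w x) = - omult w (omult u x) - (2 * (u \<bullet> w)) *\<^sub>R x"
proof -
  have e: "- omult u (omult w x) + - omult w (omult u x) = (2 * (u \<bullet> w)) *\<^sub>R x"
    using ocnj_polarised[of u w x] by (simp add: ocnj_imaginary assms O.minus_left)
  show ?thesis unfolding e[symmetric] by simp
qed

lemma imaginary_alt:
  assumes "u \<in> imaginary"
  shows "omult u (omult u x) = - ((u \<bullet> u) *\<^sub>R x)" "omult (omult x u) u = - ((u \<bullet> u) *\<^sub>R x)"
    "omult u x \<bullet> y = - (x \<bullet> omult u y)" "omult x u \<bullet> y = - (x \<bullet> omult y u)" "omult u u = - ((u \<bullet> u) *\<^sub>R oct_one)"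
proof -
  show 1: "omult u (omult u x) = - ((u \<bullet> u) *\<^sub>R x)" for x
    unfolding ocnj_omult_left[of u x, symmetric] by (simp add: ocnj_imaginary assms O.minus_left)
  show "omult (omult x u) u = - ((u \<bullet> u) *\<^sub>R x)"
    unfolding ocnj_omult_right[of x u, symmetric] by (simp add: ocnj_imaginary assms O.minus_right)
  show "omult u x \<bullet> y = - (x \<bullet> omult u y)" "omult x u \<bullet> y = - (x \<bullet> omult y u)"
    by (simp_all add: inner_omult_left[of u] inner_omult_right[of x u] ocnj_imaginary assms O.minus_left O.minus_right)
  show "omult u u = - ((u \<bullet> u) *\<^sub>R oct_one)" using 1[of oct_one] by simp
qed

lemma omult_square: "omult w w = (2 * (w \<bullet> oct_one)) *\<^sub>R w - (w \<bullet> w) *\<^sub>R oct_one"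
  using ocnj_omult_left[of w oct_one] by (simp add: ocnj_alt O.diff_left O.scaleR_left algebra_simps)

lemma inner_omult_same: "omult u x \<bullet> omult u y = (u \<bullet> u) * (x \<bullet> y)" "omult x u \<bullet> omult y u = (u \<bullet> u) * (x \<bullet> y)"
  by (simp_all add: inner_omult_left[of u] inner_omult_right[of x u] ocnj_omult_left ocnj_omult_right)

definition Lmul :: "octonion \<Rightarrow> octonion endo" where
  "Lmul u = Blinfun (omult u)"

lemma Lmul_apply [simp]: "blinfun_apply (Lmul u) = omult u"
  by (simp add: Lmul_def bounded_linear_Blinfun_apply O.bounded_linear_right)

text \<open>By the Clifford relation, conjugation with left multiplication by \<open>u\<close> sends the generator \<open>w\<close> to
  its reflection \<open>2 \<langle>u, w\<rangle> u - w\<close> in the line of \<open>u\<close>.\<close>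

lemma Lmul_Spin7:
  assumes u: "u \<in> imaginary" "norm u = 1"
  shows "Lmul u \<in> Spin7"
proof -
  have uu: "u \<bullet> u = 1" using u(2) by (simp add: norm_eq_1)
  have "orthogonal_transformation (omult u)"
    using inner_omult_same(1)[of u] uu bounded_linear.linear[OF O.bounded_linear_right]
    by (simp add: orthogonal_transformation_def)
  moreover have "\<exists>v\<in>imaginary. \<forall>x. omult u (omult w x) = omult v (omult u x)" if w: "w \<in> imaginary" for w
  proof (intro bexI allI)
    show "(- 2 * (u \<bullet> w)) *\<^sub>R - u - w \<in> imaginary"
      using u(1) w subspace_imaginary by (simp add: subspace_diff subspace_scale)
    show "omult u (omult w x) = omult ((- 2 * (u \<bullet> w)) *\<^sub>R - u - w) (omult u x)" for x
      using clifford[OF u(1) w, of x] imaginary_alt(1)[OF u(1), of x]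
      by (simp add: O.diff_left O.scaleR_left uu)
  qed
  ultimately show ?thesis by (simp add: Spin7_def)
qed

lemma Spin7_intertwines:
  "g \<in> Spin7 \<Longrightarrow> u \<in> imaginary \<Longrightarrow>
    \<exists>v\<in>imaginary. \<forall>x. blinfun_apply g (omult u x) = omult v (blinfun_apply g x)"
  by (simp add: Spin7_def)

lemma Spin7_compose:
  assumes "g \<in> Spin7" "h \<in> Spin7"
  shows "g o\<^sub>L h \<in> Spin7"
proof -
  have "orthogonal_transformation (\<lambda>x. blinfun_apply g (blinfun_apply h x))"
    using assms orthogonal_transformation_compose[of "blinfun_apply g" "blinfun_apply h"]
    by (simp add: Spin7_def o_def)
  moreover have "\<exists>v\<in>imaginary. \<forall>x. blinfun_apply g (blinfun_apply h (omult u x)) =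
      omult v (blinfun_apply g (blinfun_apply h x))" if u: "u \<in> imaginary" for u
  proof -
    obtain v where v: "v \<in> imaginary" "\<forall>x. blinfun_apply h (omult u x) = omult v (blinfun_apply h x)"
      using Spin7_intertwines[OF assms(2) u] by blast
    obtain w where "w \<in> imaginary" "\<forall>x. blinfun_apply g (omult v x) = omult w (blinfun_apply g x)"
      using Spin7_intertwines[OF assms(1) v(1)] by blast
    then show ?thesis using v(2) by auto
  qed
  moreover have "blinfun_apply (g o\<^sub>L h) = (\<lambda>x. blinfun_apply g (blinfun_apply h x))" by auto
  ultimately show ?thesis by (simp add: Spin7_def)
qed

lemma Spin7_orthogonal: "g \<in> Spin7 \<Longrightarrow> blinfun_apply g x \<bullet> blinfun_apply g y = x \<bullet> y"
  by (simp add: Spin7_def orthogonal_transformation_def)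

lemma G2_omult: "g \<in> G2 \<Longrightarrow> blinfun_apply g (omult x y) = omult (blinfun_apply g x) (blinfun_apply g y)"
  by (simp add: G2_def)

lemma G2_one:
  assumes "g \<in> G2"
  shows "blinfun_apply g oct_one = oct_one"
proof -
  have "surj (blinfun_apply g)" using assms by (simp add: G2_def bij_is_surj)
  then obtain x where "blinfun_apply g x = oct_one" by (metis surjD)
  then show ?thesis using G2_omult[OF assms, of oct_one x] by simp
qed

text \<open>An automorphism preserves squares, and a solution \<open>w\<close> of \<open>w\<^sup>2 = - r\<close> with \<open>r \<ge> 0\<close> is imaginary of
  square norm \<open>r\<close>, by the quadratic equation that every octonion satisfies.\<close>

lemma G2_imaginary:
  assumes g: "g \<in> G2" and u: "u \<in> imaginary"
  shows "blinfun_apply g u \<in> imaginary" "blinfun_apply g u \<bullet> blinfun_apply g u = u \<bullet> u"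
proof -
  define w where "w = blinfun_apply g u"
  have inj: "inj (blinfun_apply g)" using g by (simp add: G2_def bij_is_inj)
  have "omult w w = - ((u \<bullet> u) *\<^sub>R oct_one)"
    using G2_omult[OF g, of u u] by (simp add: w_def imaginary_alt(5)[OF u] blinfun.minus_right blinfun.scaleR_right G2_one[OF g])
  then have eq: "(2 * (w \<bullet> oct_one)) *\<^sub>R w = (w \<bullet> w - u \<bullet> u) *\<^sub>R oct_one"
    by (simp add: omult_square algebra_simps)
  have "w \<bullet> oct_one = 0"
  proof (rule ccontr)
    assume n: "w \<bullet> oct_one \<noteq> 0"
    define c where "c = (w \<bullet> w - u \<bullet> u) / (2 * (w \<bullet> oct_one))"
    have "(2 * (w \<bullet> oct_one)) *\<^sub>R w = (2 * (w \<bullet> oct_one)) *\<^sub>R (c *\<^sub>R oct_one)" using n eq by (simp add: c_def)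
    then have "w = c *\<^sub>R oct_one" using n by (simp only: scaleR_cancel_left) simp
    then have "blinfun_apply g u = blinfun_apply g (c *\<^sub>R oct_one)"
      by (simp add: w_def blinfun.scaleR_right G2_one[OF g])
    then have "u = c *\<^sub>R oct_one" using inj by (simp add: inj_eq)
    then have "u = 0" using u by (simp add: imaginary_iff oct_one_inner)
    then show False using n by (simp add: w_def blinfun.zero_right)
  qed
  with eq show "blinfun_apply g u \<in> imaginary" "blinfun_apply g u \<bullet> blinfun_apply g u = u \<bullet> u"
    by (simp_all add: w_def imaginary_iff) (simp add: oct_one_def zero_prod_def)
qed

lemma G2_orthogonal:
  assumes g: "g \<in> G2"
  shows "orthogonal_transformation (blinfun_apply g)"
proof -
  have "blinfun_apply g x \<bullet> blinfun_apply g x = x \<bullet> x" for x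
  proof -
    obtain r u where x: "x = r *\<^sub>R oct_one + u" "u \<in> imaginary" by (rule oct_decompose)
    show ?thesis
      using G2_imaginary[OF g x(2)] x(2)
      by (simp add: x(1) blinfun.add_right blinfun.scaleR_right G2_one[OF g] inner_add_left inner_add_right
          imaginary_iff inner_commute)
  qed
  then show ?thesis
    by (simp add: orthogonal_transformation norm_eq_sqrt_inner bounded_linear.linear blinfun.bounded_linear_right)
qed

text \<open>If \<open>g\<close> fixes \<open>1\<close>, then evaluation of \<open>g (u x) = v g(x)\<close> at \<open>x = 1\<close> identifies the multiplier as
  \<open>v = g(u)\<close>.\<close>

lemma G2_iff: "g \<in> G2 \<longleftrightarrow> g \<in> Spin7 \<and> blinfun_apply g oct_one = oct_one"
proof (intro iffI conjI)
  assume g: "g \<in> G2"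
  then show "g \<in> Spin7"
    using G2_imaginary(1)[OF g] G2_orthogonal[OF g] by (auto simp: Spin7_def G2_omult[OF g])
  show "blinfun_apply g oct_one = oct_one" by (rule G2_one[OF g])
next
  assume g: "g \<in> Spin7 \<and> blinfun_apply g oct_one = oct_one"
  have 1: "blinfun_apply g (omult u x) = omult (blinfun_apply g u) (blinfun_apply g x)" if "u \<in> imaginary" for u x
  proof -
    obtain v where v: "\<forall>x. blinfun_apply g (omult u x) = omult v (blinfun_apply g x)"
      using Spin7_intertwines[OF _ \<open>u \<in> imaginary\<close>, of g] g by blast
    from v[rule_format, of oct_one] have "v = blinfun_apply g u" using g by simp
    then show ?thesis using v by simp
  qed
  have "blinfun_apply g (omult x y) = omult (blinfun_apply g x) (blinfun_apply g y)" for x y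
  proof -
    obtain r u where x: "x = r *\<^sub>R oct_one + u" "u \<in> imaginary" by (rule oct_decompose)
    show ?thesis using g
      by (simp add: x O.add_left O.scaleR_left blinfun.add_right blinfun.scaleR_right 1)
  qed
  moreover have "bij (blinfun_apply g)"
    using g by (simp add: Spin7_def orthogonal_transformation_bij)
  ultimately show "g \<in> G2" by (simp add: G2_def)
qed

lemma orthogonal_to_four:
  fixes a b c d :: octonion
  obtains z where "norm z = 1" "z \<bullet> a = 0" "z \<bullet> b = 0" "z \<bullet> c = 0" "z \<bullet> d = 0"
proof -
  have "dim {a, b, c, d} \<le> card {a, b, c, d}" by (rule dim_le_card') simp
  also have "\<dots> \<le> 4" using card_length[of "[a, b, c, d]"] by simp
  also have "\<dots> < DIM(octonion)" by simp
  finally obtain z where z: "z \<noteq> 0" "\<And>y. y \<in> span {a, b, c, d} \<Longrightarrow> orthogonal z y"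
    using orthogonal_to_subspace_exists by metis
  show ?thesis
    by (rule that[of "z /\<^sub>R norm z"]) (use z in \<open>auto simp: orthogonal_def span_base\<close>)
qed

lemma imaginary_omult: "u \<in> imaginary \<Longrightarrow> w \<in> imaginary \<Longrightarrow> u \<bullet> w = 0 \<Longrightarrow> omult u w \<in> imaginary"
  using imaginary_alt(3)[of u w oct_one] by (simp add: imaginary_iff inner_commute)

text \<open>For a unit imaginary \<open>u\<close> orthogonal to \<open>x\<close>, the octonion \<open>v = - u x\<close> is imaginary too, and
  \<open>x = u v\<close> is a product of two Clifford generators applied to \<open>1\<close>.\<close>

lemma Spin7_transitive:
  assumes "norm x = 1"
  shows "\<exists>g\<in>Spin7. blinfun_apply g oct_one = x"
proof -
  obtain u where u: "norm u = 1" "u \<bullet> oct_one = 0" "u \<bullet> x = 0" using orthogonal_to_four by metis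
  have ui: "u \<in> imaginary" by (simp add: imaginary_iff u)
  define v where "v = - omult u x"
  have "v \<in> imaginary" using imaginary_alt(3)[OF ui, of x oct_one] u(3)
    by (simp add: v_def imaginary_iff inner_commute)
  moreover have "v \<bullet> v = 1" using u(1) assms by (simp add: v_def inner_omult_same norm_eq_1)
  ultimately have v: "v \<in> imaginary" "norm v = 1" by (simp_all add: norm_eq_1)
  have "omult u v = x" using imaginary_alt(1)[OF ui, of x] u(1) by (simp add: v_def O.minus_right norm_eq_1)
  then show ?thesis
    using Spin7_compose[OF Lmul_Spin7[OF ui u(1)] Lmul_Spin7[OF v]] by (intro bexI[of _ "Lmul u o\<^sub>L Lmul v"]) simp_all
qed

lemma S7_homogeneous: "homogeneous_space Spin7 G2 S7 oct_one"
  unfolding homogeneous_space_def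
proof (intro conjI)
  show "oct_one \<in> S7" by (simp add: S7_def norm_eq_1 oct_one_inner)
  show "S7 = {blinfun_apply g oct_one |g. g \<in> Spin7}"
  proof (intro equalityI subsetI)
    show "x \<in> {blinfun_apply g oct_one |g. g \<in> Spin7}" if "x \<in> S7" for x
      using Spin7_transitive[of x] that by (auto simp: S7_def)
    show "x \<in> S7" if "x \<in> {blinfun_apply g oct_one |g. g \<in> Spin7}" for x
      using that by (auto simp: S7_def norm_eq_1 Spin7_orthogonal oct_one_inner)
  qed
  show "G2 = {g \<in> Spin7. blinfun_apply g oct_one = oct_one}" using G2_iff by auto
qed

section \<open>Involutions in G2\<close>

lemma anticommute:
  "u \<in> imaginary \<Longrightarrow> w \<in> imaginary \<Longrightarrow> u \<bullet> w = 0 \<Longrightarrow> omult u (omult w x) = - omult w (omult u x)"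
  using clifford[of u w x] by simp

text \<open>The witness is the involution whose fixed space is a quaternion subalgebra containing \<open>p\<close> and
  whose other eigenspace is spanned by \<open>a\<close>, \<open>a p\<close>, \<open>c\<close> and \<open>c p\<close>. As a product of four Clifford
  generators it lies in Spin(7), and it fixes \<open>1\<close>.\<close>

lemma G2_reflection:
  assumes p: "p \<in> imaginary" "norm p = 1" and a: "a \<in> imaginary" "norm a = 1" and pa: "a \<bullet> p = 0"
  obtains g where "g \<in> G2" "blinfun_apply g p = p" "blinfun_apply g a = - a"
proof -
  obtain c where c: "norm c = 1" "c \<bullet> oct_one = 0" "c \<bullet> p = 0" "c \<bullet> a = 0" "c \<bullet> omult a p = 0"
    using orthogonal_to_four[of oct_one p a "omult a p"] by metis
  \<comment> \<open>the plane of \<open>a\<close> and \<open>q\<close>, and that of \<open>c\<close> and \<open>d\<close>, make up the space where \<open>g\<close> is \<open>- 1\<close>\<close>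
  define q where "q = omult a p"
  define d where "d = omult c p"
  have pp: "p \<bullet> p = 1" "a \<bullet> a = 1" "c \<bullet> c = 1" using p a c by (simp_all add: norm_eq_1)
  have ci: "c \<in> imaginary" using c by (simp add: imaginary_iff)
  have qi: "q \<in> imaginary" unfolding q_def by (rule imaginary_omult[OF a(1) p(1) pa])
  have di: "d \<in> imaginary" unfolding d_def by (rule imaginary_omult[OF ci p(1) c(3)])
  have qn: "q \<bullet> q = 1" "d \<bullet> d = 1" by (simp_all add: q_def d_def inner_omult_same pp)
  then have n: "norm q = 1" "norm d = 1" by (simp_all add: norm_eq_1)
  have o: "d \<bullet> p = 0" "q \<bullet> p = 0" "d \<bullet> a = 0"
    using a(1) p(1) c by (simp_all add: q_def d_def imaginary_alt(4)[OF p(1)] imaginary_alt(5) imaginary_iff)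
  have o': "q \<bullet> a = 0"
    using a(1) p(1) by (simp add: q_def imaginary_alt(3)[OF a(1)] imaginary_alt(5) imaginary_iff)
  define g where "g = Lmul q o\<^sub>L (Lmul a o\<^sub>L (Lmul c o\<^sub>L Lmul d))"
  have gS: "g \<in> Spin7" unfolding g_def
    by (intro Spin7_compose Lmul_Spin7 qi a ci di n c(1))
  have g1: "omult q (omult a (omult c d)) = oct_one"
    by (simp add: d_def imaginary_alt(1)[OF ci] pp O.minus_right q_def[symmetric] imaginary_alt(5)[OF qi] qn)
  then have "g \<in> G2" using gS by (simp add: G2_iff g_def)
  moreover have "blinfun_apply g p = p"
  proof -
    have "blinfun_apply g p = omult q (omult a (omult c (omult d p)))" by (simp add: g_def)
    also have "\<dots> = omult p (omult q (omult a (omult c d)))"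
      using o c pa p(1) a(1) ci qi di
      by (simp only: anticommute[of d p oct_one, unfolded omult_one] anticommute[of c p] anticommute[of a p] anticommute[of q p] O.minus_right minus_minus omult_one)
    finally show ?thesis by (simp add: g1)
  qed
  moreover have "blinfun_apply g a = - a"
  proof -
    have "blinfun_apply g a = omult q (omult a (omult c (omult d a)))" by (simp add: g_def)
    also have "\<dots> = - omult a (omult q (omult a (omult c d)))"
      using o o' c a(1) ci qi di
      by (simp only: anticommute[of d a oct_one, unfolded omult_one] anticommute[of c a] anticommute[of q a] O.minus_right minus_minus omult_one)
    finally show ?thesis by (simp add: g1)
  qed
  ultimately show ?thesis by (rule that)
qed

lemma id_G2: "id_blinfun \<in> G2"
proof -
  have "blinfun_apply (id_blinfun :: octonion endo) = id" by auto
  then show ?thesis by (simp add: G2_def)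
qed

text \<open>The vectors \<open>x + y\<close> and \<open>x - y\<close> are orthogonal; the involution fixes the first and negates the
  second.\<close>

lemma G2_swap:
  assumes x: "x \<in> imaginary" "norm x = 1" and y: "y \<in> imaginary" "norm y = 1"
  obtains g where "g \<in> G2" "blinfun_apply g x = y" "blinfun_apply g y = x"
proof (cases "x = y")
  case True
  then show ?thesis by (intro that[of id_blinfun]) (simp_all add: id_G2)
next
  case False
  define a where "a = (x - y) /\<^sub>R norm (x - y)"
  have a: "a \<in> imaginary" "norm a = 1" using False x y subspace_imaginary
    by (simp_all add: a_def subspace_diff subspace_scale)
  have xy: "(x + y) \<bullet> (x - y) = 0" using x y by (simp add: inner_add_left inner_add_right inner_diff_left inner_diff_right inner_commute norm_eq_1)
  have "\<exists>p s. p \<in> imaginary \<and> norm p = 1 \<and> a \<bullet> p = 0 \<and> x + y = s *\<^sub>R p"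
  proof (cases "x + y = 0")
    case True
    obtain p where "norm p = 1" "p \<bullet> oct_one = 0" "p \<bullet> a = 0" using orthogonal_to_four[of oct_one a a a] by metis
    then show ?thesis using True by (intro exI[of _ p] exI[of _ 0]) (simp add: imaginary_iff inner_commute)
  next
    case n: False
    show ?thesis
      by (rule exI[of _ "(x + y) /\<^sub>R norm (x + y)"], rule exI[of _ "norm (x + y)"])
        (use n x y xy subspace_imaginary in \<open>simp add: subspace_add subspace_scale a_def inner_commute\<close>)
  qed
  then obtain p s where p: "p \<in> imaginary" "norm p = 1" "a \<bullet> p = 0" and s: "x + y = s *\<^sub>R p" by blast
  have t: "x - y = norm (x - y) *\<^sub>R a" using False by (simp add: a_def)
  obtain g where g: "g \<in> G2" "blinfun_apply g p = p" "blinfun_apply g a = - a"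
    using G2_reflection[OF p(1,2) a p(3)] .
  have "blinfun_apply g (x - y) = - (norm (x - y) *\<^sub>R a)"
    using arg_cong[OF t, of "blinfun_apply g"] by (simp only: blinfun.scaleR_right g scaleR_minus_right)
  then have "blinfun_apply g (x - y) = y - x" unfolding t[symmetric] by simp
  moreover have "blinfun_apply g (x + y) = x + y" by (simp add: s blinfun.scaleR_right g)
  ultimately have 1: "blinfun_apply g x + blinfun_apply g y = x + y" "blinfun_apply g x - blinfun_apply g y = y - x"
    by (simp_all add: blinfun.add_right blinfun.diff_right)
  have "2 *\<^sub>R blinfun_apply g x = 2 *\<^sub>R y"
    using arg_cong2[OF 1, of "(+)"] by (simp add: scaleR_2)
  then have "blinfun_apply g x = y" by simp
  moreover then have "blinfun_apply g y = x" using 1(1) by simp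
  ultimately show ?thesis using g(1) by (intro that)
qed

lemma G2_compose: "g \<in> G2 \<Longrightarrow> h \<in> G2 \<Longrightarrow> g o\<^sub>L h \<in> G2"
  by (simp add: G2_iff Spin7_compose)

lemma G2_inverse:
  assumes "g \<in> G2"
  obtains h where "h \<in> G2" "\<And>x. blinfun_apply h (blinfun_apply g x) = x" "\<And>x. blinfun_apply g (blinfun_apply h x) = x"
proof -
  have b: "bij (blinfun_apply g)" using assms by (simp add: G2_def)
  note i = bij_is_surj[OF b, THEN surj_f_inv_f] bij_is_inj[OF b, THEN inv_f_f]
  have "bounded_linear (inv (blinfun_apply g))"
    using orthogonal_transformation_inv[OF G2_orthogonal[OF assms]]
    by (simp add: linear_conv_bounded_linear[symmetric] orthogonal_transformation_linear)
  then have h: "blinfun_apply (Blinfun (inv (blinfun_apply g))) = inv (blinfun_apply g)"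
    by (rule bounded_linear_Blinfun_apply)
  have "inv (blinfun_apply g) (omult x y) = omult (inv (blinfun_apply g) x) (inv (blinfun_apply g) y)" for x y
    using G2_omult[OF assms, of "inv (blinfun_apply g) x" "inv (blinfun_apply g) y"] i by metis
  then have "Blinfun (inv (blinfun_apply g)) \<in> G2"
    by (simp add: G2_def h bij_imp_bij_inv[OF b])
  then show ?thesis by (rule that) (simp_all add: h i)
qed

section \<open>SU(3) as the stabiliser of i\<close>

lemma matrix_vector_nth3:
  "(A *v v) $ k = A $ k $ 1 * v $ 1 + A $ k $ 2 * v $ 2 + A $ k $ 3 * v $ 3" for A :: "complex^3^3"
  by (simp add: matrix_vector_mult_def sum_3)

definition conj_transpose :: "complex^3^3 \<Rightarrow> complex^3^3" where
  "conj_transpose A = transpose (map_matrix cnj A)"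

lemma conj_transpose_nth [simp]: "conj_transpose A $ i $ j = cnj (A $ j $ i)"
  by (simp add: conj_transpose_def transpose_def map_matrix_def)

lemma SU3_matrices_iff:
  "A \<in> SU3_matrices \<longleftrightarrow>
    (\<forall>i j. cnj (A $ 1 $ i) * A $ 1 $ j + cnj (A $ 2 $ i) * A $ 2 $ j + cnj (A $ 3 $ i) * A $ 3 $ j = (if i = j then 1 else 0))
    \<and> det A = 1"
  by (simp add: SU3_matrices_def vec_eq_iff matrix_matrix_mult_def transpose_def map_matrix_def mat_def sum_3)

definition herm :: "complex^3 \<Rightarrow> complex^3 \<Rightarrow> complex" where
  "herm u v = u $ 1 * cnj (v $ 1) + u $ 2 * cnj (v $ 2) + u $ 3 * cnj (v $ 3)"

text \<open>The conjugate of the cofactor identity \<open>A\<^sup>T (A u \<times> A v) = det A (u \<times> v)\<close>.\<close>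

lemma conj_cross_matrix:
  "conj_transpose A *v conj_cross (A *v u) (A *v v) = cnj (det A) *s conj_cross u v" for A :: "complex^3^3"
  by (simp add: vec_eq_iff forall_3 matrix_vector_nth3 det_3) (simp add: algebra_simps)

lemma herm_adjoint: "herm (A *v u) v = herm u (conj_transpose A *v v)" for A :: "complex^3^3"
  by (simp add: herm_def matrix_vector_nth3 algebra_simps)

lemma SU3_cancel:
  assumes "A \<in> SU3_matrices"
  shows "conj_transpose A *v (A *v u) = u" "A *v (conj_transpose A *v u) = u"
proof -
  have 1: "conj_transpose A ** A = mat 1" using assms by (simp add: SU3_matrices_def conj_transpose_def)
  then have 2: "A ** conj_transpose A = mat 1" using matrix_left_right_inverse by blast
  show "conj_transpose A *v (A *v u) = u" "A *v (conj_transpose A *v u) = u"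
    by (simp_all add: matrix_vector_mul_assoc 1 2)
qed

lemma SU3_conj_cross:
  assumes "A \<in> SU3_matrices"
  shows "conj_cross (A *v u) (A *v v) = A *v conj_cross u v"
proof -
  have "cnj (det A) = 1" using assms by (simp add: SU3_matrices_def)
  then show ?thesis using conj_cross_matrix[of A u v] SU3_cancel(2)[OF assms] by (metis vector_smult_lid)
qed

lemma SU3_herm: "A \<in> SU3_matrices \<Longrightarrow> herm (A *v u) (A *v v) = herm u v"
  by (simp add: herm_adjoint SU3_cancel)

lemma SU3_embed_apply: "blinfun_apply (SU3_embed A) x = (fst x, A *v snd x)"
proof -
  have "linear (\<lambda>x::octonion. (fst x, A *v snd x))"
    by (rule linearI) (simp_all add: oct_eq_iff matrix_vector_nth3 algebra_simps)
  then show ?thesis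
    by (simp add: SU3_embed_def bounded_linear_Blinfun_apply linear_conv_bounded_linear)
qed

lemma omult_herm: "omult x y = (fst x * fst y - herm (snd x) (snd y),
    fst x *s snd y + cnj (fst y) *s snd x + conj_cross (snd x) (snd y))"
  by (simp add: omult_def herm_def sum_3)

lemma SU3_embed_G2:
  assumes "A \<in> SU3_matrices"
  shows "SU3_embed A \<in> G2"
proof -
  have "bij (blinfun_apply (SU3_embed A))"
    by (rule o_bij[of "\<lambda>y. (fst y, conj_transpose A *v snd y)"])
      (auto simp: fun_eq_iff SU3_embed_apply SU3_cancel[OF assms])
  moreover have "blinfun_apply (SU3_embed A) (omult x y) =
      omult (blinfun_apply (SU3_embed A) x) (blinfun_apply (SU3_embed A) y)" for x y
    by (simp add: SU3_embed_apply omult_herm SU3_herm[OF assms] SU3_conj_cross[OF assms]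
        matrix_vector_right_distrib vector_scalar_commute)
  ultimately show ?thesis by (simp add: G2_def)
qed

lemma oct_i_imaginary: "oct_i \<in> imaginary" "norm oct_i = 1" "oct_i \<bullet> oct_i = 1"
  by (simp_all add: imaginary_def oct_i_def norm_Pair)

text \<open>Fixing \<open>i\<close> means commuting with the complex structure of \<open>\<complex>\<^sup>3\<close>. The two components of the product
  of vectors in \<open>\<complex>\<^sup>3\<close> are the Hermitian form and the conjugate cross product: the first makes the
  matrix unitary, the second normalises its determinant.\<close>

lemma stabiliser_oct_i:
  assumes g: "g \<in> G2" and i: "blinfun_apply g oct_i = oct_i"
  obtains A where "A \<in> SU3_matrices" "g = SU3_embed A"
proof -
  define f where "f v = snd (blinfun_apply g (0, v))" for v
  have go: "blinfun_apply g x \<bullet> blinfun_apply g y = x \<bullet> y" for x y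
    using G2_orthogonal[OF g] by (simp add: orthogonal_transformation_def)
  have g0: "blinfun_apply g (0, v) = (0, f v)" for v
    using go[of "(0, v)" oct_one, unfolded G2_one[OF g]] go[of "(0, v)" oct_i, unfolded i]
    by (simp add: f_def prod_eq_iff complex_eq_iff inner_prod_def oct_one_def oct_i_def inner_complex_def)
  have gc: "blinfun_apply g (c, 0) = (c, 0)" for c
  proof -
    have "(c, 0) = Re c *\<^sub>R oct_one + Im c *\<^sub>R oct_i"
      by (simp add: oct_one_def oct_i_def complex_eq_iff)
    then show ?thesis by (simp add: blinfun.add_right blinfun.scaleR_right G2_one[OF g] i)
  qed
  have ga: "blinfun_apply g x = (fst x, f (snd x))" for x
    using blinfun.add_right[of g "(fst x, 0)" "(0, snd x)"] by (simp add: gc g0)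
  have fadd: "f (u + v) = f u + f v" for u v
    using blinfun.add_right[of g "(0, u)" "(0, v)"] by (simp add: f_def)
  have fs: "f (c *s v) = c *s f v" for c v
  proof -
    have "f 0 = 0" using blinfun.zero_right[of g] by (simp add: f_def zero_prod_def)
    moreover have "conj_cross 0 w = 0" for w by (simp add: vec_eq_iff forall_3)
    ultimately show ?thesis
      using G2_omult[OF g, of "(c, 0)" "(0, v)"] by (simp add: omult_herm ga)
  qed
  define A where "A = matrix f"
  have fA: "f v = A *v v" for v
    unfolding A_def by (rule matrix_works[symmetric]) (unfold_locales; simp add: fadd fs)
  have fh: "herm (f u) (f v) = herm u v" for u v
    using G2_omult[OF g, of "(0, u)" "(0, v)"] by (simp add: omult_herm ga)
  have fc: "f (conj_cross u v) = conj_cross (f u) (f v)" for u v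
    using G2_omult[OF g, of "(0, u)" "(0, v)"] by (simp add: omult_herm ga)
  have fe: "f (axis j 1) $ k = A $ k $ j" for j k
    using exhaust_3[of j] by (auto simp: fA matrix_vector_nth3 axis_def)
  have H: "cnj (A $ 1 $ i) * A $ 1 $ j + cnj (A $ 2 $ i) * A $ 2 $ j + cnj (A $ 3 $ i) * A $ 3 $ j = (if i = j then 1 else 0)" for i j
    using fh[of "axis j 1" "axis i 1", unfolded herm_def fe] exhaust_3[of i] exhaust_3[of j]
    by (auto simp: axis_def mult.commute)
  have "conj_cross (axis 1 1) (axis 2 1) = axis 3 1"
    by (simp add: vec_eq_iff forall_3 axis_def)
  then have C: "f (axis 3 1) = conj_cross (f (axis 1 1)) (f (axis 2 1))" using fc by metis
  have "A $ k $ 3 = conj_cross (f (axis 1 1)) (f (axis 2 1)) $ k" for k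
    using C fe[of 3 k] by simp
  then have c3: "cnj (A $ 1 $ 3) = A $ 2 $ 1 * A $ 3 $ 2 - A $ 3 $ 1 * A $ 2 $ 2"
    "cnj (A $ 2 $ 3) = A $ 3 $ 1 * A $ 1 $ 2 - A $ 1 $ 1 * A $ 3 $ 2"
    "cnj (A $ 3 $ 3) = A $ 1 $ 1 * A $ 2 $ 2 - A $ 2 $ 1 * A $ 1 $ 2"
    by (simp_all add: fe)
  have "det A = cnj (A $ 1 $ 3) * A $ 1 $ 3 + cnj (A $ 2 $ 3) * A $ 2 $ 3 + cnj (A $ 3 $ 3) * A $ 3 $ 3"
    unfolding c3 by (simp add: det_3 algebra_simps)
  then have "det A = 1" using H[of 3 3] by simp
  then have "A \<in> SU3_matrices" using H by (simp add: SU3_matrices_iff)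
  moreover have "g = SU3_embed A" by (rule blinfun_eqI) (simp add: SU3_embed_apply ga fA)
  ultimately show ?thesis by (rule that)
qed

lemma SU3_iff: "g \<in> SU3 \<longleftrightarrow> g \<in> G2 \<and> blinfun_apply g oct_i = oct_i"
proof
  assume "g \<in> SU3"
  then show "g \<in> G2 \<and> blinfun_apply g oct_i = oct_i"
    by (auto simp: SU3_def SU3_embed_G2 SU3_embed_apply oct_i_def)
next
  assume "g \<in> G2 \<and> blinfun_apply g oct_i = oct_i"
  then show "g \<in> SU3" using stabiliser_oct_i unfolding SU3_def by (metis image_eqI)
qed

lemma S6_homogeneous: "homogeneous_space G2 SU3 S6 oct_i"
  unfolding homogeneous_space_def
proof (intro conjI)
  show "oct_i \<in> S6" by (simp add: S6_def oct_i_imaginary)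
  show "S6 = {blinfun_apply g oct_i |g. g \<in> G2}"
  proof (intro equalityI subsetI)
    fix x assume "x \<in> S6"
    then obtain g where "g \<in> G2" "blinfun_apply g oct_i = x"
      using G2_swap[OF oct_i_imaginary(1,2), of x] by (auto simp: S6_def)
    then show "x \<in> {blinfun_apply g oct_i |g. g \<in> G2}" by blast
  next
    show "x \<in> S6" if "x \<in> {blinfun_apply g oct_i |g. g \<in> G2}" for x
      using that G2_imaginary[OF _ oct_i_imaginary(1)] oct_i_imaginary by (auto simp: S6_def norm_eq_1)
  qed
  show "SU3 = {g \<in> G2. blinfun_apply g oct_i = oct_i}" using SU3_iff by auto
qed

definition diag3 :: "complex \<Rightarrow> complex \<Rightarrow> complex \<Rightarrow> complex^3^3" where
  "diag3 a b c = vector [vector [a, 0, 0], vector [0, b, 0], vector [0, 0, c]]"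

lemma diag3_SU3: "cnj a * a = 1 \<Longrightarrow> cnj b * b = 1 \<Longrightarrow> cnj c * c = 1 \<Longrightarrow> a * b * c = 1 \<Longrightarrow> diag3 a b c \<in> SU3_matrices"
  by (simp add: SU3_matrices_iff forall_3 diag3_def det_3)

definition cyclic3 :: "complex^3^3" where
  "cyclic3 = vector [vector [0, 0, 1], vector [1, 0, 0], vector [0, 1, 0]]"

lemma cyclic3_SU3: "cyclic3 \<in> SU3_matrices"
  by (simp add: SU3_matrices_iff forall_3 cyclic3_def det_3)

definition block12 :: "complex \<Rightarrow> complex \<Rightarrow> complex^3^3" where
  "block12 a b = vector [vector [cnj a, cnj b, 0], vector [- b, a, 0], vector [0, 0, 1]]"

lemma block12_SU3: "cnj a * a + cnj b * b = 1 \<Longrightarrow> block12 a b \<in> SU3_matrices"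
  by (simp add: SU3_matrices_iff forall_3 block12_def det_3 algebra_simps)

definition block23 :: "complex \<Rightarrow> complex \<Rightarrow> complex^3^3" where
  "block23 a b = vector [vector [1, 0, 0], vector [0, cnj a, cnj b], vector [0, - b, a]]"

lemma block23_SU3: "cnj a * a + cnj b * b = 1 \<Longrightarrow> block23 a b \<in> SU3_matrices"
  by (simp add: SU3_matrices_iff forall_3 block23_def det_3 algebra_simps)

lemma herm_same: "herm u u = of_real ((norm u)\<^sup>2)"
  by (simp add: herm_def norm_vec_def L2_set_def sum_3 complex_norm_square[symmetric])

text \<open>Two rotations in coordinate planes: the first makes the third coordinate vanish and the second
  coordinate real, the other rotates the result to the first axis.\<close>

lemma SU3_to_axis:
  assumes "norm u = 1"
  obtains k where "k \<in> SU3" "blinfun_apply k (0, u) = (0, axis 1 1)"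
proof -
  define r where "r = sqrt ((norm (u $ 2))\<^sup>2 + (norm (u $ 3))\<^sup>2)"
  have u: "u $ 1 * cnj (u $ 1) + u $ 2 * cnj (u $ 2) + u $ 3 * cnj (u $ 3) = 1"
    using herm_same[of u] assms by (simp add: herm_def)
  have r2: "complex_of_real r * of_real r = u $ 2 * cnj (u $ 2) + u $ 3 * cnj (u $ 3)"
    by (simp add: r_def of_real_mult[symmetric] complex_norm_square of_real_power[symmetric] del: of_real_mult of_real_power)
  obtain B where B: "B \<in> SU3_matrices" "(B *v u) $ 1 = u $ 1" "(B *v u) $ 2 = of_real r" "(B *v u) $ 3 = 0"
  proof (cases "r = 0")
    case True
    then have "u $ 2 = 0" "u $ 3 = 0" by (simp_all add: r_def sum_power2_eq_zero_iff)
    then show ?thesis using True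
      by (intro that[of "diag3 1 1 1"]) (simp_all add: diag3_SU3, simp_all add: diag3_def matrix_vector_nth3)
  next
    case False
    have "cnj (u $ 2 / of_real r) * (u $ 2 / of_real r) + cnj (u $ 3 / of_real r) * (u $ 3 / of_real r) 
        = (u $ 2 * cnj (u $ 2) + u $ 3 * cnj (u $ 3)) / (of_real r * of_real r)"
      by (simp add: add_divide_distrib mult.commute)
    also have "\<dots> = 1" unfolding r2[symmetric] using False by simp
    finally have "cnj (u $ 2 / of_real r) * (u $ 2 / of_real r) + cnj (u $ 3 / of_real r) * (u $ 3 / of_real r) = 1" .
    from block23_SU3[OF this] show ?thesis
      by (rule that) (use False r2 in \<open>simp_all add: block23_def matrix_vector_nth3 field_simps\<close>)
  qed
  have "cnj (u $ 1) * u $ 1 + cnj (of_real r) * of_real r = 1" using u r2 by (simp add: algebra_simps)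
  note C = block12_SU3[OF this]
  define k where "k = SU3_embed (block12 (u $ 1) (of_real r)) o\<^sub>L SU3_embed B"
  have "k \<in> SU3"
    unfolding SU3_iff k_def using SU3_embed_G2[OF B(1)] SU3_embed_G2[OF C]
    by (simp add: G2_compose SU3_embed_apply oct_i_def)
  moreover have "blinfun_apply k (0, u) = (0, axis 1 1)"
    using B(2-4) u r2 by (simp add: k_def SU3_embed_apply oct_eq_iff matrix_vector_nth3[of _ "B *v u"] block12_def axis_def)
      (simp add: algebra_simps)
  ultimately show ?thesis by (rule that)
qed

section \<open>Equivariant bilinear maps\<close>

lemma axis_nth3:
  fixes z :: complex
  defines "e \<equiv> \<lambda>j. (axis j z :: complex^3)"
  shows "e 1 $ 1 = z" "e 1 $ 2 = 0" "e 1 $ 3 = 0"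
    "e 2 $ 1 = 0" "e 2 $ 2 = z" "e 2 $ 3 = 0"
    "e 3 $ 1 = 0" "e 3 $ 2 = 0" "e 3 $ 3 = z"
  by (simp_all add: e_def axis_def)

lemma diag3_mult: "diag3 a b c *v v = vector [a * v $ 1, b * v $ 2, c * v $ 3]"
  by (simp add: vec_eq_iff forall_3 matrix_vector_nth3 diag3_def)

lemma real_basis_expansion:
  "u = Re (u $ 1) *\<^sub>R axis 1 1 + Im (u $ 1) *\<^sub>R axis 1 \<i> + Re (u $ 2) *\<^sub>R axis 2 1 + Im (u $ 2) *\<^sub>R axis 2 \<i>
    + Re (u $ 3) *\<^sub>R axis 3 1 + Im (u $ 3) *\<^sub>R axis 3 \<i>" for u :: "complex^3"
  by (simp add: vec_eq_iff forall_3 axis_nth3 complex_eq_iff)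

text \<open>The scalar \<open>c\<close> is read off from \<open>\<beta>(e\<^sub>1, e\<^sub>2)\<close>. The difference \<open>\<gamma>\<close> then vanishes on all pairs from
  the real basis \<open>e\<^sub>j, i e\<^sub>j\<close>: diagonal matrices treat the pairs supported on \<open>e\<^sub>1\<close> and \<open>e\<^sub>2\<close>, and the
  cyclic permutation moves these to the others.\<close>

lemma SU3_bilinear_maps:
  fixes \<beta> :: "complex^3 \<Rightarrow> complex^3 \<Rightarrow> complex^3"
  assumes bil: "bilinear \<beta>" and eq: "\<And>A u v. A \<in> SU3_matrices \<Longrightarrow> \<beta> (A *v u) (A *v v) = A *v \<beta> u v"
  shows "\<exists>c. \<forall>u v. \<beta> u v = c *s conj_cross u v"
proof -
  define c where "c = \<beta> (axis 1 1) (axis 2 1) $ 3"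
  define \<gamma> where "\<gamma> u v = \<beta> u v - c *s conj_cross u v" for u v
  note bl = bilinear_ladd[OF bil] bilinear_radd[OF bil] bilinear_lmul[OF bil] bilinear_rmul[OF bil]
  have \<gamma>bil: "bilinear \<gamma>"
    unfolding bilinear_def \<gamma>_def
    by (intro conjI allI linearI) (simp_all add: bl vec_eq_iff forall_3 algebra_simps)
  have \<gamma>eq: "\<gamma> (A *v u) (A *v v) = A *v \<gamma> u v" if "A \<in> SU3_matrices" for A u v
    by (simp add: \<gamma>_def eq[OF that] SU3_conj_cross[OF that] matrix_vector_mult_diff_distrib vector_scalar_commute)
  have move: "\<gamma> u' v' = A *v \<gamma> u v" if "A \<in> SU3_matrices" "A *v u = u'" "A *v v = v'" for A u v u' v'
    using \<gamma>eq[OF that(1), of u v] that by simp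
  have \<gamma>minus: "\<gamma> (- u) (- v) = \<gamma> u v" for u v
    by (simp add: bilinear_lneg[OF \<gamma>bil] bilinear_rneg[OF \<gamma>bil])
  have d1: "diag3 (-1) (-1) 1 \<in> SU3_matrices" and d2: "diag3 (-1) 1 (-1) \<in> SU3_matrices"
    by (simp_all add: diag3_SU3)
  have \<gamma>12: "\<gamma> (axis 1 1) (axis 2 1) = 0"
  proof -
    have "\<gamma> (- axis 1 1) (- axis 2 1) = diag3 (-1) (-1) 1 *v \<gamma> (axis 1 1) (axis 2 1)"
      by (rule move[OF d1]) (simp_all add: vec_eq_iff forall_3 diag3_mult axis_nth3)
    then have "\<gamma> (axis 1 1) (axis 2 1) $ 1 = 0" "\<gamma> (axis 1 1) (axis 2 1) $ 2 = 0"
      by (simp_all add: \<gamma>minus vec_eq_iff forall_3 diag3_mult)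
    moreover have "\<gamma> (axis 1 1) (axis 2 1) $ 3 = 0" by (simp add: \<gamma>_def c_def axis_nth3)
    ultimately show ?thesis by (simp add: vec_eq_iff forall_3)
  qed
  have \<gamma>11: "\<gamma> (axis 1 z) (axis 1 w) = 0" for z w
  proof -
    have "\<gamma> (- axis 1 z) (- axis 1 w) = diag3 (-1) (-1) 1 *v \<gamma> (axis 1 z) (axis 1 w)"
      by (rule move[OF d1]) (simp_all add: vec_eq_iff forall_3 diag3_mult axis_nth3)
    moreover have "\<gamma> (- axis 1 z) (- axis 1 w) = diag3 (-1) 1 (-1) *v \<gamma> (axis 1 z) (axis 1 w)"
      by (rule move[OF d2]) (simp_all add: vec_eq_iff forall_3 diag3_mult axis_nth3)
    ultimately show ?thesis by (simp add: \<gamma>minus vec_eq_iff forall_3 diag3_mult)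
  qed
  have u12: "\<gamma> (axis 1 z) (axis 2 w) = 0" if "cnj z * z = 1" "cnj w * w = 1" for z w
  proof -
    have d: "diag3 z w (cnj (z * w)) \<in> SU3_matrices"
    proof (rule diag3_SU3[OF that])
      have "(cnj z * z) * (cnj w * w) = 1" using that by simp
      then show "cnj (cnj (z * w)) * cnj (z * w) = 1" "z * w * cnj (z * w) = 1" by (simp_all add: mult_ac)
    qed
    have "\<gamma> (axis 1 z) (axis 2 w) = diag3 z w (cnj (z * w)) *v \<gamma> (axis 1 1) (axis 2 1)"
      by (rule move[OF d]) (simp_all add: vec_eq_iff forall_3 diag3_mult axis_nth3)
    then show ?thesis by (simp add: \<gamma>12)
  qed
  have b: "block12 0 1 \<in> SU3_matrices" by (simp add: block12_SU3)
  \<comment> \<open>exchanging the first two axes, with a sign to keep the determinant\<close>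
  have u21: "\<gamma> (axis 2 z) (axis 1 w) = 0" if "cnj z * z = 1" "cnj w * w = 1" for z w
  proof -
    have "\<gamma> (axis 2 z) (axis 1 w) = block12 0 1 *v \<gamma> (axis 1 (- z)) (axis 2 w)"
      by (rule move[OF b]) (simp_all add: vec_eq_iff forall_3 matrix_vector_nth3 block12_def axis_nth3)
    then show ?thesis using that by (simp add: u12)
  qed
  have cyc: "cyclic3 *v axis 1 z = axis 2 z" "cyclic3 *v axis 2 z = axis 3 z" "cyclic3 *v axis 3 z = axis 1 z" for z
    by (simp_all add: vec_eq_iff forall_3 matrix_vector_nth3 cyclic3_def axis_nth3)
  have step: "\<gamma> (cyclic3 *v u) (cyclic3 *v v) = 0" if "\<gamma> u v = 0" for u v
    using \<gamma>eq[OF cyclic3_SU3, of u v] that by simp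
  note step1 = step[of "axis 1 z" "axis 1 w" for z w, unfolded cyc] step[of "axis 1 z" "axis 2 w" for z w, unfolded cyc]
    step[of "axis 2 z" "axis 1 w" for z w, unfolded cyc]
  note step2 = step[of "axis 2 z" "axis 2 w" for z w, unfolded cyc] step[of "axis 2 z" "axis 3 w" for z w, unfolded cyc]
    step[of "axis 3 z" "axis 2 w" for z w, unfolded cyc]
  have "\<gamma> u v = 0" for u v
    by (subst real_basis_expansion[of u], subst real_basis_expansion[of v])
      (simp add: bilinear_ladd[OF \<gamma>bil] bilinear_radd[OF \<gamma>bil] bilinear_lmul[OF \<gamma>bil] bilinear_rmul[OF \<gamma>bil]
        \<gamma>11 u12 u21 step1 step2)
  then show ?thesis by (auto simp: \<gamma>_def)
qed

definition e1 :: octonion where "e1 = (0, axis 1 1)"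

lemma e1_simps: "e1 \<in> imaginary" "norm e1 = 1" "e1 \<bullet> e1 = 1" "oct_i \<bullet> e1 = 0" "omult oct_i e1 = (0, axis 1 \<i>)"
  by (simp_all add: e1_def imaginary_def oct_i_def norm_Pair inner_oct axis_nth3 oct_eq_iff omult_simps)

text \<open>By transitivity on orthonormal pairs of imaginary octonions, an equivariant map is determined
  by one value; antisymmetry comes from its vanishing on the diagonal.\<close>

lemma G2_bilinear_maps:
  fixes \<beta> :: "octonion \<Rightarrow> octonion \<Rightarrow> octonion"
  assumes \<beta>: "equivariant_bilinear imaginary G2 \<beta>"
  shows "\<exists>s. \<forall>x\<in>imaginary. \<forall>y\<in>imaginary. \<beta> x y = s *\<^sub>R (omult x y + (x \<bullet> y) *\<^sub>R oct_one)"
proof -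
  note im = equivariant_bilinearD(1)[OF \<beta>] and add2 = equivariant_bilinearD(3)[OF \<beta>]
    and sc1 = equivariant_bilinearD(4)[OF \<beta>] and sc2 = equivariant_bilinearD(5)[OF \<beta>]
  have add1: "\<beta> (x + z) y = \<beta> x y + \<beta> z y" if "x \<in> imaginary" "z \<in> imaginary" "y \<in> imaginary" for x y z
    using equivariant_bilinearD(2)[OF \<beta> that(1,3,2)] .
  have eq: "\<beta> (blinfun_apply g x) (blinfun_apply g y) = blinfun_apply g (\<beta> x y)"
    if "g \<in> G2" "x \<in> imaginary" "y \<in> imaginary" for g x y
    using equivariant_bilinearD(6)[OF \<beta> that(2,3,1)] .
  note i = oct_i_imaginary
  have d: "diag3 (-1) (-1) 1 \<in> SU3_matrices" "diag3 (-1) 1 (-1) \<in> SU3_matrices" "diag3 1 (-1) (-1) \<in> SU3_matrices"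
    by (simp_all add: diag3_SU3)
  note dG = d[THEN SU3_embed_G2]
  have neg: "\<beta> (- x) (- y) = \<beta> x y" "\<beta> x (- y) = - \<beta> x y" "- x \<in> imaginary"
    if "x \<in> imaginary" "y \<in> imaginary" for x y
  proof -
    have n: "- x \<in> imaginary" if "x \<in> imaginary" for x using that by (simp add: imaginary_iff)
    show "- x \<in> imaginary" by (rule n[OF that(1)])
    show "\<beta> (- x) (- y) = \<beta> x y" "\<beta> x (- y) = - \<beta> x y"
      using that sc1[of x "- y" "-1"] sc2[of x y "-1"] n[of y] by simp_all
  qed
  have di: "blinfun_apply (SU3_embed (diag3 a b c)) oct_i = oct_i" for a b c
    by (simp add: SU3_embed_apply oct_i_def)
  have ii: "\<beta> oct_i oct_i = 0"
  proof -
    have v: "snd (\<beta> oct_i oct_i) = 0"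
      using eq[OF dG(1) i(1) i(1)] eq[OF dG(2) i(1) i(1)]
      by (simp add: di) (simp add: SU3_embed_apply prod_eq_iff vec_eq_iff forall_3 diag3_mult)
    define t where "t = Im (fst (\<beta> oct_i oct_i))"
    have t: "\<beta> oct_i oct_i = t *\<^sub>R oct_i"
      using im[OF i(1) i(1)] v by (simp add: t_def imaginary_def oct_i_def prod_eq_iff complex_eq_iff)
    obtain g where g: "g \<in> G2" "blinfun_apply g oct_i = - oct_i"
      using G2_swap[OF i(1,2), of "- oct_i"] neg(3)[OF i(1) i(1)] i(2) by (metis norm_minus_cancel)
    have "t *\<^sub>R oct_i = - (t *\<^sub>R oct_i)"
      using eq[OF g(1) i(1) i(1)] by (simp add: g neg i t blinfun.scaleR_right)
    then have "t = 0" by (simp add: oct_i_def prod_eq_iff)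
    then show ?thesis by (simp add: t)
  qed
  have diag: "\<beta> x x = 0" if x: "x \<in> imaginary" for x
  proof (cases "x = 0")
    case True
    then show ?thesis using sc1[of 0 0 0] subspace_0[OF subspace_imaginary] by simp
  next
    case False
    define y where "y = x /\<^sub>R norm x"
    have y: "y \<in> imaginary" "norm y = 1" using False x subspace_imaginary by (simp_all add: y_def subspace_scale)
    obtain g where g: "g \<in> G2" "blinfun_apply g oct_i = y" using G2_swap[OF i(1,2) y] .
    have "\<beta> y y = 0" using eq[OF g(1) i(1) i(1)] by (simp add: g ii blinfun.zero_right)
    moreover have "x = norm x *\<^sub>R y" using False by (simp add: y_def)
    ultimately show ?thesis using sc1[of y "norm x *\<^sub>R y"] sc2[of y y] y(1) subspace_imaginary by (metis scaleR_zero_right subspace_scale)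
  qed
  have anti: "\<beta> y x = - \<beta> x y" if x: "x \<in> imaginary" and y: "y \<in> imaginary" for x y
  proof -
    have xy: "x + y \<in> imaginary" using x y by (simp add: subspace_add[OF subspace_imaginary])
    have "\<beta> x y + \<beta> y x = 0"
      using diag[OF xy] by (simp add: add1[OF x y xy] add2[OF x x y] add2[OF y x y] diag x y)
    then show ?thesis by (simp add: add_eq_0_iff)
  qed
  define s where "s = Im (snd (\<beta> oct_i e1) $ 1)"
  have ie: "\<beta> oct_i e1 = s *\<^sub>R omult oct_i e1"
  proof -
    define z where "z = snd (\<beta> oct_i e1) $ 1"
    have de: "blinfun_apply (SU3_embed (diag3 1 (-1) (-1))) e1 = e1" "blinfun_apply (SU3_embed (diag3 (-1) (-1) 1)) e1 = - e1"
      by (simp_all add: SU3_embed_apply e1_def prod_eq_iff vec_eq_iff forall_3 diag3_mult axis_nth3)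
    have v: "snd (\<beta> oct_i e1) $ 2 = 0" "snd (\<beta> oct_i e1) $ 3 = 0"
      using eq[OF dG(3) i(1) e1_simps(1)]
      by (simp_all add: di de) (simp_all add: SU3_embed_apply oct_eq_iff diag3_mult)
    have a: "fst (\<beta> oct_i e1) = 0"
      using eq[OF dG(1) i(1) e1_simps(1)]
      by (simp add: di de neg i e1_simps) (simp add: SU3_embed_apply oct_eq_iff)
    have z: "\<beta> oct_i e1 = Re z *\<^sub>R e1 + s *\<^sub>R omult oct_i e1"
      using v a by (simp add: oct_eq_iff e1_simps(5)) (simp add: e1_def axis_nth3 z_def s_def complex_eq_iff)
    obtain g where g: "g \<in> G2" "blinfun_apply g oct_i = e1" "blinfun_apply g e1 = oct_i"
      using G2_swap[OF i(1,2) e1_simps(1,2)] .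
    have ei: "omult e1 oct_i = - omult oct_i e1"
      by (simp add: oct_eq_iff omult_simps oct_i_def e1_def axis_nth3)
    have "- \<beta> oct_i e1 = Re z *\<^sub>R oct_i - s *\<^sub>R omult oct_i e1"
      using eq[OF g(1) i(1) e1_simps(1)]
      by (simp add: g anti[OF i(1) e1_simps(1)]) (simp add: z blinfun.add_right blinfun.scaleR_right g G2_omult ei)
    then have "Re z *\<^sub>R oct_i = - (Re z *\<^sub>R e1)" by (simp add: z algebra_simps)
    then have "Re z = 0" by (simp add: prod_eq_iff oct_i_def e1_def)
    then show ?thesis by (simp add: z)
  qed
  have on: "\<beta> x y = s *\<^sub>R omult x y"
    if x: "x \<in> imaginary" "norm x = 1" and y: "y \<in> imaginary" "norm y = 1" and o: "x \<bullet> y = 0" for x y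
  proof -
    obtain h where h: "h \<in> G2" "blinfun_apply h x = oct_i" using G2_swap[OF x i(1,2)] .
    have ho: "blinfun_apply h a \<bullet> blinfun_apply h b = a \<bullet> b" for a b
      using G2_orthogonal[OF h(1)] by (simp add: orthogonal_transformation_def)
    have "fst (blinfun_apply h y) = 0"
      using ho[of x y] o G2_imaginary(1)[OF h(1) y(1)]
      by (simp add: h(2) imaginary_def complex_eq_iff inner_oct oct_i_def)
    then obtain u where u: "blinfun_apply h y = (0, u)" by (metis prod.collapse)
    have "norm u = 1" using ho[of y y] y(2) by (simp add: u norm_eq_1)
    then obtain k where k: "k \<in> SU3" "blinfun_apply k (0, u) = (0, axis 1 1)" using SU3_to_axis by metis
    have kh: "k o\<^sub>L h \<in> G2" using k(1) h(1) by (simp add: G2_compose SU3_iff)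
    then obtain g where g: "g \<in> G2" "\<And>z. blinfun_apply g (blinfun_apply (k o\<^sub>L h) z) = z" using G2_inverse by metis
    have "blinfun_apply g oct_i = x" "blinfun_apply g e1 = y"
      using g(2)[of x] g(2)[of y] k by (simp_all add: h u e1_def SU3_iff)
    then show ?thesis
      using eq[OF g(1) i(1) e1_simps(1)] by (simp add: ie blinfun.scaleR_right G2_omult[OF g(1)])
  qed
  have "\<beta> x y = s *\<^sub>R (omult x y + (x \<bullet> y) *\<^sub>R oct_one)" if x: "x \<in> imaginary" and y: "y \<in> imaginary" for x y
  proof (cases "x = 0")
    case True
    then show ?thesis using sc1[OF x y, of 0] by (simp add: O.zero_left)
  next
    case xn: False
    define r where "r = (x \<bullet> y) / (x \<bullet> x)"
    define w where "w = y - r *\<^sub>R x"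
    have w: "w \<in> imaginary" "x \<bullet> w = 0"
      using x y xn subspace_imaginary by (simp_all add: w_def r_def subspace_diff subspace_scale inner_diff_right)
    have "\<beta> x w = s *\<^sub>R omult x w"
    proof (cases "w = 0")
      case True
      then show ?thesis using sc2[OF x x, of 0] by (simp add: O.zero_right)
    next
      case wn: False
      note im' = subspace_scale[OF subspace_imaginary]
      define x1 w1 where "x1 = x /\<^sub>R norm x" and "w1 = w /\<^sub>R norm w"
      have i1: "x1 \<in> imaginary" "w1 \<in> imaginary" and r1: "x = norm x *\<^sub>R x1" "w = norm w *\<^sub>R w1"
        using xn wn w x by (simp_all add: x1_def w1_def im')
      have "\<beta> x1 w1 = s *\<^sub>R omult x1 w1"
        by (rule on[OF i1(1) _ i1(2)]) (use xn wn w in \<open>simp_all add: x1_def w1_def\<close>)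
      then have "\<beta> (norm x *\<^sub>R x1) (norm w *\<^sub>R w1) = s *\<^sub>R omult (norm x *\<^sub>R x1) (norm w *\<^sub>R w1)"
        by (simp add: sc1 sc2 i1 im' O.scaleR_left O.scaleR_right)
      then show ?thesis using r1 by simp
    qed
    moreover have "y = w + r *\<^sub>R x" by (simp add: w_def)
    moreover have "r * (x \<bullet> x) = x \<bullet> y" using xn by (simp add: r_def)
    ultimately show ?thesis
      using x w subspace_scale[OF subspace_imaginary x, of r]
      by (simp add: add2 sc2 diag O.add_right O.scaleR_right imaginary_alt(5) inner_add_right)
  qed
  then show ?thesis by blast
qed

section \<open>Lie algebras\<close>

definition derivations :: "octonion endo set" where
  "derivations = {X. \<forall>x y. blinfun_apply X (omult x y) = omult (blinfun_apply X x) y + omult x (blinfun_apply X y)}"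

text \<open>The infinitesimal form of the intertwining condition that defines \<^const>\<open>Spin7\<close>.\<close>

definition spin7_lie :: "octonion endo set" where
  "spin7_lie = {X. \<forall>w\<in>imaginary. \<exists>w'\<in>imaginary. \<forall>x.
     blinfun_apply X (omult w x) = omult w' x + omult w (blinfun_apply X x)}"

lemma endo_exp_fixes:
  fixes X :: "'v::euclidean_space endo"
  assumes "blinfun_apply X b = 0"
  shows "blinfun_apply (endo_exp t X) b = b"
proof -
  have "((\<lambda>t. blinfun_apply (endo_exp t X) b) has_vector_derivative 0) (at t)" for t
    using bounded_linear.has_vector_derivative[OF bounded_bilinear.bounded_linear_left[OF bounded_bilinear_blinfun_apply]
        endo_exp_derivative(1)[of X t], of b] by (simp add: endo_exp_derivative(2) assms blinfun.zero_right)
  then have "blinfun_apply (endo_exp t X) b = blinfun_apply (endo_exp 0 X) b"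
    using has_vector_derivative_zero_constant[of UNIV "\<lambda>t. blinfun_apply (endo_exp t X) b"]
    by (metis UNIV_I convex_UNIV)
  then show ?thesis by (simp add: endo_exp_0)
qed

lemma derivation_exp_G2:
  assumes "X \<in> derivations"
  shows "endo_exp t X \<in> G2"
proof -
  have "blinfun_apply (endo_exp t X) (omult x y) = omult (blinfun_apply (endo_exp t X) x) (blinfun_apply (endo_exp t X) y)" for x y
    by (rule endo_exp_automorphism[OF bounded_bilinear_omult]) (use assms in \<open>simp add: derivations_def\<close>)
  moreover have "bij (blinfun_apply (endo_exp t X))"
  proof (rule o_bij)
    have i: "blinfun_apply (endo_exp (- t) X o\<^sub>L endo_exp t X) = id"
      "blinfun_apply (endo_exp t X o\<^sub>L endo_exp (- t) X) = id" for t
      using endo_exp_inverse[of t X] endo_exp_inverse[of "- t" X] by (auto simp: fun_eq_iff)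
    show "blinfun_apply (endo_exp (- t) X) \<circ> blinfun_apply (endo_exp t X) = id"
      "blinfun_apply (endo_exp t X) \<circ> blinfun_apply (endo_exp (- t) X) = id"
      using i by (auto simp: fun_eq_iff)
  qed
  ultimately show ?thesis by (simp add: G2_def)
qed

lemma exp_lie_algebra:
  assumes "\<And>t. endo_exp t X \<in> G"
  shows "X \<in> lie_algebra G"
proof -
  have "X o\<^sub>L id_blinfun = X" by (rule blinfun_eqI) simp
  then show ?thesis
    unfolding lie_algebra_def tangent_space_def curve_at_def
    using assms endo_exp_derivative(1)[of X 0] by (auto intro!: exI[of _ "\<lambda>t. endo_exp t X"] simp: endo_exp_0)
qed

lemma lie_algebra_G2: "lie_algebra G2 = derivations"
proof (intro equalityI subsetI)
  fix X assume "X \<in> lie_algebra G2"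
  then obtain c where c: "\<forall>t. c t \<in> G2" "c 0 = id_blinfun"
    "\<forall>x. ((\<lambda>t. blinfun_apply (c t) x) has_vector_derivative blinfun_apply X x) (at 0)"
    using lie_algebra_curve by metis
  have "blinfun_apply X (omult x y) = omult (blinfun_apply X x) y + omult x (blinfun_apply X y)" for x y
  proof -
    have "((\<lambda>t. omult (blinfun_apply (c t) x) (blinfun_apply (c t) y)) has_vector_derivative
        (omult (blinfun_apply (c 0) x) (blinfun_apply X y) + omult (blinfun_apply X x) (blinfun_apply (c 0) y))) (at 0)"
      by (rule bounded_bilinear.has_vector_derivative[OF bounded_bilinear_omult c(3)[rule_format] c(3)[rule_format]])
    moreover have "(\<lambda>t. omult (blinfun_apply (c t) x) (blinfun_apply (c t) y)) = (\<lambda>t. blinfun_apply (c t) (omult x y))"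
      using c(1) by (simp add: G2_omult)
    ultimately show ?thesis
      using c(3) vector_derivative_unique_at by (simp add: c(2) add.commute) blast
  qed
  then show "X \<in> derivations" by (simp add: derivations_def)
next
  fix X assume "X \<in> derivations"
  then show "X \<in> lie_algebra G2" using derivation_exp_G2 exp_lie_algebra by blast
qed

lemma lie_algebra_SU3: "X \<in> derivations \<Longrightarrow> blinfun_apply X oct_i = 0 \<Longrightarrow> X \<in> lie_algebra SU3"
  by (rule exp_lie_algebra) (simp add: SU3_iff derivation_exp_G2 endo_exp_fixes)

text \<open>The multiplier \<open>v\<close> in \<open>c (w x) = v (c x)\<close> is \<open>c(w)\<close> times the conjugate of \<open>c(1)\<close>, so it is as
  differentiable as the curve \<open>c\<close>, and its derivative is the required \<open>w'\<close>.\<close>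

lemma lie_algebra_Spin7: "lie_algebra Spin7 \<subseteq> spin7_lie"
proof
  fix X assume "X \<in> lie_algebra Spin7"
  then obtain c where c: "\<forall>t. c t \<in> Spin7" "c 0 = id_blinfun"
    "\<forall>x. ((\<lambda>t. blinfun_apply (c t) x) has_vector_derivative blinfun_apply X x) (at 0)"
    using lie_algebra_curve by metis
  have "\<exists>w'\<in>imaginary. \<forall>x. blinfun_apply X (omult w x) = omult w' x + omult w (blinfun_apply X x)"
    if w: "w \<in> imaginary" for w
  proof -
    define v where "v t = omult (blinfun_apply (c t) w) (ocnj (blinfun_apply (c t) oct_one))" for t
    have v: "v t \<in> imaginary" "blinfun_apply (c t) (omult w x) = omult (v t) (blinfun_apply (c t) x)" for t x
    proof -
      obtain v' where v': "v' \<in> imaginary" "\<forall>x. blinfun_apply (c t) (omult w x) = omult v' (blinfun_apply (c t) x)"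
        using Spin7_intertwines[OF c(1)[rule_format] w] by blast
      have "v t = v'"
        using v'(2)[rule_format, of oct_one] Spin7_orthogonal[OF c(1)[rule_format], of t oct_one oct_one]
        by (simp add: v_def ocnj_omult_right oct_one_inner)
      then show "v t \<in> imaginary" "blinfun_apply (c t) (omult w x) = omult (v t) (blinfun_apply (c t) x)" using v' by simp_all
    qed
    define w' where "w' = omult (blinfun_apply (c 0) w) (ocnj (blinfun_apply X oct_one)) + omult (blinfun_apply X w) (ocnj (blinfun_apply (c 0) oct_one))"
    have Dv: "(v has_vector_derivative w') (at 0)"
      unfolding v_def w'_def
      by (rule bounded_bilinear.has_vector_derivative[OF bounded_bilinear_omult c(3)[rule_format]
            bounded_linear.has_vector_derivative[OF bounded_linear_ocnj c(3)[rule_format]]])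
    have "((\<lambda>t. v t \<bullet> oct_one) has_vector_derivative w' \<bullet> oct_one) (at 0)"
      by (rule bounded_linear.has_vector_derivative[OF bounded_linear_inner_left Dv])
    then have wi: "w' \<in> imaginary"
      using v(1) by (simp add: imaginary_iff has_vector_derivative_const_iff)
    have v0: "v 0 = w" by (simp add: v_def c(2) ocnj_alt oct_one_inner scaleR_2)
    have "blinfun_apply X (omult w x) = omult w' x + omult w (blinfun_apply X x)" for x
    proof -
      have "((\<lambda>t. omult (v t) (blinfun_apply (c t) x)) has_vector_derivative
          (omult (v 0) (blinfun_apply X x) + omult w' (blinfun_apply (c 0) x))) (at 0)"
        by (rule bounded_bilinear.has_vector_derivative[OF bounded_bilinear_omult Dv c(3)[rule_format]])
      then show ?thesis
        using c(3) vector_derivative_unique_at by (simp add: v(2)[symmetric] v0 c(2) add.commute) blast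
    qed
    then show ?thesis using wi by blast
  qed
  then show "X \<in> spin7_lie" by (simp add: spin7_lie_def)
qed

lemma spin7_lieD:
  assumes "X \<in> spin7_lie" "w \<in> imaginary"
  obtains w' where "w' \<in> imaginary" "\<And>x. blinfun_apply X (omult w x) = omult w' x + omult w (blinfun_apply X x)"
proof -
  have "\<exists>w'\<in>imaginary. \<forall>x. blinfun_apply X (omult w x) = omult w' x + omult w (blinfun_apply X x)"
    using assms by (simp add: spin7_lie_def)
  then show ?thesis using that by blast
qed

text \<open>As for the groups, evaluation at \<open>1\<close> identifies \<open>w'\<close> as \<open>X w\<close>, and a derivation exponentiates
  into \<^const>\<open>G2\<close>.\<close>

lemma spin7_lie_isotropy:
  assumes X: "X \<in> spin7_lie" and 1: "blinfun_apply X oct_one = 0"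
  shows "X \<in> lie_algebra G2"
proof -
  have im: "blinfun_apply X (omult w x) = omult (blinfun_apply X w) x + omult w (blinfun_apply X x)"
    if w: "w \<in> imaginary" for w x
  proof -
    obtain w' where w': "\<And>x. blinfun_apply X (omult w x) = omult w' x + omult w (blinfun_apply X x)"
      using spin7_lieD[OF X w] by metis
    from w'[of oct_one] have "w' = blinfun_apply X w" by (simp add: 1 O.zero_right)
    with w' show ?thesis by simp
  qed
  have "blinfun_apply X (omult x y) = omult (blinfun_apply X x) y + omult x (blinfun_apply X y)" for x y
  proof -
    obtain r u where x: "x = r *\<^sub>R oct_one + u" "u \<in> imaginary" by (rule oct_decompose)
    show ?thesis
      by (simp add: x(1) O.add_left O.scaleR_left blinfun.add_right blinfun.scaleR_right 1 im[OF x(2)])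
  qed
  then show ?thesis by (simp add: lie_algebra_G2 derivations_def)
qed

lemma spin7_lie_diff: "X \<in> spin7_lie \<Longrightarrow> Y \<in> spin7_lie \<Longrightarrow> X - Y \<in> spin7_lie"
  and spin7_lie_commutator: "X \<in> spin7_lie \<Longrightarrow> Y \<in> spin7_lie \<Longrightarrow> commutator X Y \<in> spin7_lie"
proof -
  assume X: "X \<in> spin7_lie" and Y: "Y \<in> spin7_lie"
  have "\<exists>w'\<in>imaginary. \<forall>x. blinfun_apply (X - Y) (omult w x) = omult w' x + omult w (blinfun_apply (X - Y) x)"
    if w: "w \<in> imaginary" for w
  proof -
    obtain u v where u: "u \<in> imaginary" "\<And>x. blinfun_apply X (omult w x) = omult u x + omult w (blinfun_apply X x)"
      and v: "v \<in> imaginary" "\<And>x. blinfun_apply Y (omult w x) = omult v x + omult w (blinfun_apply Y x)"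
      using spin7_lieD[OF X w] spin7_lieD[OF Y w] by metis
    show ?thesis
      by (rule bexI[of _ "u - v"]) (use u v in \<open>simp_all add: blinfun.diff_left O.diff_left O.diff_right subspace_diff[OF subspace_imaginary]\<close>)
  qed
  then show "X - Y \<in> spin7_lie" by (simp add: spin7_lie_def)
  have "\<exists>w'\<in>imaginary. \<forall>x. blinfun_apply (commutator X Y) (omult w x) = omult w' x + omult w (blinfun_apply (commutator X Y) x)"
    if w: "w \<in> imaginary" for w
  proof -
    obtain u v where u: "u \<in> imaginary" "\<And>x. blinfun_apply X (omult w x) = omult u x + omult w (blinfun_apply X x)"
      and v: "v \<in> imaginary" "\<And>x. blinfun_apply Y (omult w x) = omult v x + omult w (blinfun_apply Y x)"
      using spin7_lieD[OF X w] spin7_lieD[OF Y w] by metis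
    obtain u' v' where u': "u' \<in> imaginary" "\<And>x. blinfun_apply X (omult v x) = omult u' x + omult v (blinfun_apply X x)"
      and v': "v' \<in> imaginary" "\<And>x. blinfun_apply Y (omult u x) = omult v' x + omult u (blinfun_apply Y x)"
      using spin7_lieD[OF X v(1)] spin7_lieD[OF Y u(1)] by metis
    show ?thesis
      by (rule bexI[of _ "u' - v'"])
        (use u v u' v' in \<open>simp_all add: blinfun_apply_commutator blinfun.add_right O.diff_left O.diff_right O.add_right subspace_diff[OF subspace_imaginary]\<close>)
  qed
  then show "commutator X Y \<in> spin7_lie" by (simp add: spin7_lie_def)
qed

lemma derivations_diff: "X \<in> derivations \<Longrightarrow> Y \<in> derivations \<Longrightarrow> X - Y \<in> derivations"
  and derivations_commutator: "X \<in> derivations \<Longrightarrow> Y \<in> derivations \<Longrightarrow> commutator X Y \<in> derivations"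
  by (simp_all add: derivations_def blinfun.diff_left O.diff_left O.diff_right blinfun_apply_commutator
      blinfun.add_right O.add_right O.add_left)

text \<open>Twice the derivation with value \<open>(0, u)\<close> at \<open>i\<close> that depends on \<open>u\<close> in an SU(3)-equivariant
  way. Equivariance leaves the ansatz \<open>(a, v) \<mapsto> (- i Re\<langle>v, u\<rangle>, Im(a) u + \<kappa> cnj(u \<times> v))\<close>, and the
  Leibniz rule for the product of \<open>i\<close> and \<open>v\<close> forces \<open>\<kappa> = i/2\<close>. The factor two avoids fractions.\<close>

definition G2_derivation :: "complex^3 \<Rightarrow> octonion endo" where
  "G2_derivation u = Blinfun (\<lambda>x. (- \<i> * (herm (snd x) u + cnj (herm (snd x) u)),
     (- \<i> * (fst x - cnj (fst x))) *s u + \<i> *s conj_cross u (snd x)))"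

lemma G2_derivation_apply: "blinfun_apply (G2_derivation u) x = (- \<i> * (herm (snd x) u + cnj (herm (snd x) u)),
     (- \<i> * (fst x - cnj (fst x))) *s u + \<i> *s conj_cross u (snd x))"
proof -
  have "linear (\<lambda>x::octonion. (- \<i> * (herm (snd x) u + cnj (herm (snd x) u)),
     (- \<i> * (fst x - cnj (fst x))) *s u + \<i> *s conj_cross u (snd x)))"
    by (rule linearI) (simp_all add: oct_eq_iff herm_def scaleR_conv_of_real[where 'a=complex] algebra_simps)
  then show ?thesis by (simp add: G2_derivation_def bounded_linear_Blinfun_apply linear_conv_bounded_linear)
qed

lemma G2_derivation: "G2_derivation u \<in> derivations"
  unfolding derivations_def
  by (simp add: G2_derivation_apply oct_eq_iff herm_def omult_simps) (simp add: algebra_simps)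

lemma lie_algebra_G2_onto:
  assumes "fst x = 0"
  shows "\<exists>X\<in>lie_algebra G2. blinfun_apply X oct_i = x"
proof -
  have "blinfun_apply (G2_derivation ((1 / 2) *\<^sub>R snd x)) oct_i = x"
    using assms by (simp add: G2_derivation_apply oct_eq_iff oct_i_def herm_def complex_eq_iff)
  then show ?thesis using G2_derivation lie_algebra_G2 by blast
qed

section \<open>The 7-sphere\<close>

text \<open>Up to the factor \<open>s\<close>, the triple cross product of \<open>x\<close>, \<open>p\<close> and \<open>y\<close>. For tangent \<open>x\<close> and \<open>y\<close> the
  normal component of the product is \<open>- \<langle>x, y\<rangle> p\<close>; the second term removes it.\<close>

definition S7_tensor :: "real \<Rightarrow> octonion \<Rightarrow> octonion \<Rightarrow> octonion \<Rightarrow> octonion" where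
  "S7_tensor s p x y = s *\<^sub>R (omult (omult x (ocnj p)) y + (x \<bullet> y) *\<^sub>R p)"

interpretation S7: unit_sphere "\<lambda>x. x" S7
  by (rule unit_sphere.intro) (auto simp: S7_def bounded_linear_ident)

lemma S7_tgt: "S7.tgt oct_one = imaginary"
  by (auto simp: S7.tgt_def imaginary_iff)

definition imaginary_part :: "octonion \<Rightarrow> octonion" where
  "imaginary_part x = x - (x \<bullet> oct_one) *\<^sub>R oct_one"

lemma imaginary_part_iff: "imaginary_part x = x \<longleftrightarrow> x \<in> imaginary"
proof -
  have "oct_one \<noteq> 0" using oct_one_inner by auto
  then show ?thesis by (simp add: imaginary_part_def imaginary_iff)
qed

interpretation S6: unit_sphere imaginary_part S6
proof (rule unit_sphere.intro)
  show "bounded_linear imaginary_part"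
    unfolding imaginary_part_def
    by (intro bounded_linear_intros)
  show "imaginary_part (imaginary_part x) = imaginary_part x" for x
    by (simp add: imaginary_part_def inner_diff_left oct_one_inner)
  show "S6 = {x. imaginary_part x = x \<and> norm x = 1}"
    by (auto simp: imaginary_part_iff S6_def)
qed

lemma S6_tgt: "v \<in> S6.tgt oct_i \<longleftrightarrow> fst v = 0"
  by (auto simp: S6.tgt_def imaginary_part_iff imaginary_def inner_oct oct_i_def complex_eq_iff)

text \<open>Products of two Clifford generators give the curve. For \<open>a\<close> orthogonal to \<open>u\<close> and a curve \<open>c\<close> in
  the 6-sphere through \<open>a\<close> with velocity \<open>a u\<close>, the product of the generators \<open>- a\<close> and \<open>c(t)\<close> starts at
  the identity and moves \<open>1\<close> with velocity \<open>- a (a u) = u\<close>.\<close>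

lemma lie_algebra_Spin7_onto:
  assumes u: "u \<in> imaginary"
  shows "\<exists>X\<in>lie_algebra Spin7. blinfun_apply X oct_one = u"
proof -
  obtain a where a: "norm a = 1" "a \<bullet> oct_one = 0" "a \<bullet> u = 0"
    using orthogonal_to_four[of oct_one u u u] by metis
  have ai: "a \<in> imaginary" and aa: "a \<bullet> a = 1" using a by (simp_all add: imaginary_iff norm_eq_1)
  have "omult a u \<in> imaginary" by (rule imaginary_omult[OF ai u a(3)])
  moreover have "omult a u \<bullet> a = 0"
    using u by (simp add: imaginary_alt(3)[OF ai] imaginary_alt(5)[OF ai] aa imaginary_iff)
  ultimately have "omult a u \<in> tangent_space S6 a"
    using S6.tangent_space_eq[of a] ai a(1) by (simp add: S6_def S6.tgt_def imaginary_part_iff)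
  then obtain c where c: "\<And>t. c t \<in> S6" "c 0 = a" "(c has_vector_derivative omult a u) (at 0)"
    by (auto simp: tangent_space_def curve_at_def)
  define C where "C t = Lmul (- a) o\<^sub>L Lmul (c t)" for t
  have "bounded_linear (\<lambda>z. Lmul (- a) o\<^sub>L Lmul z)"
    unfolding linear_conv_bounded_linear[symmetric]
    by (rule linearI; rule blinfun_eqI) (simp_all add: blinfun.add_left blinfun.scaleR_left O.add_left O.add_right O.scaleR_left O.scaleR_right)
  from bounded_linear.has_vector_derivative[OF this c(3)]
  have "(C has_vector_derivative Lmul (- a) o\<^sub>L Lmul (omult a u)) (at 0)" unfolding C_def .
  moreover have "C t \<in> Spin7" for t
    unfolding C_def using c(1)[of t] ai a(1) by (intro Spin7_compose Lmul_Spin7) (simp_all add: S6_def imaginary_iff)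
  moreover have "C 0 = id_blinfun"
    by (rule blinfun_eqI) (simp add: C_def c(2) O.minus_left imaginary_alt(1)[OF ai] aa)
  ultimately have "Lmul (- a) o\<^sub>L Lmul (omult a u) \<in> lie_algebra Spin7"
    unfolding lie_algebra_def tangent_space_def curve_at_def by (auto intro!: exI[of _ C])
  moreover have "blinfun_apply (Lmul (- a) o\<^sub>L Lmul (omult a u)) oct_one = u"
    by (simp add: O.minus_left imaginary_alt(1)[OF ai] aa)
  ultimately show ?thesis by blast
qed

lemma S7_tensor_one:
  "x \<in> imaginary \<Longrightarrow> S7_tensor s oct_one x y = s *\<^sub>R (omult x y + (x \<bullet> y) *\<^sub>R oct_one)"
  by (simp add: S7_tensor_def ocnj_alt oct_one_inner scaleR_2)

text \<open>The Clifford multiplier carrying \<open>p\<close> to a tangent vector \<open>x\<close> is \<open>x\<close> times the conjugate of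
  \<open>p\<close>; since Spin(7) permutes Clifford multipliers, the tensor is invariant.\<close>

lemma S7_tensor_equivariant:
  assumes g: "g \<in> Spin7" and p: "norm p = 1" and x: "x \<bullet> p = 0"
  shows "S7_tensor s (blinfun_apply g p) (blinfun_apply g x) (blinfun_apply g y) = blinfun_apply g (S7_tensor s p x y)"
proof -
  have pp: "p \<bullet> p = 1" using p by (simp add: norm_eq_1)
  have "omult x (ocnj p) \<in> imaginary" using x by (simp add: imaginary_iff inner_omult_right)
  then obtain v where v: "\<And>z. blinfun_apply g (omult (omult x (ocnj p)) z) = omult v (blinfun_apply g z)"
    using Spin7_intertwines[OF g] by blast
  have "omult (omult x (ocnj p)) p = x" using ocnj_omult_right[of x "ocnj p"] pp by (simp add: ocnj_def inner_prod_def inner_complex_def)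
  then have "blinfun_apply g x = omult v (blinfun_apply g p)" using v[of p] by simp
  then have "omult (blinfun_apply g x) (ocnj (blinfun_apply g p)) = v"
    by (simp add: ocnj_omult_right Spin7_orthogonal[OF g] pp)
  then show ?thesis
    by (simp add: S7_tensor_def blinfun.add_right blinfun.scaleR_right v Spin7_orthogonal[OF g])
qed

interpretation S7: homogeneous_sphere_lie "\<lambda>x. x" S7 Spin7 G2 oct_one S7_tensor spin7_lie
proof (intro homogeneous_sphere_lie.intro homogeneous_sphere.intro homogeneous_sphere_axioms.intro
    homogeneous_sphere_lie_axioms.intro)
  show "unit_sphere (\<lambda>x. x) S7" by (rule S7.unit_sphere_axioms)
  show "homogeneous_space Spin7 G2 S7 oct_one" by (rule S7_homogeneous)
  show "S7.symmetry (blinfun_apply g)" if "g \<in> Spin7" for g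
    using that by (simp add: S7.symmetry_def Spin7_def)
  show "\<exists>k\<in>G2. blinfun_apply k x = y"
    if xy: "x \<in> S7.tgt oct_one" "y \<in> S7.tgt oct_one" and n: "norm x = norm y" for x y
  proof (cases "x = 0")
    case True
    then show ?thesis using n by (intro bexI[of _ id_blinfun]) (simp_all add: id_G2)
  next
    case False
    then have "y \<noteq> 0" using n by auto
    then obtain g where g: "g \<in> G2" "blinfun_apply g (x /\<^sub>R norm x) = y /\<^sub>R norm y"
      using G2_swap[of "x /\<^sub>R norm x" "y /\<^sub>R norm y"] False xy
      by (auto simp: S7_tgt subspace_scale[OF subspace_imaginary])
    then have "blinfun_apply g x = y" using False \<open>y \<noteq> 0\<close> n by (simp add: blinfun.scaleR_right)
    then show ?thesis using g(1) by blast
  qed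
  show "bilinear (S7_tensor s p)" for s p
    unfolding bilinear_def S7_tensor_def
    by (intro conjI allI linearI)
      (simp_all add: O.add_left O.add_right O.scaleR_left O.scaleR_right inner_add_left inner_add_right algebra_simps)
  show "linear (\<lambda>s. S7_tensor s p x y)" for p x y
    by (rule linearI) (simp_all add: S7_tensor_def scaleR_add_left)
  have sk: "S7_tensor s oct_one x y \<bullet> z = s * (omult x y \<bullet> z)"
    if "x \<in> imaginary" "z \<in> imaginary" for s x y z
    using that inner_commute[of oct_one z] by (simp add: S7_tensor_one inner_add_left imaginary_iff)
  show "S7_tensor s oct_one x y \<in> S7.tgt oct_one" if "x \<in> S7.tgt oct_one" "y \<in> S7.tgt oct_one" for s x y
    using that imaginary_alt(3)[of x y oct_one] inner_commute[of y x] unfolding S7_tgt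
    by (simp add: S7_tensor_one imaginary_iff[of "_ *\<^sub>R _"] inner_add_left oct_one_inner)
  show "S7_tensor s (blinfun_apply g p) (blinfun_apply g x) (blinfun_apply g y) = blinfun_apply g (S7_tensor s p x y)"
    if "g \<in> Spin7" "p \<in> S7" "x \<in> S7.tgt p" "y \<in> S7.tgt p" for s g p x y
    using that by (intro S7_tensor_equivariant) (simp_all add: S7_def S7.tgt_def)
  show "smooth_on S7 (\<lambda>p. S7_tensor s p (X p) (Y p))" if "X \<in> vector_fields S7" "Y \<in> vector_fields S7" for s X Y
    unfolding S7_tensor_def
    by (intro smooth_on_add smooth_on_scaleR smooth_on_inner
        smooth_on_bilinear[OF bounded_bilinear_omult] smooth_on_linear[OF bounded_linear_ocnj] smooth_on_id smooth_on_const
        S7.vector_fieldD(1)[OF that(1)] S7.vector_fieldD(1)[OF that(2)])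
  show "S7_tensor s oct_one x y \<bullet> z = - (y \<bullet> S7_tensor s oct_one x z)"
    if "x \<in> S7.tgt oct_one" "y \<in> S7.tgt oct_one" "z \<in> S7.tgt oct_one" for s x y z
    using that sk[of x z s y] sk[of x y s z] imaginary_alt(3)[of x y z] unfolding S7_tgt
    by (simp add: inner_commute)
  show "S7_tensor s oct_one x y = - S7_tensor s oct_one y x"
    if "x \<in> S7.tgt oct_one" "y \<in> S7.tgt oct_one" for s x y
  proof -
    have i: "x \<in> imaginary" "y \<in> imaginary" using that by (simp_all add: S7_tgt)
    have c: "omult x y = - omult y x - ((x \<bullet> y) *\<^sub>R oct_one + (x \<bullet> y) *\<^sub>R oct_one)"
      using clifford[OF i, of oct_one] by (simp only: omult_one mult_2 scaleR_add_left)
    have "omult x y + (x \<bullet> y) *\<^sub>R oct_one = - (omult y x + (y \<bullet> x) *\<^sub>R oct_one)"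
      unfolding c inner_commute[of y x] by simp
    then show ?thesis by (simp only: S7_tensor_one[OF i(1)] S7_tensor_one[OF i(2)] scaleR_minus_right)
  qed
  show "s = 0" if z: "\<And>x y. x \<in> S7.tgt oct_one \<Longrightarrow> y \<in> S7.tgt oct_one \<Longrightarrow> S7_tensor s oct_one x y = 0" for s
    using z[of oct_i e1] unfolding S7_tgt
    by (simp add: S7_tensor_one e1_simps oct_i_imaginary) (simp add: prod_eq_iff vec_eq_iff forall_3 axis_nth3)
  show "\<exists>s. \<forall>x\<in>S7.tgt oct_one. \<forall>y\<in>S7.tgt oct_one. \<beta> x y = S7_tensor s oct_one x y"
    if "equivariant_bilinear (S7.tgt oct_one) G2 \<beta>" for \<beta>
    using G2_bilinear_maps[OF that[unfolded S7_tgt]] unfolding S7_tgt by (simp add: S7_tensor_one)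
  show "lie_algebra Spin7 \<subseteq> spin7_lie" by (rule lie_algebra_Spin7)
  show "X - Y \<in> spin7_lie" "commutator X Y \<in> spin7_lie" if "X \<in> spin7_lie" "Y \<in> spin7_lie" for X Y
    using that by (rule spin7_lie_diff spin7_lie_commutator)+
  show "X \<in> lie_algebra G2" if "X \<in> spin7_lie" "blinfun_apply X oct_one = 0" for X
    using that by (rule spin7_lie_isotropy)
  show "\<exists>X\<in>lie_algebra Spin7. blinfun_apply X oct_one = x" if "x \<in> S7.tgt oct_one" for x
    using that unfolding S7_tgt by (rule lie_algebra_Spin7_onto)
  show "\<exists>x\<in>S7.tgt oct_one. \<forall>X\<in>spin7_lie. blinfun_apply X oct_one = x \<longrightarrow>
      (\<exists>v\<in>S7.tgt oct_one. blinfun_apply X v \<noteq> - (x \<bullet> v) *\<^sub>R oct_one)"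
    unfolding S7_tgt
  \<comment> \<open>otherwise \<open>e\<^sub>1\<close> would have the multiplier \<open>(0, i e\<^sub>1)\<close>, which fails on the product of \<open>e\<^sub>1\<close> and \<open>e\<^sub>2\<close>\<close>
  proof (rule bexI[of _ oct_i], intro ballI impI, rule ccontr)
    fix X assume X: "X \<in> spin7_lie" "blinfun_apply X oct_one = oct_i"
      and "\<not> (\<exists>v\<in>imaginary. blinfun_apply X v \<noteq> - (oct_i \<bullet> v) *\<^sub>R oct_one)"
    then have v: "blinfun_apply X (0, v) = 0" for v
      by (force simp: imaginary_def oct_i_def inner_prod_def)
    obtain w' where w': "\<And>x. blinfun_apply X (omult e1 x) = omult w' x + omult e1 (blinfun_apply X x)"
      using spin7_lieD[OF X(1) e1_simps(1)] by metis
    have Xe1: "blinfun_apply X e1 = 0" by (simp add: e1_def v)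
    have "omult e1 oct_i = - (0, axis 1 \<i>)"
      by (simp add: oct_eq_iff omult_simps e1_def oct_i_def axis_nth3)
    then have w1: "w' = (0, axis 1 \<i>)" using w'[of oct_one] by (simp add: Xe1 X(2) prod_eq_iff add_eq_0_iff)
    have "omult e1 (0, axis 2 1) = (0, axis 3 1)"
      by (simp add: oct_eq_iff omult_simps e1_def axis_nth3)
    then have "omult w' (0, axis 2 1) = 0" using w'[of "(0, axis 2 1)"] by (simp add: v O.zero_right)
    then show False unfolding w1 by (simp add: oct_eq_iff omult_simps axis_nth3)
  qed (simp add: oct_i_imaginary)
qed

section \<open>The 6-sphere\<close>

text \<open>The part of the product that is tangent to the 6-sphere at \<open>p\<close>, for tangent \<open>x\<close> and \<open>y\<close>.\<close>

definition S6_cross :: "octonion \<Rightarrow> octonion \<Rightarrow> octonion \<Rightarrow> octonion" where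
  "S6_cross p x y = omult x y + (x \<bullet> y) *\<^sub>R oct_one - (omult x y \<bullet> p) *\<^sub>R p"

text \<open>Left multiplication by \<open>p\<close> is the almost complex structure of the tangent space at \<open>p\<close>, so this is
  \<open>s\<close> times the cross product.\<close>

definition S6_tensor :: "complex \<Rightarrow> octonion \<Rightarrow> octonion \<Rightarrow> octonion \<Rightarrow> octonion" where
  "S6_tensor s p x y = Re s *\<^sub>R S6_cross p x y + Im s *\<^sub>R omult p (S6_cross p x y)"

lemma S6_tensor_i: "S6_tensor s oct_i (0, u) (0, v) = (0, s *s conj_cross u v)"
proof -
  have "S6_cross oct_i (0, u) (0, v) = (0, conj_cross u v)"
    by (simp add: S6_cross_def omult_herm inner_oct oct_one_def oct_i_def prod_eq_iff)
      (simp add: herm_def complex_eq_iff inner_prod_def inner_complex_def)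
  moreover have "omult oct_i (0, w) = (0, \<i> *s w)" for w
    by (simp add: oct_eq_iff omult_simps oct_i_def)
  ultimately show ?thesis
    by (simp add: S6_tensor_def vec_eq_iff forall_3 complex_eq_iff algebra_simps)
qed

lemma S6_tensor_equivariant:
  assumes g: "g \<in> G2"
  shows "S6_tensor s (blinfun_apply g p) (blinfun_apply g x) (blinfun_apply g y) = blinfun_apply g (S6_tensor s p x y)"
proof -
  have o: "blinfun_apply g x \<bullet> blinfun_apply g y = x \<bullet> y" for x y
    using G2_orthogonal[OF g] by (simp add: orthogonal_transformation_def)
  have "S6_cross (blinfun_apply g p) (blinfun_apply g x) (blinfun_apply g y) = blinfun_apply g (S6_cross p x y)"
    by (simp add: S6_cross_def blinfun.add_right blinfun.diff_right blinfun.scaleR_right G2_one[OF g] o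
        flip: G2_omult[OF g])
  then show ?thesis
    by (simp add: S6_tensor_def blinfun.add_right blinfun.scaleR_right G2_omult[OF g])
qed

lemma SU3_apply_pair: "k \<in> SU3 \<Longrightarrow> \<exists>A\<in>SU3_matrices. \<forall>u. blinfun_apply k (0, u) = (0, A *v u)"
  by (auto simp: SU3_def SU3_embed_apply)

lemma SU3_transitive:
  assumes "norm u = norm v"
  obtains k where "k \<in> SU3" "blinfun_apply k (0, u) = (0, v)"
proof (cases "u = 0")
  case True
  then show ?thesis using assms by (intro that[of id_blinfun]) (simp_all add: SU3_iff id_G2)
next
  case False
  then have vn: "v \<noteq> 0" using assms by auto
  obtain h where h: "h \<in> SU3" "blinfun_apply h (0, u /\<^sub>R norm u) = (0, axis 1 1)"
    using SU3_to_axis[of "u /\<^sub>R norm u"] False by auto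
  obtain k where k: "k \<in> SU3" "blinfun_apply k (0, v /\<^sub>R norm v) = (0, axis 1 1)"
    using SU3_to_axis[of "v /\<^sub>R norm v"] vn by auto
  obtain l where l: "l \<in> G2" "\<And>x. blinfun_apply l (blinfun_apply k x) = x"
    using G2_inverse k(1) by (metis SU3_iff)
  have "blinfun_apply l oct_i = oct_i" using l(2)[of oct_i] k(1) by (simp add: SU3_iff)
  then have lh: "l o\<^sub>L h \<in> SU3" using l(1) h(1) by (simp add: SU3_iff G2_compose)
  have "blinfun_apply (l o\<^sub>L h) (0, u /\<^sub>R norm u) = (0, v /\<^sub>R norm v)"
    using l(2)[of "(0, v /\<^sub>R norm v)"] by (simp add: h k)
  then have "blinfun_apply (l o\<^sub>L h) (norm u *\<^sub>R (0, u /\<^sub>R norm u)) = norm u *\<^sub>R (0, v /\<^sub>R norm v)"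
    by (simp only: blinfun.scaleR_right)
  then have "blinfun_apply (l o\<^sub>L h) (0, u) = (0, v)" using False vn assms by simp
  then show ?thesis using lh that by blast
qed

lemma fst_zero_pair: "fst x = 0 \<Longrightarrow> x = (0, snd x)"
  by (simp add: prod_eq_iff)

interpretation S6: homogeneous_sphere_lie imaginary_part S6 G2 SU3 oct_i S6_tensor derivations
proof (intro homogeneous_sphere_lie.intro homogeneous_sphere.intro homogeneous_sphere_axioms.intro
    homogeneous_sphere_lie_axioms.intro)
  show "unit_sphere imaginary_part S6" by (rule S6.unit_sphere_axioms)
  show "homogeneous_space G2 SU3 S6 oct_i" by (rule S6_homogeneous)
  show "S6.symmetry (blinfun_apply g)" if g: "g \<in> G2" for g
  proof -
    have "blinfun_apply g x \<bullet> oct_one = x \<bullet> oct_one" for x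
      using G2_orthogonal[OF g] G2_one[OF g] unfolding orthogonal_transformation_def by metis
    then show ?thesis
      using G2_orthogonal[OF g]
      by (simp add: S6.symmetry_def imaginary_part_def blinfun.diff_right blinfun.scaleR_right G2_one[OF g])
  qed
  show "\<exists>k\<in>SU3. blinfun_apply k x = y"
    if "x \<in> S6.tgt oct_i" "y \<in> S6.tgt oct_i" "norm x = norm y" for x y
  proof -
    have xy: "x = (0, snd x)" "y = (0, snd y)" using that by (simp_all add: S6_tgt prod_eq_iff)
    have "norm (snd x) = norm (snd y)" using that by (simp add: S6_tgt norm_prod_def)
    then obtain k where "k \<in> SU3" "blinfun_apply k (0, snd x) = (0, snd y)" using SU3_transitive by metis
    then show ?thesis using xy by metis
  qed
  show "bilinear (S6_tensor s p)" for s p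
    unfolding bilinear_def S6_tensor_def S6_cross_def
    by (intro conjI allI linearI)
      (simp_all add: O.add_left O.add_right O.diff_right O.scaleR_left O.scaleR_right inner_add_left inner_add_right algebra_simps)
  show "linear (\<lambda>s. S6_tensor s p x y)" for p x y
    by (rule linearI) (simp_all add: S6_tensor_def algebra_simps)
  show "S6_tensor s oct_i x y \<in> S6.tgt oct_i" if "x \<in> S6.tgt oct_i" "y \<in> S6.tgt oct_i" for s x y
    using that S6_tensor_i[of s "snd x" "snd y"] by (simp add: S6_tgt flip: fst_zero_pair)
  show "S6_tensor s (blinfun_apply g p) (blinfun_apply g x) (blinfun_apply g y) = blinfun_apply g (S6_tensor s p x y)"
    if "g \<in> G2" for s g p x y
    by (rule S6_tensor_equivariant[OF that])
  show "smooth_on S6 (\<lambda>p. S6_tensor s p (X p) (Y p))" if "X \<in> vector_fields S6" "Y \<in> vector_fields S6" for s X Y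
    unfolding S6_tensor_def S6_cross_def diff_conv_add_uminus
    by (intro smooth_on_add smooth_on_scaleR smooth_on_inner
        smooth_on_bilinear[OF bounded_bilinear_omult] smooth_on_linear[OF bounded_linear_minus[OF bounded_linear_ident]]
        smooth_on_id smooth_on_const
        S6.vector_fieldD(1)[OF that(1)] S6.vector_fieldD(1)[OF that(2)])
  show "S6_tensor s oct_i x y \<bullet> z = - (y \<bullet> S6_tensor s oct_i x z)"
    if "x \<in> S6.tgt oct_i" "y \<in> S6.tgt oct_i" "z \<in> S6.tgt oct_i" for s x y z
  proof -
    have e: "x = (0, snd x)" "y = (0, snd y)" "z = (0, snd z)" using that by (simp_all add: S6_tgt prod_eq_iff)
    have "S6_tensor s oct_i (0, u) (0, v) \<bullet> (0, w) = - (S6_tensor s oct_i (0, u) (0, w) \<bullet> (0, v))" for u v w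
      unfolding S6_tensor_i inner_oct by (simp add: algebra_simps)
    then show ?thesis by (subst e(1), subst e(2), subst e(3), subst e(1), subst e(2), subst e(3)) (metis inner_commute)
  qed
  show "S6_tensor s oct_i x y = - S6_tensor s oct_i y x"
    if "x \<in> S6.tgt oct_i" "y \<in> S6.tgt oct_i" for s x y
  proof -
    have e: "x = (0, snd x)" "y = (0, snd y)" using that by (simp_all add: S6_tgt prod_eq_iff)
    have "S6_tensor s oct_i (0, u) (0, v) = - S6_tensor s oct_i (0, v) (0, u)" for u v
      unfolding S6_tensor_i by (simp add: oct_eq_iff algebra_simps)
    then show ?thesis using e by metis
  qed
  show "s = 0" if z: "\<And>x y. x \<in> S6.tgt oct_i \<Longrightarrow> y \<in> S6.tgt oct_i \<Longrightarrow> S6_tensor s oct_i x y = 0" for s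
    using z[of "(0, axis 1 1)" "(0, axis 2 1)"]
    by (simp add: S6_tgt S6_tensor_i) (simp add: prod_eq_iff vec_eq_iff forall_3 axis_nth3)
  show "\<exists>s. \<forall>x\<in>S6.tgt oct_i. \<forall>y\<in>S6.tgt oct_i. \<beta> x y = S6_tensor s oct_i x y"
    if \<beta>: "equivariant_bilinear (S6.tgt oct_i) SU3 \<beta>" for \<beta>
  proof -
    define \<gamma> where "\<gamma> u v = snd (\<beta> (0, u) (0, v))" for u v
    have T: "(0, u) \<in> S6.tgt oct_i" for u by (simp add: S6_tgt)
    have \<beta>\<gamma>: "\<beta> (0, u) (0, v) = (0, \<gamma> u v)" for u v
      using equivariant_bilinearD(1)[OF \<beta> T T, of u v] by (simp add: \<gamma>_def S6_tgt prod_eq_iff)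
    have "bilinear \<gamma>"
      unfolding bilinear_def
    proof (intro conjI allI linearI)
      fix u u' v r
      show "\<gamma> (u + u') v = \<gamma> u v + \<gamma> u' v" using equivariant_bilinearD(2)[OF \<beta> T T T, of u u' v] by (simp add: \<beta>\<gamma>)
      show "\<gamma> v (u + u') = \<gamma> v u + \<gamma> v u'" using equivariant_bilinearD(3)[OF \<beta> T T T, of v u u'] by (simp add: \<beta>\<gamma>)
      show "\<gamma> (r *\<^sub>R u) v = r *\<^sub>R \<gamma> u v" using equivariant_bilinearD(4)[OF \<beta> T T, of r u v] by (simp add: \<beta>\<gamma>)
      show "\<gamma> v (r *\<^sub>R u) = r *\<^sub>R \<gamma> v u" using equivariant_bilinearD(5)[OF \<beta> T T, of v r u] by (simp add: \<beta>\<gamma>)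
    qed
    moreover have "\<gamma> (A *v u) (A *v v) = A *v \<gamma> u v" if "A \<in> SU3_matrices" for A u v
    proof -
      have "SU3_embed A \<in> SU3" using that by (simp add: SU3_def)
      from equivariant_bilinearD(6)[OF \<beta> T T this, of u v] show ?thesis by (simp add: SU3_embed_apply \<beta>\<gamma>)
    qed
    ultimately obtain c where "\<And>u v. \<gamma> u v = c *s conj_cross u v" using SU3_bilinear_maps by metis
    then have "\<beta> (0, u) (0, v) = S6_tensor c oct_i (0, u) (0, v)" for u v by (simp add: \<beta>\<gamma> S6_tensor_i)
    then show ?thesis by (metis S6_tgt fst_zero_pair)
  qed
  show "lie_algebra G2 \<subseteq> derivations" by (simp add: lie_algebra_G2)
  show "X - Y \<in> derivations" "commutator X Y \<in> derivations" if "X \<in> derivations" "Y \<in> derivations" for X Y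
    using that by (rule derivations_diff derivations_commutator)+
  show "X \<in> lie_algebra SU3" if "X \<in> derivations" "blinfun_apply X oct_i = 0" for X
    using that by (rule lie_algebra_SU3)
  show "\<exists>X\<in>lie_algebra G2. blinfun_apply X oct_i = x" if "x \<in> S6.tgt oct_i" for x
    using that unfolding S6_tgt by (rule lie_algebra_G2_onto)
  show "\<exists>x\<in>S6.tgt oct_i. \<forall>X\<in>derivations. blinfun_apply X oct_i = x \<longrightarrow>
      (\<exists>v\<in>S6.tgt oct_i. blinfun_apply X v \<noteq> - (x \<bullet> v) *\<^sub>R oct_i)"
  \<comment> \<open>otherwise the Leibniz rule fails on the product of \<open>i\<close> and \<open>e\<^sub>2\<close>\<close>
  proof (rule bexI[of _ e1], intro ballI impI, rule ccontr)
    fix X assume X: "X \<in> derivations" "blinfun_apply X oct_i = e1"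
      and "\<not> (\<exists>v\<in>S6.tgt oct_i. blinfun_apply X v \<noteq> - (e1 \<bullet> v) *\<^sub>R oct_i)"
    then have v: "blinfun_apply X (0, axis 2 z) = 0" for z
      by (simp add: S6_tgt e1_def inner_oct axis_nth3)
    have "omult oct_i (0, axis 2 1) = (0, axis 2 \<i>)"
      by (simp add: oct_eq_iff omult_simps oct_i_def axis_nth3)
    then have "omult e1 (0, axis 2 1) = 0"
      using X v unfolding derivations_def by (metis (mono_tags, lifting) CollectD O.zero_right add.right_neutral)
    then show False by (simp add: oct_eq_iff omult_simps e1_def axis_nth3)
  qed (simp add: S6_tgt e1_def)
qed

text \<open>A diagonal matrix that fixes \<open>e\<^sub>1\<close> and negates the other axes shows that \<open>e\<^sub>1\<close> is mapped to a
  multiple of itself; transitivity on vectors of equal norm propagates the factor.\<close>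

lemma SU3_linear_maps:
  fixes f :: "complex^3 \<Rightarrow> complex^3"
  assumes lin: "linear f" and eq: "\<And>A u. A \<in> SU3_matrices \<Longrightarrow> f (A *v u) = A *v f u"
  shows "\<exists>c. \<forall>u. f u = c *s u"
proof -
  define c where "c = f (axis 1 1) $ 1"
  have d: "diag3 1 (-1) (-1) \<in> SU3_matrices" by (simp add: diag3_SU3)
  have "diag3 1 (-1) (-1) *v axis 1 1 = axis 1 1" by (simp add: vec_eq_iff forall_3 diag3_mult axis_nth3)
  then have "f (axis 1 1) = diag3 1 (-1) (-1) *v f (axis 1 1)" using eq[OF d, of "axis 1 1"] by simp
  then have f1: "f (axis 1 1) = c *s axis 1 1"
    by (simp add: c_def vec_eq_iff forall_3 diag3_mult axis_nth3)
  have "f u = c *s u" for u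
  proof -
    obtain k where "k \<in> SU3" "blinfun_apply k (0, norm u *\<^sub>R axis 1 1) = (0, u)"
      using SU3_transitive[of "norm u *\<^sub>R axis 1 1" u] by auto
    then obtain A where A: "A \<in> SU3_matrices" "A *v (norm u *\<^sub>R axis 1 1) = u"
      using SU3_apply_pair by force
    have "f u = A *v (norm u *\<^sub>R f (axis 1 1))"
      using eq[OF A(1), of "norm u *\<^sub>R axis 1 1"] A(2) by (simp add: linear_cmul[OF lin])
    also have "norm u *\<^sub>R f (axis 1 1) = c *s (norm u *\<^sub>R axis 1 1)"
      by (simp add: f1 vec_eq_iff)
    finally show ?thesis by (simp only: vector_scalar_commute A(2))
  qed
  then show ?thesis by blast
qed

text \<open>In terms of tangent vectors at \<open>i\<close> the module isomorphism is multiplication by a constant, which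
  commutes with the scalar \<open>a\<close>.\<close>

lemma complex_scale_at_oct_i:
  assumes m: "reductive_decomposition G2 SU3 m" and \<phi>: "standard_SU3_module_iso \<phi> m" and Z: "Z \<in> m"
    and Zi: "blinfun_apply Z oct_i = (0, w)"
  shows "complex_scale \<phi> a Z \<in> m" "blinfun_apply (complex_scale \<phi> a Z) oct_i = (0, a *s w)"
proof -
  have \<phi>': "linear \<phi>" "bij_betw \<phi> UNIV m" "\<And>A u. A \<in> SU3_matrices \<Longrightarrow> \<phi> (A *v u) = Ad (SU3_embed A) (\<phi> u)"
    using \<phi> by (simp_all add: standard_SU3_module_iso_def)
  have rng: "\<phi> u \<in> m" for u using \<phi>'(2) by (auto simp: bij_betw_def)
  define f where "f u = snd (blinfun_apply (\<phi> u) oct_i)" for u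
  have \<phi>f: "blinfun_apply (\<phi> u) oct_i = (0, f u)" for u
    using S6.m_tgt[OF m rng[of u]] by (simp add: f_def S6_tgt prod_eq_iff)
  have "linear f"
    unfolding f_def by (rule linearI) (simp_all add: linear_add[OF \<phi>'(1)] linear_cmul[OF \<phi>'(1)] blinfun.add_left blinfun.scaleR_left)
  moreover have "f (A *v u) = A *v f u" if "A \<in> SU3_matrices" for A u
  proof -
    have k: "SU3_embed A \<in> SU3" using that by (simp add: SU3_def)
    then have "blinfun_apply (SU3_embed A) oct_i = oct_i" by (simp add: SU3_iff)
    then have "blinfun_apply (\<phi> (A *v u)) oct_i = blinfun_apply (SU3_embed A) (blinfun_apply (\<phi> u) oct_i)"
      using S6.blinfun_apply_Ad[OF m k, of "\<phi> u" oct_i] by (simp add: \<phi>'(3)[OF that])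
    then show ?thesis by (simp add: \<phi>f SU3_embed_apply)
  qed
  ultimately obtain c where c: "\<And>u. f u = c *s u" using SU3_linear_maps by metis
  obtain u where u: "Z = \<phi> u" using Z \<phi>'(2) by (auto simp: bij_betw_def)
  have "inv \<phi> Z = u" using \<phi>'(2) by (simp add: u bij_betw_def inv_f_f)
  then have s: "complex_scale \<phi> a Z = \<phi> (a *s u)" by (simp add: complex_scale_def)
  show "complex_scale \<phi> a Z \<in> m" by (simp add: s rng)
  have "w = c *s u" using Zi by (simp add: u \<phi>f c)
  then show "blinfun_apply (complex_scale \<phi> a Z) oct_i = (0, a *s w)"
    by (simp add: s \<phi>f c vector_smult_assoc mult.commute)
qed

section \<open>Invariant connections on the spheres\<close>

theorem theorem3p4:
  shows
    "homogeneous_space Spin7 G2 S7 oct_one \<and>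
     (\<forall>m. reductive_decomposition Spin7 G2 m \<longrightarrow>
        bij_betw (nomizu_map S7 oct_one m) (invariant_connections Spin7 S7)
          (range (\<lambda>\<alpha>::real. Lambda_alpha scaleR G2 m \<alpha>))) \<and>
     (\<forall>g. invariant_metric Spin7 S7 g \<longrightarrow>
        {D \<in> invariant_connections Spin7 S7. metric_connection S7 g D} =
          invariant_connections Spin7 S7) \<and>
     affine_dimension (invariant_connections Spin7 S7) = 1 \<and>
     homogeneous_space G2 SU3 S6 oct_i \<and>
     (\<forall>m \<phi>. reductive_decomposition G2 SU3 m \<and> standard_SU3_module_iso \<phi> m \<longrightarrow>
        bij_betw (nomizu_map S6 oct_i m) (invariant_connections G2 S6)
          (range (\<lambda>\<alpha>::complex. Lambda_alpha (complex_scale \<phi>) SU3 m \<alpha>))) \<and>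
     (\<forall>g. invariant_metric G2 S6 g \<longrightarrow>
        {D \<in> invariant_connections G2 S6. metric_connection S6 g D} =
          invariant_connections G2 S6) \<and>
     affine_dimension (invariant_connections G2 S6) = 2"
proof (intro conjI allI impI)
  show "homogeneous_space Spin7 G2 S7 oct_one" by (rule S7_homogeneous)
  show "homogeneous_space G2 SU3 S6 oct_i" by (rule S6_homogeneous)
  show "affine_dimension (invariant_connections Spin7 S7) = 1"
    by (simp add: S7.affine_dimension_invariant_connections)
  show "affine_dimension (invariant_connections G2 S6) = 2"
    by (simp add: S6.affine_dimension_invariant_connections)
  show "{D \<in> invariant_connections Spin7 S7. metric_connection S7 g D} = invariant_connections Spin7 S7"
    if "invariant_metric Spin7 S7 g" for g
    by (rule S7.invariant_connections_metric[OF that])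
  show "{D \<in> invariant_connections G2 S6. metric_connection S6 g D} = invariant_connections G2 S6"
    if "invariant_metric G2 S6 g" for g
    by (rule S6.invariant_connections_metric[OF that])
  show "bij_betw (nomizu_map S7 oct_one m) (invariant_connections Spin7 S7)
          (range (\<lambda>\<alpha>::real. Lambda_alpha scaleR G2 m \<alpha>))"
    if m: "reductive_decomposition Spin7 G2 m" for m
  proof (rule S7.nomizu_map_bij[OF m])
    fix a s :: real and Z x y
    assume "Z \<in> m" "blinfun_apply Z oct_one = S7_tensor s oct_one x y"
    then show "a *\<^sub>R Z \<in> m \<and> blinfun_apply (a *\<^sub>R Z) oct_one = S7_tensor (a * s) oct_one x y"
      using S7.m_subspace[OF m] by (simp add: subspace_scale blinfun.scaleR_left S7_tensor_def)
  qed
  show "bij_betw (nomizu_map S6 oct_i m) (invariant_connections G2 S6)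
          (range (\<lambda>\<alpha>::complex. Lambda_alpha (complex_scale \<phi>) SU3 m \<alpha>))"
    if m\<phi>: "reductive_decomposition G2 SU3 m \<and> standard_SU3_module_iso \<phi> m" for m \<phi>
  proof (rule S6.nomizu_map_bij[OF m\<phi>[THEN conjunct1]])
    fix a s :: complex and Z x y
    assume Z: "Z \<in> m" and x: "x \<in> S6.tgt oct_i" and y: "y \<in> S6.tgt oct_i"
      and Zi: "blinfun_apply Z oct_i = S6_tensor s oct_i x y"
    have T: "S6_tensor r oct_i x y = (0, r *s conj_cross (snd x) (snd y))" for r
      using S6_tensor_i[of r "snd x" "snd y"] x y by (simp add: S6_tgt flip: fst_zero_pair)
    show "complex_scale \<phi> a Z \<in> m \<and> blinfun_apply (complex_scale \<phi> a Z) oct_i = S6_tensor (a * s) oct_i x y"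
      using complex_scale_at_oct_i[OF m\<phi>[THEN conjunct1] m\<phi>[THEN conjunct2] Z Zi[unfolded T], of a]
      by (simp add: T vector_smult_assoc)
  qed
qed

end
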